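(* Let $\phi^0:[-1,1]\to\mathbb R$ be $C^2$ with $\phi^0(\pm1)=0$ and with finitely many changes of monotonicity (extend $\phi^0(y)=0$ for $y>1$). For $L\in\mathbb N$ let $\Phi_0(x)=L\phi^0(x/L)$ and $h^0_x=\lfloor\Phi_0(x)\rfloor$ for $x\in\{-L,\dots,L+1\}$, let $(h(t))_{t\ge0}$ be the Markov chain on $\Omega_L$ with generator $\mathcal L$ below started from $h^0$, and let $\Phi$ solve the system of ODEs below. Then for every $t\ge0$, $$\lim_{L\to\infty}\max_{x\in\{-L,\dots,L+1\}}\frac1L\big|h_x(L^2t)-\Phi(x,L^2t)\big|=0\quad\text{in probability.}$$
   Context: $\Omega_L=\{h:\{-L,\dots,L+1\}\to\mathbb Z\}$. For $h\in\Omega_L$ and $x\in\{-L+1,\dots,L\}$, $h^{\pm,x}$ agrees with $h$ off $x$ and $h^{\pm,x}_x=h_x\pm1$. The generator is $\mathcal Lf(h)=\frac12\sum_{x=-L+1}^{L}\big[c^{+,x}(h)(f(h^{+,x})-f(h))+c^{-,x}(h)(f(h^{-,x})-f(h))\big]$ with $c^{+,x}(h)=\mathbf 1_{\{h_{x+1}>h_x\}}+\mathbf 1_{\{h_{x-1}>h_x\}}$ and $c^{-,x}(h)=\mathbf 1_{\{h_{x+1}<h_x\}}+\mathbf 1_{\{h_{x-1}<h_x\}}$ (so $h_{-L},h_{L+1}$ are fixed in time). With $\sigma(u)=u/(1+|u|)$ and $q_x(t)=\Phi(x+1,t)-\Phi(x,t)$, $\Phi:\{-L,\dots,L+1\}\times\mathbb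 R_+\to\mathbb R$ solves $\partial_t\Phi(x,t)=\frac12[\sigma(q_x(t))-\sigma(q_{x-1}(t))]$ for $x\in\{-L+1,\dots,L\}$, $\Phi(-L,t)=\Phi(L+1,t)=0$, $\Phi(x,0)=\Phi_0(x)$. *)

theory Defs
  imports "HOL-Analysis.Analysis"
begin

text \<open>States of Omega_L are represented as functions int => int; only the values on
  {-L..L+1} are relevant (the generator only reads/changes those coordinates).\<close>

definition sigma :: "real \<Rightarrow> real" where
  "sigma u = u / (1 + \<bar>u\<bar>)"

definition cplus :: "(int \<Rightarrow> int) \<Rightarrow> int \<Rightarrow> real" where
  "cplus h x = (if h (x+1) > h x then 1 else 0) + (if h (x-1) > h x then 1 else 0)"

definition cminus :: "(int \<Rightarrow> int) \<Rightarrow> int \<Rightarrow> real" where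
  "cminus h x = (if h (x+1) < h x then 1 else 0) + (if h (x-1) < h x then 1 else 0)"

definition gen :: "nat \<Rightarrow> ((int \<Rightarrow> int) \<Rightarrow> real) \<Rightarrow> (int \<Rightarrow> int) \<Rightarrow> real" where
  "gen L f h = (1/2) * (\<Sum>x\<in>{-int L + 1 .. int L}.
      cplus h x * (f (h(x := h x + 1)) - f h) + cminus h x * (f (h(x := h x - 1)) - f h))"

text \<open>Markov semigroup P_t = exp(t \<L>) (bounded jump rates), so that
  E_h[f(h(t))] = markov_sg L t f h.\<close>
definition markov_sg :: "nat \<Rightarrow> real \<Rightarrow> ((int \<Rightarrow> int) \<Rightarrow> real) \<Rightarrow> (int \<Rightarrow> int) \<Rightarrow> real" where
  "markov_sg L t f h = (\<Sum>n. t ^ n / fact n * ((gen L ^^ n) f) h)"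

definition chain_prob :: "nat \<Rightarrow> (int \<Rightarrow> int) \<Rightarrow> real \<Rightarrow> (int \<Rightarrow> int) set \<Rightarrow> real" where
  "chain_prob L h0 t A = markov_sg L t (\<lambda>h. if h \<in> A then 1 else 0) h0"

definition C2_on_interval :: "(real \<Rightarrow> real) \<Rightarrow> real \<Rightarrow> real \<Rightarrow> bool" where
  "C2_on_interval f a b \<longleftrightarrow> (\<exists>f1 f2. (\<forall>y\<in>{a..b}. (f has_real_derivative f1 y) (at y within {a..b})
       \<and> (f1 has_real_derivative f2 y) (at y within {a..b})) \<and> continuous_on {a..b} f2)"

definition piecewise_monotone :: "(real \<Rightarrow> real) \<Rightarrow> real \<Rightarrow> real \<Rightarrow> bool" where
  "piecewise_monotone f a b \<longleftrightarrow> (\<exists>(p :: nat \<Rightarrow> real) k. p 0 = a \<and> p k = b \<and>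
      (\<forall>i<k. p i < p (Suc i)) \<and>
      (\<forall>i<k. (\<forall>y\<in>{p i..p (Suc i)}. \<forall>z\<in>{p i..p (Suc i)}. y \<le> z \<longrightarrow> f y \<le> f z)
           \<or> (\<forall>y\<in>{p i..p (Suc i)}. \<forall>z\<in>{p i..p (Suc i)}. y \<le> z \<longrightarrow> f z \<le> f y)))"

definition phi_ext :: "(real \<Rightarrow> real) \<Rightarrow> real \<Rightarrow> real" where
  "phi_ext phi0 y = (if y > 1 then 0 else phi0 y)"

definition Phi0 :: "(real \<Rightarrow> real) \<Rightarrow> nat \<Rightarrow> int \<Rightarrow> real" where
  "Phi0 phi0 L x = real L * phi_ext phi0 (real_of_int x / real L)"

text \<open>Initial configuration h^0 (set to 0 off {-L..L+1}; irrelevant).\<close>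
definition h_init :: "(real \<Rightarrow> real) \<Rightarrow> nat \<Rightarrow> int \<Rightarrow> int" where
  "h_init phi0 L x = (if x \<in> {-int L .. int L + 1} then \<lfloor>Phi0 phi0 L x\<rfloor> else 0)"

definition solves_ODE :: "(real \<Rightarrow> real) \<Rightarrow> nat \<Rightarrow> (int \<Rightarrow> real \<Rightarrow> real) \<Rightarrow> bool" where
  "solves_ODE phi0 L Phi \<longleftrightarrow>
     (\<forall>x\<in>{-int L .. int L + 1}. Phi x 0 = Phi0 phi0 L x) \<and>
     (\<forall>t\<ge>0. Phi (-int L) t = 0 \<and> Phi (int L + 1) t = 0) \<and>
     (\<forall>x\<in>{-int L + 1 .. int L}. \<forall>t\<ge>0.
        ((\<lambda>s. Phi x s) has_real_derivative
           (1/2) * (sigma (Phi (x+1) t - Phi x t) - sigma (Phi x t - Phi (x-1) t))) (at t within {0..}))"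

end

(*
Write the dynamics as random maps: a site moves one unit towards the height of a chosen neighbour.
Driving two configurations h, g by the same maps moves h - g at the updated site to a value between
those of h - g at the two sites. So sums of squares of h - g decrease and the largest rise of h - g
never grows. For slope u >= 0 the uniform measure on monotone profiles with given end heights is
stationary, with exact first and second moments.

The squared distance D of h to an Euler discretisation of the equations has drift at most the sum
over edges of f(eta, q) = s^2 - (eta - q) (s - sigma q), where eta is the increment of h, s = sgn eta
and q is the slope of the discretisation. Localise with a tent theta and compare h with a stationary
profile g of the local slope u: since g stays close to the line u x, the functional
  sum theta ((h - u x)^2 - (h - g)^2)
remains of lower order for all times, while the contraction of h - g and a summation by parts bound
its drift below by the sum of theta f(eta, u), up to the fluctuations of g and of its number of
nonzero increments. Hence f(eta, u) is asymptotically nonpositive on average over space and time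
blocks, and D is o(L^3). Coupling with a steep stationary profile gives a modulus of continuity, which
turns the bound on D into a uniform one. The Markov chain is the discrete chain at a Poisson time.
*)
theory Submission
  imports Defs
begin

section \<open>Random moves and their coupling\<close>


text \<open>The pinned chain offers no equilibrium to compare with: the flat configuration is
  absorbing, and the profile both rises and falls. Local equilibrium must therefore be extracted
  inside blocks. A uniform monotone profile behaves locally like a walk with geometric increments,
  and a geometric increment of mean u is positive with probability u / (1 + u). This is where
  \<open>sigma\<close> comes from.

  Squared distances to a line alone are of order n^3 in total, which yields no more than the trivial
  bound on the energy. The comparison functional gains because (h - u x)^2 - (h - g)^2 equals (g - u
  x) (2 h - u x - g): one factor is an equilibrium fluctuation, of size o(n), whatever h does.

  D has to be bounded from above only. Hence an upper bound on the energy is enough, and the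
  contraction of h - g may be used as an inequality, without any estimate of how fast h - g
  decreases.

  Moves come at total rate n, so the time L^2 t corresponds to about n L^2 t moves, which is of
  order n^3.\<close>

text \<open>Sites are 0, ..., n with n = 2 L + 1, so site k stands for x = k - L, and edge e joins e and
  e + 1. A move picks an edge and one of its ends (the left one if b) and pulls that end one unit
  towards the other. Moves of the fixed sites 0 and n are null: with them there are 2 n moves of
  rate 1/2 each, so the generator is n (avg - 1).\<close>
definition move :: "nat \<Rightarrow> nat \<Rightarrow> bool \<Rightarrow> (nat \<Rightarrow> int) \<Rightarrow> nat \<Rightarrow> int" where
  "move n e b h =
     (if b then (if 0 < e then h(e := h e + sgn (h (Suc e) - h e)) else h)
      else (if Suc e < n then h(Suc e := h (Suc e) - sgn (h (Suc e) - h e)) else h))"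

definition move2 :: "nat \<Rightarrow> nat \<Rightarrow> bool \<Rightarrow> (nat \<Rightarrow> int) \<times> (nat \<Rightarrow> int) \<Rightarrow> (nat \<Rightarrow> int) \<times> (nat \<Rightarrow> int)" where
  "move2 n e b p = (move n e b (fst p), move n e b (snd p))"

text \<open>Probability enters only through operators on observables: \<open>avg\<close> averages
  over the 2 n equally likely moves, and iterating it gives the expectation after several moves as a
  function of the starting state. The action is a parameter, so that a single chain
  (\<open>move\<close>) and a coupled pair (\<open>move2\<close>) share all lemmas.\<close>

definition avg :: "nat \<Rightarrow> (nat \<Rightarrow> bool \<Rightarrow> 's \<Rightarrow> 's) \<Rightarrow> ('s \<Rightarrow> real) \<Rightarrow> 's \<Rightarrow> real" where
  "avg n act F p = (\<Sum>e<n. F (act e True p) + F (act e False p)) / (2 * real n)"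

definition run :: "nat \<Rightarrow> (nat \<Rightarrow> bool \<Rightarrow> 's \<Rightarrow> 's) \<Rightarrow> nat \<Rightarrow> ('s \<Rightarrow> real) \<Rightarrow> 's \<Rightarrow> real" where
  "run n act k = (avg n act ^^ k)"

lemma avg_mono:
  assumes "\<And>e b. e < n \<Longrightarrow> F (act e b p) \<le> G (act e b p)"
  shows "avg n act F p \<le> avg n act G p"
  unfolding avg_def by (intro divide_right_mono sum_mono add_mono assms) auto

lemma avg_add: "avg n act (\<lambda>q. F q + G q) p = avg n act F p + avg n act G p"
  unfolding avg_def by (simp add: sum.distrib add_divide_distrib)

lemma avg_cmult: "avg n act (\<lambda>q. c * F q) p = c * avg n act F p"
  unfolding avg_def by (simp add: sum_distrib_left distrib_left)

lemma avg_const: "0 < n \<Longrightarrow> avg n act (\<lambda>q. c) p = c"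
  unfolding avg_def by simp

lemma run_0 [simp]: "run n act 0 F = F"
  and run_Suc: "run n act (Suc k) F = avg n act (run n act k F)"
  and run_Suc': "run n act (Suc k) F = run n act k (avg n act F)"
  by (simp_all add: run_def funpow_swap1)

lemma run_run: "run n act (j + k) F = run n act j (run n act k F)"
  by (simp add: run_def funpow_add)

text \<open>The invariant admits pointwise comparisons that hold only on reachable states, such as
  tame configurations or pairs whose second component is a stationary profile.\<close>

lemma run_mono:
  assumes inv: "\<And>q e b. I q \<Longrightarrow> e < n \<Longrightarrow> I (act e b q)"
    and "I p" and le: "\<And>q. I q \<Longrightarrow> F q \<le> G q"
  shows "run n act k F p \<le> run n act k G p"
  using \<open>I p\<close>
proof (induction k arbitrary: p)
  case (Suc k)
  show ?case unfolding run_Suc by (rule avg_mono) (rule Suc.IH[OF inv[OF Suc.prems]])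
qed (simp add: le)

lemma run_add: "run n act k (\<lambda>q. F q + G q) p = run n act k F p + run n act k G p"
proof (induction k arbitrary: F G)
  case (Suc k)
  have "avg n act (\<lambda>q. F q + G q) = (\<lambda>q. avg n act F q + avg n act G q)"
    using avg_add by fast
  then show ?case by (simp add: run_Suc' Suc.IH)
qed simp

lemma run_cmult: "run n act k (\<lambda>q. c * F q) p = c * run n act k F p"
proof (induction k arbitrary: F)
  case (Suc k)
  have "avg n act (\<lambda>q. c * F q) = (\<lambda>q. c * avg n act F q)"
    using avg_cmult by fast
  then show ?case by (simp add: run_Suc' Suc.IH)
qed simp

lemma run_diff: "run n act k (\<lambda>q. F q - G q) p = run n act k F p - run n act k G p"
  using run_add[of n act k F "\<lambda>q. -1 * G q" p] run_cmult[of n act k "-1" G p] by simp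

lemma run_const: "0 < n \<Longrightarrow> run n act k (\<lambda>q. c) p = c"
proof (induction k)
  case (Suc k)
  have "avg n act (\<lambda>q. c) = (\<lambda>q. c)" using avg_const[OF Suc.prems] by fast
  then show ?case using Suc by (simp add: run_Suc')
qed simp

lemma run_sum:
  assumes "finite A" "0 < n"
  shows "run n act k (\<lambda>q. \<Sum>a\<in>A. F a q) p = (\<Sum>a\<in>A. run n act k (F a) p)"
  using assms(1) by induction (simp_all add: run_add run_const assms(2))

lemma run_dynkin:
  "run n act T F p - F p = (\<Sum>k<T. run n act k (\<lambda>q. avg n act F q - F q) p)"
proof -
  have "(\<Sum>k<T. run n act k (\<lambda>q. avg n act F q - F q) p)
      = (\<Sum>k<T. run n act (Suc k) F p - run n act k F p)"
    by (intro sum.cong refl) (simp add: run_diff run_Suc')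
  then show ?thesis using sum_lessThan_telescope[of "\<lambda>k. run n act k F p" T] by simp
qed

lemma run_fst: "run n (move2 n) k (\<lambda>p. F (fst p)) p = run n (move n) k F (fst p)"
proof (induction k arbitrary: p)
  case (Suc k)
  show ?case unfolding run_Suc avg_def by (simp add: Suc.IH move2_def)
qed simp

lemma run_snd: "run n (move2 n) k (\<lambda>p. F (snd p)) p = run n (move n) k F (snd p)"
proof (induction k arbitrary: p)
  case (Suc k)
  show ?case unfolding run_Suc avg_def by (simp add: Suc.IH move2_def)
qed simp

lemma move_bd [simp]: "move n e b h 0 = h 0" "e < n \<Longrightarrow> move n e b h n = h n"
  by (auto simp: move_def)

lemma move_uminus: "move n e b (\<lambda>x. - h x) = (\<lambda>x. - move n e b h x)"
  by (auto simp: move_def fun_eq_iff sgn_if)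

text \<open>Reflection commutes with every single move because sgn is odd. It later reduces negative
  slopes to positive ones, and steep falls to steep rises.\<close>

lemma run_uminus: "run n (move n) k (\<lambda>h. F (\<lambda>x. - h x)) h = run n (move n) k F (\<lambda>x. - h x)"
proof (induction k arbitrary: h)
  case (Suc k)
  show ?case unfolding run_Suc avg_def by (simp add: Suc.IH move_uminus)
qed simp

lemma sgn_diff_between:
  fixes a b :: int
  shows "a \<le> b \<Longrightarrow> 0 \<le> sgn b - sgn a" "a \<le> b \<Longrightarrow> sgn b - sgn a \<le> b - a"
  by (auto simp: sgn_if)

text \<open>As sgn is nondecreasing and 1-Lipschitz on the integers, a simultaneous move of h and g
  takes h - g towards, but not beyond, its value at the chosen neighbour.\<close>
lemma move_diff_cases:
  assumes "e < n"
  obtains (stay) "\<And>x. move n e b h x - move n e b g x = h x - g x"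
  | (site) y z where "y < n" "0 < y" "z \<le> n" "z = Suc y \<or> y = Suc z"
      "\<And>x. x \<noteq> y \<Longrightarrow> move n e b h x - move n e b g x = h x - g x"
      "min (h y - g y) (h z - g z) \<le> move n e b h y - move n e b g y"
      "move n e b h y - move n e b g y \<le> max (h y - g y) (h z - g z)"
proof (cases "(b \<and> e = 0) \<or> (\<not> b \<and> \<not> Suc e < n)")
  case True
  then show ?thesis by (intro stay) (auto simp: move_def)
next
  case False
  define y where "y = (if b then e else Suc e)"
  define z where "z = (if b then Suc e else e)"
  let ?a = "h (Suc e) - h e" and ?c = "g (Suc e) - g e"
  note * = sgn_diff_between[of ?a ?c] sgn_diff_between[of ?c ?a]
  show ?thesis
  proof (rule site[of y z])
    show "y < n" "0 < y" "z \<le> n" "z = Suc y \<or> y = Suc z"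
      using False assms by (auto simp: y_def z_def)
    show "x \<noteq> y \<Longrightarrow> move n e b h x - move n e b g x = h x - g x" for x
      using False by (auto simp: move_def y_def)
    show "min (h y - g y) (h z - g z) \<le> move n e b h y - move n e b g y"
      "move n e b h y - move n e b g y \<le> max (h y - g y) (h z - g z)"
      using False * by (cases b; auto simp: move_def y_def z_def min_def max_def)+
  qed
qed

section \<open>A priori bounds from the total variation\<close>

definition tv :: "nat \<Rightarrow> (nat \<Rightarrow> int) \<Rightarrow> int" where
  "tv n h = (\<Sum>e<n. \<bar>h (Suc e) - h e\<bar>)"

lemma tv_upd:
  assumes "Suc x < n"
  shows "tv n (h(Suc x := v)) - tv n h
    = \<bar>v - h x\<bar> - \<bar>h (Suc x) - h x\<bar> + \<bar>h (Suc (Suc x)) - v\<bar> - \<bar>h (Suc (Suc x)) - h (Suc x)\<bar>"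
proof -
  let ?t = "\<lambda>h e. \<bar>h (Suc e) - h e\<bar>"
  have "tv n (h(Suc x := v)) - tv n h = (\<Sum>e<n. ?t (h(Suc x := v)) e - ?t h e)"
    by (simp add: tv_def sum_subtractf)
  also have "\<dots> = (\<Sum>e\<in>{x, Suc x}. ?t (h(Suc x := v)) e - ?t h e)"
    using assms by (intro sum.mono_neutral_right) auto
  finally show ?thesis by simp
qed

text \<open>A site that moves shortens by one the edge to the neighbour it approaches, as heights
  are integers, and lengthens its other edge by at most one.\<close>

lemma tv_move:
  assumes "e < n"
  shows "tv n (move n e b h) \<le> tv n h"
proof -
  \<comment> \<open>\<open>p\<close> and \<open>q\<close> are both the height of the updated site,
    \<open>r\<close> is that of the neighbour it approaches and \<open>q'\<close> that of the other
    neighbour.\<close>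
  have s: "\<bar>p + sgn (r - q) - q'\<bar> - \<bar>p - q'\<bar> + \<bar>r - (q + sgn (r - q))\<bar> - \<bar>r - q\<bar> \<le> 0"
    if "p = q" for p q q' r :: int using that by (auto simp: sgn_if)
  show ?thesis
  proof (cases b)
    case True
    show ?thesis
    proof (cases e)
      case (Suc x)
      have "tv n (h(Suc x := h (Suc x) + sgn (h (Suc (Suc x)) - h (Suc x)))) \<le> tv n h"
        using tv_upd[of x n h "h (Suc x) + sgn (h (Suc (Suc x)) - h (Suc x))"] Suc assms
          s[of "h (Suc x)" "h (Suc x)" "h (Suc (Suc x))" "h x"] by linarith
      then show ?thesis using True Suc by (simp add: move_def)
    qed (simp add: move_def True)
  next
    case False
    show ?thesis
    proof (cases "Suc e < n")
      case c: True
      have "tv n (h(Suc e := h (Suc e) - sgn (h (Suc e) - h e))) \<le> tv n h"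
        using tv_upd[OF c, of h "h (Suc e) - sgn (h (Suc e) - h e)"]
        by (auto simp: sgn_if split: if_splits)
      then show ?thesis using False c by (simp add: move_def)
    qed (simp add: move_def False)
  qed
qed

text \<open>The a priori bound kept along every run: heights are of order n and the increments have
  total size of order n, while no uniform bound on single increments is claimed.\<close>

definition tame :: "nat \<Rightarrow> real \<Rightarrow> (nat \<Rightarrow> int) \<Rightarrow> bool" where
  "tame n C h \<longleftrightarrow> h 0 = 0 \<and> h n = 0 \<and> real_of_int (tv n h) \<le> C * real n"

lemma tame_move: "tame n C h \<Longrightarrow> e < n \<Longrightarrow> tame n C (move n e b h)"
  using tv_move[of e n b h] unfolding tame_def by (auto intro: order_trans[rotated])

lemma tame_uminus: "tame n C h \<Longrightarrow> tame n C (\<lambda>x. - h x)"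
  by (simp add: tame_def tv_def abs_minus_commute)

lemma abs_le_tv:
  assumes "x \<le> n"
  shows "\<bar>h x - h 0\<bar> \<le> tv n h"
proof -
  have "\<bar>h x - h 0\<bar> \<le> (\<Sum>e<x. \<bar>h (Suc e) - h e\<bar>)"
    using sum_lessThan_telescope[of h x] by (metis sum_abs)
  also have "\<dots> \<le> tv n h" unfolding tv_def using assms by (intro sum_mono2) auto
  finally show ?thesis .
qed

lemma tame_abs_le: "tame n C h \<Longrightarrow> x \<le> n \<Longrightarrow> \<bar>real_of_int (h x)\<bar> \<le> C * real n"
  using abs_le_tv[of x n h] unfolding tame_def by linarith

text \<open>For a sum over sites each move changes a single summand, so the drift can be read off
  edge by edge; 2 n is the number of moves. The form for pairs serves the coupling and, with equal
  components, a single chain.\<close>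

lemma avg_site_sum:
  "2 * real n * (avg n (move2 n) (\<lambda>p. \<Sum>x\<le>n. Q x (fst p x) (snd p x)) (h, g) - (\<Sum>x\<le>n. Q x (h x) (g x)))
   = (\<Sum>e<n. (if 0 < e then Q e (h e + sgn (h (Suc e) - h e)) (g e + sgn (g (Suc e) - g e)) - Q e (h e) (g e) else 0)
     + (if Suc e < n then Q (Suc e) (h (Suc e) - sgn (h (Suc e) - h e)) (g (Suc e) - sgn (g (Suc e) - g e)) - Q (Suc e) (h (Suc e)) (g (Suc e)) else 0))"
  (is "?l = ?r")
proof -
  have upd: "(\<Sum>x\<le>n. Q x ((h(y := a)) x) ((g(y := c)) x)) = (\<Sum>x\<le>n. Q x (h x) (g x)) + (Q y a c - Q y (h y) (g y))"
    if "y \<le> n" for y a c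
  proof -
    have "(\<Sum>x\<le>n. Q x ((h(y := a)) x) ((g(y := c)) x)) - (\<Sum>x\<le>n. Q x (h x) (g x))
      = (\<Sum>x\<le>n. if x = y then Q y a c - Q y (h y) (g y) else 0)"
      unfolding sum_subtractf[symmetric] by (intro sum.cong) auto
    then show ?thesis using that by simp
  qed
  define S where "S = (\<Sum>x\<le>n. Q x (h x) (g x))"
  define f where "f = (\<lambda>p. \<Sum>x\<le>n. Q x (fst p x) (snd p x))"
  define A where "A e = (if 0 < e then Q e (h e + sgn (h (Suc e) - h e)) (g e + sgn (g (Suc e) - g e)) - Q e (h e) (g e) else 0)" for e
  define B where "B e = (if Suc e < n then Q (Suc e) (h (Suc e) - sgn (h (Suc e) - h e)) (g (Suc e) - sgn (g (Suc e) - g e)) - Q (Suc e) (h (Suc e)) (g (Suc e)) else 0)" for e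
  have T: "f (move2 n e True (h, g)) = S + A e" if "e < n" for e
    using that upd[of e] by (simp add: move2_def move_def f_def S_def A_def del: fun_upd_apply)
  have F: "f (move2 n e False (h, g)) = S + B e" if "e < n" for e
    using that upd[of "Suc e"] by (simp add: move2_def move_def f_def S_def B_def del: fun_upd_apply)
  have "(\<Sum>e<n. f (move2 n e True (h, g)) + f (move2 n e False (h, g))) = (\<Sum>e<n. 2 * S + (A e + B e))"
    by (intro sum.cong refl) (simp add: T F)
  also have "\<dots> = 2 * real n * S + (\<Sum>e<n. A e + B e)"
    by (simp add: sum.distrib)
  finally have "2 * real n * (avg n (move2 n) f (h, g) - S) = (\<Sum>e<n. A e + B e)"
    by (cases "n = 0") (simp_all add: avg_def right_diff_distrib)
  then show ?thesis unfolding f_def S_def A_def B_def .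
qed

section \<open>Stationary monotone profiles\<close>


text \<open>Values beyond \<open>n\<close> are fixed to 0, so that a profile is determined by its
  heights on the sites and the set is finite.\<close>

definition profiles :: "nat \<Rightarrow> nat \<Rightarrow> (nat \<Rightarrow> int) set" where
  "profiles n N = {g. g 0 = 0 \<and> g n = int N \<and> (\<forall>e<n. g e \<le> g (Suc e)) \<and> (\<forall>x>n. g x = 0)}"

text \<open>Sums over profiles stay unnormalised, so that the recursions in \<open>N\<close> relate
  them without quotients. Division by \<open>Esum n N (\<lambda>_. 1)\<close> gives the expectation
  under the uniform measure.\<close>

definition Esum :: "nat \<Rightarrow> nat \<Rightarrow> ((nat \<Rightarrow> int) \<Rightarrow> real) \<Rightarrow> real" where
  "Esum n N F = (\<Sum>g\<in>profiles n N. F g)"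

lemma profiles_mono:
  assumes "g \<in> profiles n N" "x \<le> y" "y \<le> n"
  shows "g x \<le> g y"
  using assms(2,3)
proof (induction rule: dec_induct)
  case (step m)
  then have "g m \<le> g (Suc m)" using assms(1) by (auto simp: profiles_def)
  then show ?case using step by simp
qed simp

lemma profiles_range: "g \<in> profiles n N \<Longrightarrow> x \<le> n \<Longrightarrow> 0 \<le> g x \<and> g x \<le> int N"
  using profiles_mono[of g n N 0 x] profiles_mono[of g n N x n] by (auto simp: profiles_def)

lemma finite_profiles: "finite (profiles n N)"
proof (rule finite_subset)
  show "profiles n N \<subseteq> {f. \<forall>x. (x \<in> {..n} \<longrightarrow> f x \<in> {0..int N}) \<and> (x \<notin> {..n} \<longrightarrow> f x = 0)}"
    using profiles_range by (auto simp: profiles_def)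
  show "finite \<dots>" by (rule finite_set_of_finite_funs) auto
qed

lemma profiles_nonempty: "0 < n \<Longrightarrow> profiles n N \<noteq> {}"
proof -
  assume "0 < n"
  then have "(\<lambda>x. if x = n then int N else 0) \<in> profiles n N"
    by (auto simp: profiles_def)
  then show ?thesis by blast
qed

lemma Esum_1: "Esum n N (\<lambda>_. 1) = real (card (profiles n N))"
  by (simp add: Esum_def)

lemma card_profiles_pos: "0 < n \<Longrightarrow> 0 < Esum n N (\<lambda>_. 1)"
  using finite_profiles profiles_nonempty by (simp add: Esum_1 card_gt_0_iff)

lemma Esum_mono: "(\<And>g. g \<in> profiles n N \<Longrightarrow> F g \<le> G g) \<Longrightarrow> Esum n N F \<le> Esum n N G"
  unfolding Esum_def by (rule sum_mono)

lemma Esum_cong: "(\<And>g. g \<in> profiles n N \<Longrightarrow> F g = G g) \<Longrightarrow> Esum n N F = Esum n N G"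
  unfolding Esum_def by (rule sum.cong) auto

lemma Esum_add: "Esum n N (\<lambda>g. F g + G g) = Esum n N F + Esum n N G"
  and Esum_cmult: "Esum n N (\<lambda>g. c * F g) = c * Esum n N F"
  and Esum_sum: "Esum n N (\<lambda>g. \<Sum>a\<in>A. K a g) = (\<Sum>a\<in>A. Esum n N (K a))"
  by (simp_all add: Esum_def sum.distrib sum_distrib_left) (rule sum.swap)

lemma Esum_const: "Esum n N (\<lambda>g. c) = c * Esum n N (\<lambda>_. 1)"
  by (simp add: Esum_def)

lemma profiles_upd:
  assumes "g \<in> profiles (Suc m) N" "e < m" "g e \<le> v" "v \<le> g (Suc (Suc e))"
  shows "g(Suc e := v) \<in> profiles (Suc m) N"
proof -
  have le: "\<And>x. x < Suc m \<Longrightarrow> g x \<le> g (Suc x)" using assms(1) by (auto simp: profiles_def)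
  show ?thesis unfolding profiles_def
  proof (intro CollectI conjI allI impI)
    fix x assume "x < Suc m"
    then show "(g(Suc e := v)) x \<le> (g(Suc e := v)) (Suc x)" using le assms(3,4) by auto
  qed (use assms(1,2) in \<open>auto simp: profiles_def\<close>)
qed

text \<open>At a fixed site, the upward move is a bijection from the profiles with a positive
  increment on the right onto those with a positive increment on the left, and the
  downward move is its inverse.\<close>
lemma Esum_move_site:
  assumes "e < m"
  shows "Esum (Suc m) N (\<lambda>g. F (move (Suc m) (Suc e) True g) + F (move (Suc m) e False g)) = 2 * Esum (Suc m) N F"
proof -
  let ?P = "profiles (Suc m) N"
  let ?x = "Suc e" and ?z = "Suc (Suc e)"
  let ?A = "{g \<in> ?P. g ?x < g ?z}" and ?B = "{g \<in> ?P. g e < g ?x}"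
  let ?A' = "{g \<in> ?P. g ?x = g ?z}" and ?B' = "{g \<in> ?P. g e = g ?x}"
  note fin = finite_profiles[of "Suc m" N]
  have le: "g e \<le> g ?x \<and> g ?x \<le> g ?z" if "g \<in> ?P" for g
    using that assms by (auto simp: profiles_def)
  have P1: "?P = ?A \<union> ?A'" and P2: "?P = ?B \<union> ?B'" using le by force+
  have up: "move (Suc m) ?x True g = g(?x := g ?x + 1)" if "g \<in> ?A" for g
    using that by (simp add: move_def)
  have up': "move (Suc m) ?x True g = g" if "g \<in> ?A'" for g
    using that by (auto simp: move_def fun_eq_iff)
  have dn: "move (Suc m) e False g = g(?x := g ?x - 1)" if "g \<in> ?B" for g
    using that assms by (simp add: move_def)
  have dn': "move (Suc m) e False g = g" if "g \<in> ?B'" for g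
    using that by (auto simp: move_def fun_eq_iff)
  have AB: "g(?x := g ?x + 1) \<in> ?B" if "g \<in> ?A" for g
    using that le[of g] by (auto intro!: profiles_upd assms)
  have BA: "g(?x := g ?x - 1) \<in> ?A" if "g \<in> ?B" for g
    using that le[of g] by (auto intro!: profiles_upd assms)
  have "(\<Sum>g\<in>?P. F (move (Suc m) ?x True g)) = (\<Sum>g\<in>?A. F (move (Suc m) ?x True g)) + (\<Sum>g\<in>?A'. F (move (Suc m) ?x True g))"
    by (subst P1, rule sum.union_disjoint) (use fin in auto)
  also have "\<dots> = (\<Sum>g\<in>?A. F (g(?x := g ?x + 1))) + (\<Sum>g\<in>?A'. F g)"
    using up up' by (intro arg_cong2[where f = "(+)"] sum.cong) auto
  also have "(\<Sum>g\<in>?A. F (g(?x := g ?x + 1))) = (\<Sum>g\<in>?B. F g)"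
    by (rule sum.reindex_bij_witness[where i = "\<lambda>g. g(?x := g ?x - 1)" and j = "\<lambda>g. g(?x := g ?x + 1)"])
      (use AB BA in auto)
  finally have U: "(\<Sum>g\<in>?P. F (move (Suc m) ?x True g)) = (\<Sum>g\<in>?B. F g) + (\<Sum>g\<in>?A'. F g)" .
  have "(\<Sum>g\<in>?P. F (move (Suc m) e False g)) = (\<Sum>g\<in>?B. F (move (Suc m) e False g)) + (\<Sum>g\<in>?B'. F (move (Suc m) e False g))"
    by (subst P2, rule sum.union_disjoint) (use fin in auto)
  also have "\<dots> = (\<Sum>g\<in>?B. F (g(?x := g ?x - 1))) + (\<Sum>g\<in>?B'. F g)"
    using dn dn' by (intro arg_cong2[where f = "(+)"] sum.cong) auto
  also have "(\<Sum>g\<in>?B. F (g(?x := g ?x - 1))) = (\<Sum>g\<in>?A. F g)"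
    by (rule sum.reindex_bij_witness[where j = "\<lambda>g. g(?x := g ?x - 1)" and i = "\<lambda>g. g(?x := g ?x + 1)"])
      (use AB BA in auto)
  finally have D: "(\<Sum>g\<in>?P. F (move (Suc m) e False g)) = (\<Sum>g\<in>?A. F g) + (\<Sum>g\<in>?B'. F g)" .
  have "sum F ?P = sum F ?A + sum F ?A'"
    by (subst P1, rule sum.union_disjoint) (use fin in auto)
  moreover have "sum F ?P = sum F ?B + sum F ?B'"
    by (subst P2, rule sum.union_disjoint) (use fin in auto)
  ultimately show ?thesis using U D by (simp add: Esum_def sum.distrib)
qed

lemma Esum_avg:
  assumes "0 < n"
  shows "Esum n N (avg n (move n) F) = Esum n N F"
proof -
  obtain m where n: "n = Suc m" using assms gr0_implies_Suc by blast
  \<comment> \<open>The move of site \<open>Suc e\<close> along its right edge is paired with its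
    move along its left edge \<open>e\<close>. Unpaired are the null moves of the two fixed ends,
    which give the term 2 F g.\<close>
  have "(\<Sum>e<n. F (move n e True g) + F (move n e False g))
    = 2 * F g + (\<Sum>e<m. F (move n (Suc e) True g) + F (move n e False g))" for g
  proof -
    have "(\<Sum>e<n. F (move n e True g)) = F g + (\<Sum>e<m. F (move n (Suc e) True g))"
      unfolding n sum.lessThan_Suc_shift by (simp add: move_def)
    moreover have "(\<Sum>e<n. F (move n e False g)) = (\<Sum>e<m. F (move n e False g)) + F g"
      unfolding n by (simp add: move_def)
    ultimately show ?thesis by (simp add: sum.distrib)
  qed
  then have "Esum n N (avg n (move n) F)
    = Esum n N (\<lambda>g. 1 / (2 * real n) * (2 * F g + (\<Sum>e<m. F (move n (Suc e) True g) + F (move n e False g))))"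
    by (intro Esum_cong) (simp add: avg_def)
  also have "\<dots> = 1 / (2 * real n) * (2 * Esum n N F + (\<Sum>e<m. Esum n N (\<lambda>g. F (move n (Suc e) True g) + F (move n e False g))))"
    by (simp only: Esum_cmult Esum_add Esum_sum)
  also have "\<dots> = 1 / (2 * real n) * (2 * Esum n N F + (\<Sum>e<m. 2 * Esum n N F))"
    using Esum_move_site n by simp
  also have "\<dots> = Esum n N F" using n by (simp add: field_simps)
  finally show ?thesis .
qed

lemma Esum_run: "0 < n \<Longrightarrow> Esum n N (run n (move n) k F) = Esum n N F"
  by (induction k) (simp_all add: run_Suc Esum_avg)

text \<open>Raising everything to the right of edge i by one identifies the profiles of total height N
  with those of total height N + 1 that increase at i. All moments below come from this.\<close>
definition lift_at :: "nat \<Rightarrow> nat \<Rightarrow> (nat \<Rightarrow> int) \<Rightarrow> nat \<Rightarrow> int" where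
  "lift_at n i g = (\<lambda>x. if i < x \<and> x \<le> n then g x + 1 else g x)"

lemma Esum_lift:
  assumes "i < n"
  shows "Esum n (Suc N) (\<lambda>g. of_bool (g i < g (Suc i)) * F g) = Esum n N (\<lambda>g. F (lift_at n i g))"
proof -
  have "Esum n (Suc N) (\<lambda>g. of_bool (g i < g (Suc i)) * F g) = (\<Sum>g\<in>{g \<in> profiles n (Suc N). g i < g (Suc i)}. F g)"
    unfolding Esum_def by (rule sum.mono_neutral_cong_right) (auto simp: finite_profiles)
  also have "\<dots> = Esum n N (\<lambda>g. F (lift_at n i g))"
    unfolding Esum_def
  proof (rule sum.reindex_bij_witness[where i = "lift_at n i" and j = "\<lambda>g x. if i < x \<and> x \<le> n then g x - 1 else g x"])
    fix g assume g: "g \<in> profiles n N"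
    then have "g x \<le> g (Suc x)" if "x < n" for x using that by (auto simp: profiles_def)
    moreover from g have "g 0 = 0" "g n = int N" "\<And>x. x > n \<Longrightarrow> g x = 0" by (auto simp: profiles_def)
    ultimately show "lift_at n i g \<in> {g \<in> profiles n (Suc N). g i < g (Suc i)}"
      using assms by (auto simp: profiles_def lift_at_def intro: order_trans)
        (smt (verit) Suc_leI less_Suc_eq)+
  next
    fix g assume g: "g \<in> {g \<in> profiles n (Suc N). g i < g (Suc i)}"
    then have le: "g x \<le> g (Suc x)" if "x < n" for x using that by (auto simp: profiles_def)
    show "(\<lambda>x. if i < x \<and> x \<le> n then g x - 1 else g x) \<in> profiles n N"
      unfolding profiles_def
    proof (intro CollectI conjI allI impI)
      fix x assume "x < n"
      then show "(if i < x \<and> x \<le> n then g x - 1 else g x) \<le> (if i < Suc x \<and> Suc x \<le> n then g (Suc x) - 1 else g (Suc x))"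
        using le[of x] g by (cases "x = i") auto
    qed (use g assms in \<open>auto simp: profiles_def\<close>)
  next
    fix g show "F (lift_at n i (\<lambda>x. if i < x \<and> x \<le> n then g x - 1 else g x)) = F g"
      by (rule arg_cong[of _ _ F]) (auto simp: lift_at_def)
  qed (auto simp: lift_at_def fun_eq_iff)
  finally show ?thesis .
qed

text \<open>A flat edge has weight 0, so the indicator of a step can be inserted and then lifted
  away.\<close>

lemma Esum_lift_weighted:
  assumes "i < n"
  shows "Esum n (Suc N) (\<lambda>g. real_of_int (g (Suc i) - g i) * F g)
    = Esum n N (\<lambda>g. (real_of_int (g (Suc i) - g i) + 1) * F (lift_at n i g))"
proof -
  have "Esum n (Suc N) (\<lambda>g. real_of_int (g (Suc i) - g i) * F g)
    = Esum n (Suc N) (\<lambda>g. of_bool (g i < g (Suc i)) * (real_of_int (g (Suc i) - g i) * F g))"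
  proof (rule Esum_cong)
    fix g assume "g \<in> profiles n (Suc N)"
    then have "g i \<le> g (Suc i)" using assms by (auto simp: profiles_def)
    then show "real_of_int (g (Suc i) - g i) * F g = of_bool (g i < g (Suc i)) * (real_of_int (g (Suc i) - g i) * F g)"
      by (cases "g i = g (Suc i)") auto
  qed
  also have "\<dots> = Esum n N (\<lambda>g. (real_of_int (g (Suc i) - g i) + 1) * F (lift_at n i g))"
    unfolding Esum_lift[OF assms] using assms by (intro Esum_cong) (simp add: lift_at_def)
  finally show ?thesis .
qed

text \<open>The height at \<open>k\<close> is the sum of the increments on the edges below
  \<open>k\<close>. Lifting at any of them raises this height by one, and the extra units of weight
  add up to \<open>real k\<close>. Each choice of F yields a recursion in \<open>N\<close> for a
  moment of the height.\<close>

lemma Esum_height_weighted: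
  assumes "k \<le> n"
  shows "Esum n (Suc N) (\<lambda>g. real_of_int (g k) * F (g k)) = Esum n N (\<lambda>g. (real_of_int (g k) + real k) * F (g k + 1))"
proof -
  have tel: "real_of_int (g k) = (\<Sum>i<k. real_of_int (g (Suc i) - g i))" if "g \<in> profiles n M" for g M
  proof -
    have "(\<Sum>i<k. g (Suc i) - g i) = g k"
      using that by (simp add: sum_lessThan_telescope profiles_def)
    then show ?thesis by (metis of_int_sum)
  qed
  have "Esum n (Suc N) (\<lambda>g. real_of_int (g k) * F (g k)) = Esum n (Suc N) (\<lambda>g. \<Sum>i<k. real_of_int (g (Suc i) - g i) * F (g k))"
    by (rule Esum_cong) (subst tel, simp_all add: sum_distrib_right)
  also have "\<dots> = (\<Sum>i<k. Esum n (Suc N) (\<lambda>g. real_of_int (g (Suc i) - g i) * F (g k)))"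
    by (rule Esum_sum)
  also have "\<dots> = (\<Sum>i<k. Esum n N (\<lambda>g. (real_of_int (g (Suc i) - g i) + 1) * F (g k + 1)))"
  proof (intro sum.cong refl)
    fix i assume "i \<in> {..<k}"
    then have i: "i < n" "lift_at n i g k = g k + 1" for g using assms by (auto simp: lift_at_def)
    show "Esum n (Suc N) (\<lambda>g. real_of_int (g (Suc i) - g i) * F (g k)) = Esum n N (\<lambda>g. (real_of_int (g (Suc i) - g i) + 1) * F (g k + 1))"
      using Esum_lift_weighted[OF i(1), of N "\<lambda>g. F (g k)"] by (simp add: i(2))
  qed
  also have "\<dots> = Esum n N (\<lambda>g. \<Sum>i<k. (real_of_int (g (Suc i) - g i) + 1) * F (g k + 1))"
    by (rule Esum_sum[symmetric])
  also have "\<dots> = Esum n N (\<lambda>g. (real_of_int (g k) + real k) * F (g k + 1))"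
  proof (rule Esum_cong)
    fix g assume g: "g \<in> profiles n N"
    show "(\<Sum>i<k. (real_of_int (g (Suc i) - g i) + 1) * F (g k + 1)) = (real_of_int (g k) + real k) * F (g k + 1)"
      unfolding sum_distrib_right[symmetric] sum.distrib using tel[OF g] by simp
  qed
  finally show ?thesis .
qed

text \<open>At k = n the height is constant on each set of profiles, and the height recursion
  becomes the stars and bars ratio.\<close>

lemma card_rec: "(real N + 1) * Esum n (Suc N) (\<lambda>_. 1) = (real N + real n) * Esum n N (\<lambda>_. 1)"
proof -
  have "Esum n (Suc N) (\<lambda>g. real_of_int (g n) * 1) = Esum n N (\<lambda>g. (real_of_int (g n) + real n) * 1)"
    using Esum_height_weighted[of n n N "\<lambda>_. 1"] by simp
  moreover have "Esum n (Suc N) (\<lambda>g. real_of_int (g n) * 1) = Esum n (Suc N) (\<lambda>g. (real N + 1) * 1)"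
    by (rule Esum_cong) (auto simp: profiles_def)
  moreover have "Esum n N (\<lambda>g. (real_of_int (g n) + real n) * 1) = Esum n N (\<lambda>g. (real N + real n) * 1)"
    by (rule Esum_cong) (auto simp: profiles_def)
  ultimately show ?thesis by (simp only: Esum_cmult)
qed

lemma profiles_0: "g \<in> profiles n 0 \<Longrightarrow> k \<le> n \<Longrightarrow> g k = 0"
  using profiles_range[of g n 0 k] by simp

lemma Esum_height:
  assumes "k \<le> n"
  shows "real n * Esum n N (\<lambda>g. real_of_int (g k)) = real k * real N * Esum n N (\<lambda>_. 1)"
proof (induction N)
  case 0
  have "Esum n 0 (\<lambda>g. real_of_int (g k)) = Esum n 0 (\<lambda>g. 0)" by (rule Esum_cong) (simp add: profiles_0 assms)
  then show ?case by (simp add: Esum_def)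
next
  case (Suc N)
  let ?c = "Esum n N (\<lambda>_. 1)"
  have "Esum n (Suc N) (\<lambda>g. real_of_int (g k)) = Esum n N (\<lambda>g. real_of_int (g k)) + real k * ?c"
    using Esum_height_weighted[OF assms, of N "\<lambda>_. 1"] Esum_add[of n N "\<lambda>g. real_of_int (g k)" "\<lambda>_. real k"]
      Esum_const[of n N "real k"] by simp
  then have "real n * Esum n (Suc N) (\<lambda>g. real_of_int (g k)) = real k * ((real N + real n) * ?c)"
    using Suc by (simp add: algebra_simps)
  then show ?case unfolding card_rec[symmetric] by (simp add: algebra_simps)
qed

text \<open>The factorial moment is chosen because the recursion closes on it: with F v = v - 1 the
  lifted integrand is (g + k) g = g (g - 1) + (k + 1) g, which adds only the known mean.\<close>

lemma Esum_height_fact2: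
  assumes "k \<le> n"
  shows "real n * (real n + 1) * Esum n N (\<lambda>g. real_of_int (g k) * (real_of_int (g k) - 1))
    = real k * (real k + 1) * real N * (real N - 1) * Esum n N (\<lambda>_. 1)"
proof (induction N)
  case 0
  have "Esum n 0 (\<lambda>g. real_of_int (g k) * (real_of_int (g k) - 1)) = Esum n 0 (\<lambda>g. 0)"
    by (rule Esum_cong) (simp add: profiles_0 assms)
  then show ?case by (simp add: Esum_def)
next
  case (Suc N)
  let ?c = "Esum n N (\<lambda>_. 1)" and ?h = "Esum n N (\<lambda>g. real_of_int (g k))"
  let ?q = "\<lambda>N. Esum n N (\<lambda>g. real_of_int (g k) * (real_of_int (g k) - 1))"
  have "?q (Suc N) = Esum n N (\<lambda>g. (real_of_int (g k) + real k) * real_of_int (g k))"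
    using Esum_height_weighted[OF assms, of N "\<lambda>v. real_of_int v - 1"] by simp
  also have "\<dots> = Esum n N (\<lambda>g. real_of_int (g k) * (real_of_int (g k) - 1) + (real k + 1) * real_of_int (g k))"
    by (rule Esum_cong) (simp add: algebra_simps)
  also have "\<dots> = ?q N + (real k + 1) * ?h" by (simp only: Esum_add Esum_cmult)
  finally have "real n * (real n + 1) * ?q (Suc N) = real n * (real n + 1) * ?q N + (real n + 1) * (real k + 1) * (real n * ?h)"
    by (simp add: algebra_simps)
  also have "\<dots> = real k * (real k + 1) * real N * ((real N + real n) * ?c)"
    unfolding Suc Esum_height[OF assms] by (simp add: algebra_simps)
  also have "\<dots> = real k * (real k + 1) * real (Suc N) * (real (Suc N) - 1) * Esum n (Suc N) (\<lambda>_. 1)"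
    unfolding card_rec[symmetric] by (simp add: algebra_simps)
  finally show ?case .
qed

text \<open>In the expanded square the terms of order k^2 cancel up to u^2 n, so a height deviates
  from the line by order sqrt n only.\<close>

lemma Esum_height_var:
  assumes "k \<le> n" "0 < n" and u: "u = real N / real n"
  shows "Esum n N (\<lambda>g. (real_of_int (g k) - u * real k)^2) \<le> (u^2 + u) * real n * Esum n N (\<lambda>_. 1)"
proof -
  let ?c = "Esum n N (\<lambda>_. 1)"
  have c: "0 < ?c" by (rule card_profiles_pos[OF assms(2)])
  have N: "real N = u * real n" using assms by simp
  have u0: "0 \<le> u" using u by simp
  have k: "real k \<le> real n" using assms by simp
  have h: "Esum n N (\<lambda>g. real_of_int (g k)) = real k * u * ?c"
    using Esum_height[OF assms(1), of N] assms(2) N by (simp add: field_simps)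
  have q: "Esum n N (\<lambda>g. real_of_int (g k) * (real_of_int (g k) - 1)) \<le> (u^2 * real k^2 + u^2 * real n) * ?c"
  proof -
    have "real k * (real k + 1) * real N * (real N - 1) \<le> real n * (real n + 1) * (u^2 * real k^2 + u^2 * real n)"
    proof -
      have "real k * (real k + 1) * real N * (real N - 1) \<le> real k * (real k + 1) * (real N * real N)"
        by (simp add: mult_left_mono right_diff_distrib algebra_simps)
      also have "\<dots> = u^2 * real n * (real n * (real k * (real k + 1)))"
        by (simp add: N power2_eq_square algebra_simps)
      also have "\<dots> \<le> u^2 * real n * ((real n + 1) * (real k^2 + real n))"
      proof (intro mult_left_mono)
        have "real n * real k \<le> real n * real n" "0 \<le> real k * real k" "0 \<le> real n"
          using k by (auto intro: mult_left_mono)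
        moreover have "real n * (real k * (real k + 1)) = real n * (real k * real k) + real n * real k"
          by (simp add: algebra_simps)
        moreover have "(real n + 1) * (real k^2 + real n) = real n * (real k * real k) + real n * real n + real k * real k + real n"
          by (simp add: algebra_simps power2_eq_square)
        ultimately show "real n * (real k * (real k + 1)) \<le> (real n + 1) * (real k^2 + real n)"
          by linarith
      qed (use u0 in auto)
      finally show ?thesis by (simp add: algebra_simps)
    qed
    then have "real n * (real n + 1) * Esum n N (\<lambda>g. real_of_int (g k) * (real_of_int (g k) - 1))
      \<le> real n * (real n + 1) * ((u^2 * real k^2 + u^2 * real n) * ?c)"
      unfolding Esum_height_fact2[OF assms(1)] using mult_right_mono[of _ _ ?c] c by (metis less_imp_le mult.assoc)
    then show ?thesis using assms(2) by (simp add: mult_le_cancel_left)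
  qed
  have "Esum n N (\<lambda>g. (real_of_int (g k) - u * real k)^2)
    = Esum n N (\<lambda>g. (real_of_int (g k) * (real_of_int (g k) - 1) + (1 - 2 * u * real k) * real_of_int (g k)) + (u * real k)^2 * 1)"
    by (rule Esum_cong) (simp add: power2_eq_square algebra_simps)
  also have "\<dots> = Esum n N (\<lambda>g. real_of_int (g k) * (real_of_int (g k) - 1)) + (1 - 2 * u * real k) * (real k * u * ?c) + (u * real k)^2 * ?c"
    by (simp only: Esum_add Esum_cmult h)
  also have "\<dots> \<le> (u^2 * real k^2 + u^2 * real n) * ?c + (1 - 2 * u * real k) * (real k * u * ?c) + (u * real k)^2 * ?c"
    using q by simp
  also have "\<dots> = (u^2 * real n + u * real k) * ?c" by (simp add: power2_eq_square algebra_simps)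
  also have "\<dots> \<le> (u^2 + u) * real n * ?c"
    using c u0 k by (intro mult_right_mono) (auto simp: distrib_right intro: mult_left_mono)
  finally show ?thesis .
qed

section \<open>Fluctuations of the number of strict increments\<close>

definition steps :: "nat \<Rightarrow> (nat \<Rightarrow> int) \<Rightarrow> real" where
  "steps k g = (\<Sum>e<k. of_bool (g e < g (Suc e)))"

lemma Esum_step:
  assumes "i < n"
  shows "Esum n (Suc N) (\<lambda>g. of_bool (g i < g (Suc i))) = Esum n N (\<lambda>_. 1)"
  using Esum_lift[OF assms, of N "\<lambda>_. 1"] by simp

lemma Esum_step2:
  assumes "i < n" "j < n" "i \<noteq> j"
  shows "Esum n (Suc N) (\<lambda>g. of_bool (g i < g (Suc i)) * of_bool (g j < g (Suc j))) = Esum n N (\<lambda>g. of_bool (g j < g (Suc j)))"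
  unfolding Esum_lift[OF assms(1)] using assms
  by (intro Esum_cong) (auto simp: lift_at_def)

text \<open>A step on one edge, lifted away, leaves a profile of smaller total height, on which a
  step elsewhere is less likely. So steps are negatively correlated and the variance is of order n.
  For monotone profiles \<open>steps\<close> is the partial sum of the signs of the
  increments.\<close>

lemma Esum_steps_var:
  assumes "k \<le> n" "0 < n" and a: "a = real N / (real N + real n)"
  shows "Esum n N (\<lambda>g. (steps k g - a * real k)^2) \<le> 2 * real n * Esum n N (\<lambda>_. 1)"
proof (cases N)
  case 0
  have "Esum n N (\<lambda>g. (steps k g - a * real k)^2) = Esum n N (\<lambda>g. 0)"
  proof (rule Esum_cong)
    fix g assume g: "g \<in> profiles n N"
    have "steps k g = (\<Sum>e<k. 0)" unfolding steps_def
      using profiles_0[of g n] g 0 assms(1) by (intro sum.cong) auto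
    then show "(steps k g - a * real k)^2 = 0" using 0 a by simp
  qed
  then show ?thesis using card_profiles_pos[OF assms(2), of N] by (simp add: Esum_def)
next
  case (Suc M)
  let ?c = "Esum n N (\<lambda>_. 1)" and ?r = "\<lambda>i g. of_bool (g i < g (Suc i)) :: real"
  \<comment> \<open>The exact probability of a step on a given edge. It exceeds \<open>a\<close>,
    which is \<open>sigma\<close> of the slope, by at most 1 / n, and this shifts the mean of
    \<open>steps k\<close> by at most 1.\<close>
  define p where "p = real N / (real N + real n - 1)"
  have c: "0 < ?c" by (rule card_profiles_pos[OF assms(2)])
  have n1: "1 \<le> real n" "1 \<le> real N" and k: "real k \<le> real n" using assms Suc by simp_all
  have cM: "Esum n M (\<lambda>_. 1) = p * ?c"
    using card_rec[of M n] n1 Suc by (simp add: p_def field_simps)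
  have p: "0 \<le> p" "p \<le> 1" using n1 by (auto simp: p_def field_simps)
  have E1: "Esum n N (?r i) = p * ?c" if "i < n" for i
    using Esum_step[OF that, of M] Suc cM by simp
  \<comment> \<open>After lifting at i, the probability of a step at j is that for total height M,
    which is at most \<open>p\<close> since M < N.\<close>
  have E2: "Esum n N (\<lambda>g. ?r i g * ?r j g) \<le> p^2 * ?c" if "i < n" "j < n" "i \<noteq> j" for i j
  proof -
    have eq: "Esum n N (\<lambda>g. ?r i g * ?r j g) = Esum n M (?r j)"
      using Esum_step2[OF that, of M] Suc by simp
    have "Esum n M (?r j) \<le> p * Esum n M (\<lambda>_. 1)"
    proof (cases M)
      case 0
      have "Esum n M (?r j) = Esum n M (\<lambda>g. 0)"
      proof (rule Esum_cong)
        fix g assume "g \<in> profiles n M"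
        then show "?r j g = 0" using profiles_0[of g n j] profiles_0[of g n "Suc j"] 0 that by simp
      qed
      then show ?thesis using card_profiles_pos[OF assms(2), of M] p by (simp add: Esum_def)
    next
      case (Suc K)
      have "Esum n M (?r j) = Esum n K (\<lambda>_. 1)" using Esum_step[OF that(2), of K] Suc by simp
      also have "\<dots> = real M / (real M + real n - 1) * Esum n M (\<lambda>_. 1)"
        using card_rec[of K n] n1 Suc by (simp add: field_simps)
      also have "\<dots> \<le> p * Esum n M (\<lambda>_. 1)"
        using card_profiles_pos[OF assms(2), of M] n1 Suc \<open>N = Suc M\<close>
        by (intro mult_right_mono) (auto simp: p_def field_simps)
      finally show ?thesis .
    qed
    then show ?thesis using eq cM by (simp add: power2_eq_square)
  qed
  have S1: "Esum n N (steps k) = real k * p * ?c"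
  proof -
    have "Esum n N (steps k) = (\<Sum>i<k. Esum n N (?r i))"
      using Esum_sum[of n N ?r "{..<k}"] by (simp add: steps_def[abs_def])
    also have "\<dots> = (\<Sum>i<k. p * ?c)" using assms(1) by (intro sum.cong refl E1) auto
    finally show ?thesis by simp
  qed
  have S2: "Esum n N (\<lambda>g. steps k g * steps k g) \<le> (real k + real k^2 * p^2) * ?c"
  proof -
    have "Esum n N (\<lambda>g. steps k g * steps k g) = (\<Sum>i<k. \<Sum>j<k. Esum n N (\<lambda>g. ?r i g * ?r j g))"
      by (simp only: steps_def sum_product Esum_sum)
    also have "\<dots> \<le> (\<Sum>i<k. \<Sum>j<k. (if i = j then ?c else 0) + p^2 * ?c)"
    proof (intro sum_mono)
      fix i j assume ij: "i \<in> {..<k}" "j \<in> {..<k}"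
      show "Esum n N (\<lambda>g. ?r i g * ?r j g) \<le> (if i = j then ?c else 0) + p^2 * ?c"
      proof (cases "i = j")
        case True
        have "Esum n N (\<lambda>g. ?r i g * ?r j g) \<le> ?c" by (rule Esum_mono) simp
        then show ?thesis using True c by (simp add: add_increasing2)
      qed (use E2[of i j] ij assms(1) in auto)
    qed
    also have "\<dots> = (real k + real k^2 * p^2) * ?c"
      by (simp add: sum.distrib power2_eq_square algebra_simps)
    finally show ?thesis .
  qed
  have "Esum n N (\<lambda>g. (steps k g - a * real k)^2)
    = Esum n N (\<lambda>g. (steps k g * steps k g + (- 2 * a * real k) * steps k g) + (a * real k)^2 * 1)"
    by (rule Esum_cong) (simp add: power2_eq_square algebra_simps)
  also have "\<dots> = Esum n N (\<lambda>g. steps k g * steps k g) + (- 2 * a * real k) * (real k * p * ?c) + (a * real k)^2 * ?c"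
    by (simp only: Esum_add Esum_cmult S1)
  also have "\<dots> \<le> (real k + real k^2 * p^2) * ?c + (- 2 * a * real k) * (real k * p * ?c) + (a * real k)^2 * ?c"
    using S2 by simp
  also have "\<dots> = (real k + (real k * (p - a))^2) * ?c" by (simp add: power2_eq_square algebra_simps)
  also have "\<dots> \<le> (2 * real n) * ?c"
  proof -
    have eq: "p - a = p * (1 / (real N + real n))"
      using n1 by (simp add: p_def a field_simps)
    also have "\<dots> \<le> 1 * (1 / real n)" using p n1 by (intro mult_mono) (auto simp: field_simps)
    finally have pa: "p - a \<le> 1 / real n" by simp
    have "0 \<le> p - a" unfolding eq using p by simp
    have "real k * (p - a) \<le> real n * (1 / real n)"
      using pa k \<open>0 \<le> p - a\<close> by (intro mult_mono) auto
    then have "real k * (p - a) \<le> 1" using n1 by simp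
    then have "(real k * (p - a))^2 \<le> 1" using \<open>0 \<le> p - a\<close> by (simp add: power_le_one)
    then show ?thesis using c n1 k by (intro mult_right_mono) auto
  qed
  finally show ?thesis .
qed


text \<open>For a monotone function, closeness to the line on a grid of spacing B suffices: in
  between at most v B is lost. By |x| \<le> c / 2 + x^2 / (2 c) the maximum over the grid is
  replaced by a sum of squares, whose mean can be computed.\<close>

lemma grid_bound:
  fixes f :: "nat \<Rightarrow> real"
  assumes mono: "\<And>x y. x \<le> y \<Longrightarrow> y \<le> n \<Longrightarrow> f x \<le> f y" and "0 \<le> v" "0 < B" "0 < c" "k \<le> n"
  shows "\<bar>f k - v * real k\<bar> \<le> v * real B + c + (\<Sum>j\<le>n div B + 1. (f (min (j * B) n) - v * real (min (j * B) n))^2) / c"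
proof -
  let ?S = "\<lambda>x. f x - v * real x" and ?J = "n div B + 1"
  let ?R = "(\<Sum>j\<le>?J. (?S (min (j * B) n))^2) / c"
  define j where "j = k div B"
  define p where "p = min (j * B) n"
  define q where "q = min (Suc j * B) n"
  have jJ: "j \<le> n div B" unfolding j_def using assms by (intro div_le_mono)
  have jk: "j * B \<le> k" "k < Suc j * B"
    unfolding j_def using assms(3) by (auto simp: dividend_less_div_times add.commute)
  then have p: "p \<le> k" "k \<le> q" "q \<le> n" "q \<le> p + B" using assms(5) by (auto simp: p_def q_def)
  have amgm: "\<bar>x\<bar> \<le> c / 2 + (x^2 / c) / 2" for x :: real
  proof -
    have "0 \<le> (\<bar>x\<bar> - c)^2" by simp
    then have "2 * c * \<bar>x\<bar> \<le> c^2 + x^2" by (simp add: power2_diff algebra_simps)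
    then show ?thesis using assms(4) by (simp add: field_simps power2_eq_square)
  qed
  have single: "(?S (min (i * B) n))^2 / c \<le> ?R" if "i \<le> ?J" for i
    using assms(4) that by (intro divide_right_mono member_le_sum[where f = "\<lambda>j. (?S (min (j * B) n))^2"]) auto
  have half: "\<bar>x\<bar> \<le> c / 2 + R / 2" if "x^2 / c \<le> R" for x R
    by (rule order_trans[OF amgm[of x]], intro add_left_mono divide_right_mono that, simp)
  have Sp: "\<bar>?S p\<bar> \<le> c / 2 + ?R / 2" unfolding p_def by (rule half, rule single) (use jJ in simp)
  have Sq: "\<bar>?S q\<bar> \<le> c / 2 + ?R / 2" unfolding q_def by (rule half, rule single) (use jJ in simp)
  have "f p \<le> f k" "f k \<le> f q" using mono p assms(5) by auto
  moreover have "v * real k \<le> v * real p + v * real B" "v * real q \<le> v * real k + v * real B"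
    using p assms(2) by (auto simp: distrib_left[symmetric] intro!: mult_left_mono)
  ultimately have "\<bar>?S k\<bar> \<le> v * real B + (max \<bar>?S p\<bar> \<bar>?S q\<bar>)" by linarith
  also have "max \<bar>?S p\<bar> \<bar>?S q\<bar> \<le> c + ?R"
  proof -
    have "0 \<le> ?R" using assms(4) by (intro divide_nonneg_pos sum_nonneg) auto
    then show ?thesis using Sp Sq assms(4) by (simp)
  qed
  finally show ?thesis by (simp add: algebra_simps)
qed

text \<open>\<open>real N / (real N + real n)\<close> is \<open>sigma\<close> of the slope
  \<open>real N / real n\<close>. A majorant \<open>Y\<close> of the two suprema, rather than the
  suprema themselves, is what gets averaged over the profiles.\<close>

definition flucts :: "nat \<Rightarrow> nat \<Rightarrow> (nat \<Rightarrow> int) \<Rightarrow> real \<Rightarrow> bool" where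
  "flucts n N g Y \<longleftrightarrow> 0 \<le> Y \<and> (\<forall>k\<le>n. \<bar>real_of_int (g k) - real N / real n * real k\<bar> \<le> Y
     \<and> \<bar>steps k g - real N / (real N + real n) * real k\<bar> \<le> Y)"

lemma grid_sum_expect:
  assumes "\<And>k. k \<le> n \<Longrightarrow> Esum n N (\<lambda>g. (D k g)^2) \<le> V * Esum n N (\<lambda>_. 1)" "0 < c"
  shows "Esum n N (\<lambda>g. vB + c + (\<Sum>j\<le>J. (D (min (j * B) n) g)^2) / c) \<le> (vB + c + (real J + 1) * V / c) * Esum n N (\<lambda>_. 1)"
proof -
  have "Esum n N (\<lambda>g. vB + c + (\<Sum>j\<le>J. (D (min (j * B) n) g)^2) / c)
    = Esum n N (\<lambda>g. (vB + c) * 1 + 1 / c * (\<Sum>j\<le>J. (D (min (j * B) n) g)^2))" by simp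
  also have "\<dots> = (vB + c) * Esum n N (\<lambda>_. 1) + 1 / c * (\<Sum>j\<le>J. Esum n N (\<lambda>g. (D (min (j * B) n) g)^2))"
    by (simp only: Esum_add Esum_cmult Esum_sum)
  also have "\<dots> \<le> (vB + c) * Esum n N (\<lambda>_. 1) + 1 / c * (\<Sum>j\<le>J. V * Esum n N (\<lambda>_. 1))"
    using assms by (intro add_left_mono mult_left_mono sum_mono) auto
  also have "\<dots> = (vB + c + (real J + 1) * V / c) * Esum n N (\<lambda>_. 1)"
    by (simp add: algebra_simps add_divide_distrib)
  finally show ?thesis .
qed

text \<open>Variances are of order n while the tolerated square is of order n^2, so a grid with a
  number of points bounded in n controls all heights and step counts at once. The threshold for n is
  uniform in the total height up to C n.\<close>

lemma equilibrium_fluctuations: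
  assumes "0 < \<epsilon>" "0 \<le> C"
  shows "\<exists>n0>0. \<forall>n\<ge>n0. \<forall>N. real N \<le> C * real n \<longrightarrow>
    (\<exists>Y. (\<forall>g\<in>profiles n N. flucts n N g (Y g)) \<and> Esum n N Y \<le> \<epsilon> * real n * Esum n N (\<lambda>_. 1))"
proof -
  \<comment> \<open>Grid spacing b n: since C + 1 bounds both the slope \<open>u\<close> and the
    step density \<open>a\<close>, interpolation costs about \<epsilon> n / 8. The constant
    \<open>K\<close> below bounds the grid sum of the variances divided by c = \<epsilon> n / 8,
    which is free of n.\<close>
  define b where "b = \<epsilon> / (8 * (C + 1))"
  have b: "0 < b" "b * (C + 1) = \<epsilon> / 8" "b \<le> \<epsilon> / 8" using assms by (auto simp: b_def field_simps)
  define K where "K = (1 / b + 3) * (2 + C^2 + C) / (\<epsilon> / 8)"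
  obtain n0 where n0: "real n0 > 2 / b + 2 + 8 * (C+1) / \<epsilon> + 8 * K / \<epsilon>"
    using reals_Archimedean2 by blast
  have pos: "0 \<le> K" using b assms by (simp add: K_def)
  have n0': "real n0 > 2 / b" "real n0 > 2" "real n0 > 8 * (C+1) / \<epsilon>" "real n0 > 8 * K / \<epsilon>"
  proof -
    have "0 < 2 / b" "0 \<le> 8 * (C+1) / \<epsilon>" "0 \<le> 8 * K / \<epsilon>" using b assms pos by auto
    then show "real n0 > 2 / b" "real n0 > 2" "real n0 > 8 * (C+1) / \<epsilon>" "real n0 > 8 * K / \<epsilon>" using n0 by linarith+
  qed
  show ?thesis
  proof (intro exI[of _ n0] conjI allI impI)
    show "0 < n0" using n0'(2) by simp
    fix n N assume n: "n0 \<le> n" and N: "real N \<le> C * real n"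
    have n': "real n > 2 / b" "real n > 2" "real n > 8 * (C+1) / \<epsilon>" "real n > 8 * K / \<epsilon>"
      using n n0' by linarith+
    have np: "0 < n" using n'(2) by simp
    define B where "B = nat \<lceil>b * real n\<rceil>"
    have B: "b * real n \<le> real B" "real B \<le> b * real n + 1" "0 < B"
      using b(1) n' by (auto simp: B_def)
    define c where "c = \<epsilon> / 8 * real n"
    have c: "0 < c" using assms np by (simp add: c_def)
    let ?J = "n div B + 1"
    have J: "real ?J + 1 \<le> 1 / b + 3"
    proof -
      have "real (n div B) \<le> real n / real B" by (rule of_nat_div_le_of_nat)
      also have "\<dots> \<le> real n / (b * real n)" using B b np by (intro divide_left_mono) auto
      also have "\<dots> = 1 / b" using np by simp
      finally show ?thesis by simp
    qed
    define u where "u = real N / real n"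
    define a where "a = real N / (real N + real n)"
    have u: "0 \<le> u" "u \<le> C" using N np by (auto simp: u_def field_simps)
    have a: "0 \<le> a" "a \<le> 1" using np by (auto simp: a_def)
    define V where "V = (2 + C^2 + C) * real n"
    have V1: "Esum n N (\<lambda>g. (real_of_int (g k) - u * real k)^2) \<le> V * Esum n N (\<lambda>_. 1)" if "k \<le> n" for k
    proof -
      have "u^2 + u \<le> 2 + C^2 + C" using u by (smt (verit) power_mono)
      then have "(u^2 + u) * real n * Esum n N (\<lambda>_. 1) \<le> V * Esum n N (\<lambda>_. 1)"
        unfolding V_def using card_profiles_pos[OF np, of N] by (intro mult_right_mono) auto
      then show ?thesis using Esum_height_var[OF that np u_def] by linarith
    qed
    have V2: "Esum n N (\<lambda>g. (steps k g - a * real k)^2) \<le> V * Esum n N (\<lambda>_. 1)" if "k \<le> n" for k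
    proof -
      have "2 * real n * Esum n N (\<lambda>_. 1) \<le> V * Esum n N (\<lambda>_. 1)"
        unfolding V_def using card_profiles_pos[OF np, of N] assms by (intro mult_right_mono) auto
      then show ?thesis using Esum_steps_var[OF that np a_def] by linarith
    qed
    define D1 where "D1 = (\<lambda>k (g :: nat \<Rightarrow> int). real_of_int (g k) - u * real k)"
    define D2 where "D2 = (\<lambda>k g. steps k g - a * real k)"
    define Y1 where "Y1 g = u * real B + c + (\<Sum>j\<le>?J. (D1 (min (j * B) n) g)^2) / c" for g
    define Y2 where "Y2 g = a * real B + c + (\<Sum>j\<le>?J. (D2 (min (j * B) n) g)^2) / c" for g
    have nn: "0 \<le> Y1 g" "0 \<le> Y2 g" for g
      using u a c by (auto simp: Y1_def Y2_def intro!: add_nonneg_nonneg divide_nonneg_pos sum_nonneg)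
    have E: "v * real B + c + (real ?J + 1) * V / c \<le> \<epsilon> / 2 * real n" if "0 \<le> v" "v \<le> C + 1" for v
    proof -
      have "v * real B \<le> (C + 1) * (b * real n + 1)" using that B assms by (intro mult_mono) auto
      also have "\<dots> = b * (C + 1) * real n + (C + 1)" by (simp add: algebra_simps)
      also have "\<dots> = \<epsilon> / 8 * real n + (C + 1)" unfolding b(2) by simp
      also have "\<dots> \<le> \<epsilon> / 8 * real n + \<epsilon> / 8 * real n" using n'(3) assms by (simp add: field_simps)
      finally have 1: "v * real B \<le> \<epsilon> / 4 * real n" by simp
      have "(real ?J + 1) * V / c \<le> (1 / b + 3) * V / c"
        using J c np assms by (intro divide_right_mono mult_right_mono) (auto simp: V_def)
      also have "\<dots> = K" using np by (simp add: V_def c_def K_def)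
      also have "\<dots> \<le> \<epsilon> / 8 * real n" using n'(4) assms by (simp add: field_simps)
      finally show ?thesis using 1 by (simp add: c_def)
    qed
    show "\<exists>Y. (\<forall>g\<in>profiles n N. flucts n N g (Y g)) \<and> Esum n N Y \<le> \<epsilon> * real n * Esum n N (\<lambda>_. 1)"
    proof (intro exI[of _ "\<lambda>g. Y1 g + Y2 g"] conjI ballI)
      fix g assume g: "g \<in> profiles n N"
      have s: "steps x g \<le> steps y g" if "x \<le> y" for x y
        unfolding steps_def using that by (intro sum_mono2) auto
      have "\<bar>D1 k g\<bar> \<le> Y1 g" if "k \<le> n" for k
        unfolding Y1_def D1_def
        using profiles_mono[OF g] u(1) B(3) c that by (intro grid_bound) auto
      moreover have "\<bar>D2 k g\<bar> \<le> Y2 g" if "k \<le> n" for k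
        unfolding Y2_def D2_def
        using s a(1) B(3) c that by (intro grid_bound) auto
      ultimately show "flucts n N g (Y1 g + Y2 g)"
        using nn[of g] by (force simp: flucts_def D1_def D2_def u_def a_def)
    next
      have "Esum n N Y1 \<le> (u * real B + c + (real ?J + 1) * V / c) * Esum n N (\<lambda>_. 1)"
        unfolding Y1_def using V1 c by (intro grid_sum_expect) (auto simp: D1_def)
      also have "\<dots> \<le> (\<epsilon> / 2 * real n) * Esum n N (\<lambda>_. 1)"
        using E[of u] u card_profiles_pos[OF np, of N] by (intro mult_right_mono) auto
      finally have 1: "Esum n N Y1 \<le> (\<epsilon> / 2 * real n) * Esum n N (\<lambda>_. 1)" .
      have "Esum n N Y2 \<le> (a * real B + c + (real ?J + 1) * V / c) * Esum n N (\<lambda>_. 1)"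
        unfolding Y2_def using V2 c by (intro grid_sum_expect) (auto simp: D2_def)
      also have "\<dots> \<le> (\<epsilon> / 2 * real n) * Esum n N (\<lambda>_. 1)"
        using E[of a] a assms card_profiles_pos[OF np, of N] by (intro mult_right_mono) auto
      finally show "Esum n N (\<lambda>g. Y1 g + Y2 g) \<le> \<epsilon> * real n * Esum n N (\<lambda>_. 1)"
        using 1 by (simp add: Esum_add)
    qed
  qed
qed

section \<open>One-block estimate by energy comparison\<close>


text \<open>The drift of the squared distance along an edge. Its mean vanishes in equilibrium: for
  q > 0 the mean of \<eta> is q, and sgn \<eta> and its square have mean sigma q.\<close>
definition efun :: "real \<Rightarrow> real \<Rightarrow> real" where
  "efun \<eta> q = (sgn \<eta>)^2 - (\<eta> - q) * (sgn \<eta> - sigma q)"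

definition incr :: "(nat \<Rightarrow> int) \<Rightarrow> nat \<Rightarrow> real" where
  "incr h e = real_of_int (h (Suc e) - h e)"

text \<open>The constants are those of a tent with sides of slope \<beta>: second differences of
  size \<beta>, 2 \<beta>, \<beta> at three kinks, whence 4 \<beta>. Vanishing at site 0 and from
  \<open>n\<close> on removes the boundary terms and makes the null moves of the fixed ends
  harmless.\<close>

definition cutoff :: "nat \<Rightarrow> real \<Rightarrow> (nat \<Rightarrow> real) \<Rightarrow> bool" where
  "cutoff n \<beta> \<theta> \<longleftrightarrow> (\<forall>x. 0 \<le> \<theta> x \<and> \<theta> x \<le> 1) \<and> \<theta> 0 = 0 \<and> (\<forall>x\<ge>n. \<theta> x = 0)
     \<and> (\<forall>e. \<bar>\<theta> e - \<theta> (Suc e)\<bar> \<le> \<beta>) \<and> (\<Sum>e<n. \<bar>\<theta> e - 2 * \<theta> (Suc e) + \<theta> (Suc (Suc e))\<bar>) \<le> 4 * \<beta>"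

text \<open>An edge carries the weights of both its ends, since a move of either end uses it. A
  partition of unity therefore counts each edge twice.\<close>

definition block_energy :: "nat \<Rightarrow> (nat \<Rightarrow> real) \<Rightarrow> real \<Rightarrow> (nat \<Rightarrow> int) \<Rightarrow> real" where
  "block_energy n \<theta> u h = (\<Sum>e<n. (\<theta> e + \<theta> (Suc e)) * efun (incr h e) u)"

text \<open>The contraction of the coupling enters through the first assumption; w, d stand for
  h - u x and h - g at the two ends of an edge.\<close>
lemma edge_energy:
  fixes \<theta>0 \<theta>1 w0 w1 d0 d1 s r a :: real
  assumes contr: "(s - r)^2 \<le> (s - r) * (d1 - d0)" and "0 \<le> \<theta>0" "0 \<le> \<theta>1"
  shows "(\<theta>0 + \<theta>1) * (s^2 - (w1 - w0) * (s - a)) - 2 * a * (\<theta>1 * w1 - \<theta>0 * w0)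
      + (\<theta>0 - \<theta>1) * (s - a) * ((w0 - d0) + (w1 - d1)) + (r - a) * ((\<theta>0 - \<theta>1) * (d0 + d1))
    \<le> \<theta>0 * (((w0 + s)^2 - (d0 + (s - r))^2) - (w0^2 - d0^2)) + \<theta>1 * (((w1 - s)^2 - (d1 - (s - r))^2) - (w1^2 - d1^2))"
proof -
  \<comment> \<open>This product is exactly the right side minus the left side.\<close>
  have "0 \<le> (\<theta>0 + \<theta>1) * ((s - r) * (d1 - d0) - (s - r)^2)"
    using assms by simp
  then show ?thesis by (simp add: power2_eq_square algebra_simps)
qed

lemma sgn_contraction:
  fixes a b :: int
  shows "(sgn a - sgn b)^2 \<le> (sgn a - sgn b) * (a - b)"
  by (auto simp: sgn_if power2_eq_square)

lemma abel_sum: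
  fixes R c :: "nat \<Rightarrow> real"
  shows "(\<Sum>e<n. (R (Suc e) - R e) * c e) = R n * c n - R 0 * c 0 - (\<Sum>e<n. R (Suc e) * (c (Suc e) - c e))"
  by (induction n) (simp_all add: algebra_simps)

lemma tame_nonneg:
  assumes "tame n C h" "0 < n"
  shows "0 \<le> C"
proof -
  have "0 \<le> real_of_int (tv n h)" by (simp add: tv_def sum_nonneg)
  then have "0 \<le> C * real n" using assms(1) unfolding tame_def by linarith
  then show ?thesis using assms(2) by (simp add: zero_le_mult_iff)
qed

text \<open>Every error term carries one factor \<open>Y\<close>. Where \<theta> varies, g - u x
  enters directly. The signs of the increments of g enter through r - a, whose partial sums are
  small; they are summed by parts against the gradient of \<theta> times h - g, whose total
  variation is of order \<beta> C n. The bound on F comes from factorising the difference of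
  squares.\<close>

lemma energy_drift:
  assumes "cutoff n \<beta> \<theta>" "tame n C h" "g \<in> profiles n N" "real N \<le> C * real n" "flucts n N g Y" "0 < n"
  defines "u \<equiv> real N / real n"
  defines "F \<equiv> \<lambda>p. \<Sum>x\<le>n. \<theta> x * ((real_of_int (fst p x) - u * real x)^2 - (real_of_int (fst p x) - real_of_int (snd p x))^2)"
  shows "block_energy n \<theta> u h - \<beta> * real n * (4 + 20 * C) * Y \<le> 2 * real n * (avg n (move2 n) F (h, g) - F (h, g))"
    and "\<bar>F (h, g)\<bar> \<le> 4 * C * real n ^ 2 * Y"
proof -
  have th: "\<And>x. 0 \<le> \<theta> x" "\<And>x. \<theta> x \<le> 1" "\<theta> 0 = 0" "\<And>x. n \<le> x \<Longrightarrow> \<theta> x = 0"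
    "\<And>e. \<bar>\<theta> e - \<theta> (Suc e)\<bar> \<le> \<beta>" "(\<Sum>e<n. \<bar>\<theta> e - 2 * \<theta> (Suc e) + \<theta> (Suc (Suc e))\<bar>) \<le> 4 * \<beta>"
    using assms(1) unfolding cutoff_def by auto
  have be: "0 \<le> \<beta>" using th(5)[of 0] by linarith
  define a where "a = real N / (real N + real n)"
  have sig: "sigma u = a"
    using assms(6) unfolding sigma_def u_def a_def by (simp add: field_simps)
  have a: "0 \<le> a" "a \<le> 1" using assms(6) by (auto simp: a_def)
  have C: "0 \<le> C" by (rule tame_nonneg[OF assms(2,6)])
  define w where "w x = real_of_int (h x) - u * real x" for x
  define d where "d x = real_of_int (h x) - real_of_int (g x)" for x
  define s where "s e = real_of_int (sgn (h (Suc e) - h e))" for e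
  define r where "r e = real_of_int (sgn (g (Suc e) - g e))" for e
  define R where "R k = steps k g - a * real k" for k
  define c where "c e = (\<theta> e - \<theta> (Suc e)) * (d e + d (Suc e))" for e
  have Y: "0 \<le> Y" "\<And>k. k \<le> n \<Longrightarrow> \<bar>w k - d k\<bar> \<le> Y" "\<And>k. k \<le> n \<Longrightarrow> \<bar>R k\<bar> \<le> Y"
    using assms(5) unfolding flucts_def w_def d_def R_def u_def a_def by (auto simp: abs_minus_commute)
  have gb: "\<bar>real_of_int (g x)\<bar> \<le> C * real n" if "x \<le> n" for x
    using profiles_range[OF assms(3) that] assms(4) by simp
  have hb: "\<bar>real_of_int (h x)\<bar> \<le> C * real n" if "x \<le> n" for x
    by (rule tame_abs_le[OF assms(2) that])
  have db: "\<bar>d x\<bar> \<le> 2 * C * real n" if "x \<le> n" for x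
    using hb[OF that] gb[OF that] unfolding d_def by linarith
  have s_inc: "s e = sgn (incr h e)" for e by (auto simp: s_def incr_def sgn_if)
  have s1: "\<bar>s e\<bar> \<le> 1" for e by (simp add: s_def sgn_if)
  have r_step: "R (Suc e) - R e = r e - a" if "e < n" for e
    using assms(3) that unfolding R_def steps_def r_def profiles_def
    by (auto simp: algebra_simps sgn_if)
  have w_inc: "w (Suc e) - w e = incr h e - u" for e by (simp add: w_def incr_def algebra_simps)
  have d_inc: "d (Suc e) - d e = real_of_int ((h (Suc e) - h e) - (g (Suc e) - g e))" for e
    by (simp add: d_def)
  have contr: "(s e - r e)^2 \<le> (s e - r e) * (d (Suc e) - d e)" for e
    unfolding s_def r_def d_inc using sgn_contraction[of "h (Suc e) - h e" "g (Suc e) - g e"]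
    by (metis of_int_diff of_int_le_iff of_int_mult of_int_power)
  let ?X = "\<lambda>e. \<theta> e * (((w e + s e)^2 - (d e + (s e - r e))^2) - ((w e)^2 - (d e)^2))
     + \<theta> (Suc e) * (((w (Suc e) - s e)^2 - (d (Suc e) - (s e - r e))^2) - ((w (Suc e))^2 - (d (Suc e))^2))"
  have gen: "2 * real n * (avg n (move2 n) F (h, g) - F (h, g)) = (\<Sum>e<n. ?X e)"
  proof -
    let ?Q = "\<lambda>x (p::int) (q::int). \<theta> x * ((real_of_int p - u * real x)^2 - (real_of_int p - real_of_int q)^2)"
    have "2 * real n * (avg n (move2 n) F (h, g) - F (h, g)) =
      (\<Sum>e<n. (if 0 < e then ?Q e (h e + sgn (h (Suc e) - h e)) (g e + sgn (g (Suc e) - g e)) - ?Q e (h e) (g e) else 0)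
     + (if Suc e < n then ?Q (Suc e) (h (Suc e) - sgn (h (Suc e) - h e)) (g (Suc e) - sgn (g (Suc e) - g e)) - ?Q (Suc e) (h (Suc e)) (g (Suc e)) else 0))"
    proof -
      have F1: "F = (\<lambda>p. \<Sum>x\<le>n. ?Q x (fst p x) (snd p x))" and F2: "F (h, g) = (\<Sum>x\<le>n. ?Q x (h x) (g x))"
        by (simp_all add: F_def)
      show ?thesis unfolding F2 unfolding F1 by (rule avg_site_sum)
    qed
    \<comment> \<open>The null moves at the two fixed ends may be treated as real ones because
      \<theta> vanishes there.\<close>
    also have "\<dots> = (\<Sum>e<n. ?X e)"
    proof (intro sum.cong refl arg_cong2[where f = "(+)"])
      fix e assume "e \<in> {..<n}"
      have eqs: "real_of_int (h e + sgn (h (Suc e) - h e)) - u * real e = w e + s e"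
        "real_of_int (h e + sgn (h (Suc e) - h e)) - real_of_int (g e + sgn (g (Suc e) - g e)) = d e + (s e - r e)"
        "real_of_int (h (Suc e) - sgn (h (Suc e) - h e)) - u * real (Suc e) = w (Suc e) - s e"
        "real_of_int (h (Suc e) - sgn (h (Suc e) - h e)) - real_of_int (g (Suc e) - sgn (g (Suc e) - g e)) = d (Suc e) - (s e - r e)"
        by (simp_all add: w_def d_def s_def r_def del: of_nat_Suc)
      show "(if 0 < e then ?Q e (h e + sgn (h (Suc e) - h e)) (g e + sgn (g (Suc e) - g e)) - ?Q e (h e) (g e) else 0)
        = \<theta> e * (((w e + s e)^2 - (d e + (s e - r e))^2) - ((w e)^2 - (d e)^2))"
        unfolding eqs w_def[symmetric] d_def[symmetric] right_diff_distrib[symmetric] using th(3) by simp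
      show "(if Suc e < n then ?Q (Suc e) (h (Suc e) - sgn (h (Suc e) - h e)) (g (Suc e) - sgn (g (Suc e) - g e)) - ?Q (Suc e) (h (Suc e)) (g (Suc e)) else 0)
        = \<theta> (Suc e) * (((w (Suc e) - s e)^2 - (d (Suc e) - (s e - r e))^2) - ((w (Suc e))^2 - (d (Suc e))^2))"
        unfolding eqs w_def[symmetric] d_def[symmetric] right_diff_distrib[symmetric] using th(4)[of "Suc e"] by simp
    qed
    finally show ?thesis .
  qed
  let ?E2 = "\<Sum>e<n. (\<theta> e - \<theta> (Suc e)) * (s e - a) * ((w e - d e) + (w (Suc e) - d (Suc e)))"
  let ?E3 = "\<Sum>e<n. (R (Suc e) - R e) * c e"
  have "(\<Sum>e<n. (\<theta> e + \<theta> (Suc e)) * efun (incr h e) u - 2 * a * (\<theta> (Suc e) * w (Suc e) - \<theta> e * w e)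
      + (\<theta> e - \<theta> (Suc e)) * (s e - a) * ((w e - d e) + (w (Suc e) - d (Suc e))) + (R (Suc e) - R e) * c e) \<le> (\<Sum>e<n. ?X e)"
  proof (rule sum_mono)
    fix e assume "e \<in> {..<n}"
    then have r: "R (Suc e) - R e = r e - a" by (simp add: r_step)
    have ef: "efun (incr h e) u = (s e)^2 - (w (Suc e) - w e) * (s e - a)"
      by (simp only: efun_def sig s_inc w_inc)
    show "(\<theta> e + \<theta> (Suc e)) * efun (incr h e) u - 2 * a * (\<theta> (Suc e) * w (Suc e) - \<theta> e * w e)
      + (\<theta> e - \<theta> (Suc e)) * (s e - a) * ((w e - d e) + (w (Suc e) - d (Suc e))) + (R (Suc e) - R e) * c e \<le> ?X e"
      unfolding ef r c_def by (rule edge_energy[OF contr th(1) th(1)])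
  qed
  moreover have "(\<Sum>e<n. 2 * a * (\<theta> (Suc e) * w (Suc e) - \<theta> e * w e)) = 0"
    unfolding sum_distrib_left[symmetric] sum_lessThan_telescope[of "\<lambda>e. \<theta> e * w e" n] using th(3,4) by simp
  ultimately have main: "block_energy n \<theta> u h + ?E2 + ?E3 \<le> (\<Sum>e<n. ?X e)"
    by (simp add: sum.distrib sum_subtractf block_energy_def)
  have "\<bar>?E2\<bar> \<le> (\<Sum>e<n. \<beta> * 2 * (2 * Y))"
  proof (rule order_trans[OF sum_abs sum_mono])
    fix e assume e: "e \<in> {..<n}"
    have "\<bar>s e - a\<bar> \<le> 2" using s1[of e] a by linarith
    moreover have "\<bar>(w e - d e) + (w (Suc e) - d (Suc e))\<bar> \<le> 2 * Y"
      using Y(2)[of e] Y(2)[of "Suc e"] e by simp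
    ultimately show "\<bar>(\<theta> e - \<theta> (Suc e)) * (s e - a) * ((w e - d e) + (w (Suc e) - d (Suc e)))\<bar> \<le> \<beta> * 2 * (2 * Y)"
      unfolding abs_mult using th(5) be by (intro mult_mono) auto
  qed
  then have E2: "\<bar>?E2\<bar> \<le> \<beta> * real n * 4 * Y" by (simp add: algebra_simps)
  have "(\<Sum>e<n. \<bar>c (Suc e) - c e\<bar>) \<le> (\<Sum>e<n. \<bar>\<theta> e - 2 * \<theta> (Suc e) + \<theta> (Suc (Suc e))\<bar> * (4 * C * real n)
      + \<beta> * ((if Suc e < n then \<bar>d (Suc (Suc e)) - d (Suc e)\<bar> else 0) + \<bar>d (Suc e) - d e\<bar>))"
  proof (rule sum_mono)
    fix e assume e: "e \<in> {..<n}"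
    have eq: "c (Suc e) - c e = - ((\<theta> e - 2 * \<theta> (Suc e) + \<theta> (Suc (Suc e))) * (d e + d (Suc e)))
        + (\<theta> (Suc e) - \<theta> (Suc (Suc e))) * (d (Suc (Suc e)) - d e)"
      unfolding c_def by (simp add: algebra_simps)
    have 1: "\<bar>(\<theta> e - 2 * \<theta> (Suc e) + \<theta> (Suc (Suc e))) * (d e + d (Suc e))\<bar> \<le> \<bar>\<theta> e - 2 * \<theta> (Suc e) + \<theta> (Suc (Suc e))\<bar> * (4 * C * real n)"
      unfolding abs_mult using db[of e] db[of "Suc e"] e by (intro mult_left_mono) auto
    \<comment> \<open>At the last edge, \<open>d (Suc (Suc e))\<close> lies beyond the sites; its
      coefficient is 0 since \<theta> vanishes from \<open>n\<close> on.\<close>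
    have 2: "\<bar>(\<theta> (Suc e) - \<theta> (Suc (Suc e))) * (d (Suc (Suc e)) - d e)\<bar> \<le> \<beta> * ((if Suc e < n then \<bar>d (Suc (Suc e)) - d (Suc e)\<bar> else 0) + \<bar>d (Suc e) - d e\<bar>)"
    proof (cases "Suc e < n")
      case True
      then show ?thesis unfolding abs_mult using th(5)[of "Suc e"] be by (intro mult_mono) auto
    next
      case False
      then show ?thesis using th(4)[of "Suc e"] th(4)[of "Suc (Suc e)"] be by simp
    qed
    show "\<bar>c (Suc e) - c e\<bar> \<le> \<bar>\<theta> e - 2 * \<theta> (Suc e) + \<theta> (Suc (Suc e))\<bar> * (4 * C * real n)
      + \<beta> * ((if Suc e < n then \<bar>d (Suc (Suc e)) - d (Suc e)\<bar> else 0) + \<bar>d (Suc e) - d e\<bar>)"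
      using 1 2 unfolding eq by linarith
  qed
  also have "\<dots> = (\<Sum>e<n. \<bar>\<theta> e - 2 * \<theta> (Suc e) + \<theta> (Suc (Suc e))\<bar>) * (4 * C * real n)
      + \<beta> * ((\<Sum>e<n. if Suc e < n then \<bar>d (Suc (Suc e)) - d (Suc e)\<bar> else 0) + (\<Sum>e<n. \<bar>d (Suc e) - d e\<bar>))"
    by (simp only: sum.distrib sum_distrib_left[symmetric] sum_distrib_right[symmetric])
  \<comment> \<open>Second differences of \<theta> give the coefficient 16. The variations of h and
    g, at most C n each, enter twice and give 4, whence the 20.\<close>
  also have "\<dots> \<le> (4 * \<beta>) * (4 * C * real n) + \<beta> * (2 * C * real n + 2 * C * real n)"
  proof -
    have tvd: "(\<Sum>e<n. \<bar>d (Suc e) - d e\<bar>) \<le> 2 * C * real n"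
    proof -
      have "(\<Sum>e<n. \<bar>d (Suc e) - d e\<bar>) \<le> (\<Sum>e<n. real_of_int \<bar>h (Suc e) - h e\<bar> + real_of_int (g (Suc e) - g e))"
        unfolding d_inc using assms(3) by (intro sum_mono) (auto simp: profiles_def)
      also have "\<dots> = real_of_int (tv n h) + real_of_int (\<Sum>e<n. g (Suc e) - g e)"
        by (simp only: sum.distrib tv_def of_int_sum)
      also have "(\<Sum>e<n. g (Suc e) - g e) = int N"
        unfolding sum_lessThan_telescope using assms(3) by (simp add: profiles_def)
      finally show ?thesis using assms(2,4) unfolding tame_def by simp
    qed
    have shift: "(\<Sum>e<n. if Suc e < n then \<bar>d (Suc (Suc e)) - d (Suc e)\<bar> else 0) \<le> (\<Sum>e<n. \<bar>d (Suc e) - d e\<bar>)"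
    proof -
      obtain m where n: "n = Suc m" using assms(6) gr0_implies_Suc by blast
      have "(\<Sum>e<n. if Suc e < n then \<bar>d (Suc (Suc e)) - d (Suc e)\<bar> else 0) = (\<Sum>e<m. \<bar>d (Suc (Suc e)) - d (Suc e)\<bar>)"
        unfolding n sum.lessThan_Suc by simp
      then show ?thesis unfolding n sum.lessThan_Suc_shift by simp
    qed
    show ?thesis using th(6) tvd shift be C by (intro add_mono mult_mono) (auto intro!: add_nonneg_nonneg sum_nonneg)
  qed
  finally have dc: "(\<Sum>e<n. \<bar>c (Suc e) - c e\<bar>) \<le> 20 * C * \<beta> * real n" by (simp add: algebra_simps)
  have "\<bar>?E3\<bar> = \<bar>\<Sum>e<n. R (Suc e) * (c (Suc e) - c e)\<bar>"
    unfolding abel_sum using th(4) by (simp add: c_def R_def steps_def)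
  also have "\<dots> \<le> (\<Sum>e<n. Y * \<bar>c (Suc e) - c e\<bar>)"
    by (rule order_trans[OF sum_abs sum_mono]) (simp add: abs_mult Y mult_right_mono)
  also have "\<dots> \<le> Y * (20 * C * \<beta> * real n)"
    unfolding sum_distrib_left[symmetric] by (rule mult_left_mono[OF dc Y(1)])
  finally have E3: "\<bar>?E3\<bar> \<le> Y * (20 * C * \<beta> * real n)" .
  have "\<beta> * real n * (4 + 20 * C) * Y = \<beta> * real n * 4 * Y + Y * (20 * C * \<beta> * real n)" by (simp add: algebra_simps)
  then show "block_energy n \<theta> u h - \<beta> * real n * (4 + 20 * C) * Y \<le> 2 * real n * (avg n (move2 n) F (h, g) - F (h, g))"
    unfolding gen using main E2 E3 by linarith
  have "F (h, g) = (\<Sum>x<n. \<theta> x * ((w x)^2 - (d x)^2))"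
    using th(4)[of n] by (simp add: F_def w_def d_def lessThan_Suc_atMost[symmetric])
  also have "\<bar>\<dots>\<bar> \<le> (\<Sum>x<n. 1 * (Y * (4 * C * real n)))"
  proof (rule order_trans[OF sum_abs sum_mono])
    fix x assume x: "x \<in> {..<n}"
    have "\<bar>u * real x\<bar> \<le> C * real n"
    proof -
      have "u * real x \<le> u * real n" "0 \<le> u * real x" using x mult_left_mono[of "real x" "real n" u] by (auto simp: u_def)
      then show ?thesis using assms(4,6) by (simp add: u_def)
    qed
    then have "\<bar>w x + d x\<bar> \<le> 4 * C * real n"
      using hb[of x] gb[of x] x unfolding w_def d_def by simp
    moreover have "(w x)^2 - (d x)^2 = (w x - d x) * (w x + d x)"
      by (simp add: power2_eq_square algebra_simps)
    ultimately have "\<bar>(w x)^2 - (d x)^2\<bar> \<le> Y * (4 * C * real n)"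
      using Y(2)[of x] x Y(1) by (simp only: abs_mult, intro mult_mono) auto
    then show "\<bar>\<theta> x * ((w x)^2 - (d x)^2)\<bar> \<le> 1 * (Y * (4 * C * real n))"
      unfolding abs_mult using th(1,2)[of x] by (intro mult_mono) auto
  qed
  finally show "\<bar>F (h, g)\<bar> \<le> 4 * C * real n ^ 2 * Y" by (simp add: power2_eq_square algebra_simps)
qed

lemma profiles_move:
  assumes "g \<in> profiles n N" "e < n"
  shows "move n e b g \<in> profiles n N"
proof -
  have le: "\<And>x. x < n \<Longrightarrow> g x \<le> g (Suc x)" using assms(1) by (auto simp: profiles_def)
  have sg: "x + sgn (y - x) \<le> y" "x \<le> x + sgn (y - x)" if "x \<le> y" for x y :: int
    using that by (auto simp: sgn_if)
  obtain m where n: "n = Suc m" using assms(2) by (cases n) auto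
  show ?thesis
  proof (cases b)
    case True
    show ?thesis
    proof (cases e)
      case (Suc x)
      have "g(Suc x := g (Suc x) + sgn (g (Suc (Suc x)) - g (Suc x))) \<in> profiles (Suc m) N"
        using assms le[of x] le[of "Suc x"] sg[of "g (Suc x)" "g (Suc (Suc x))"] unfolding n Suc
        by (intro profiles_upd) auto
      then show ?thesis using True Suc n by (simp add: move_def)
    qed (simp add: move_def True assms(1))
  next
    case False
    show ?thesis
    proof (cases "Suc e < n")
      case c: True
      have "g(Suc e := g (Suc e) - sgn (g (Suc e) - g e)) \<in> profiles (Suc m) N"
        using assms c le[of e] le[of "Suc e"] sg[of "g e" "g (Suc e)"] unfolding n
        by (intro profiles_upd) (auto simp: sgn_if)
      then show ?thesis using False c n by (simp add: move_def)
    qed (simp add: move_def assms(1) False)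
  qed
qed

lemma Esum_run_snd:
  assumes "0 < n"
  shows "Esum n N (\<lambda>g. run n (move2 n) k (\<lambda>p. Y (snd p)) (h, g)) = Esum n N Y"
  using Esum_run[OF assms] by (simp add: run_snd)

text \<open>The drifts of F telescope to its values at the two end times, of order n^2
  \<open>Y\<close>, times 2 n; the errors add \<beta> n \<open>Y\<close> per step. Averaged over
  stationary g, the mean of \<open>Y\<close> is at most \<kappa> n at every time. For \<beta> = 1 /
  B and T up to n B^2 with B \<le> n, both terms on the right are at most \<epsilon> n^4.\<close>

lemma block_energy_time_pos:
  assumes "0 < \<epsilon>" "0 \<le> C"
  shows "\<exists>n0>0. \<forall>n\<ge>n0. \<forall>N. real N \<le> C * real n \<longrightarrow> (\<forall>\<beta> \<theta> h T. cutoff n \<beta> \<theta> \<longrightarrow> tame n C h \<longrightarrow>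
    (\<Sum>k<T. run n (move n) k (block_energy n \<theta> (real N / real n)) h) \<le> \<epsilon> * (real n ^ 4 + real T * \<beta> * real n ^ 2))"
proof -
  define \<kappa> where "\<kappa> = \<epsilon> / (4 + 20 * C)"
  have k: "0 < \<kappa>" "\<kappa> * (4 + 20 * C) = \<epsilon>" using assms by (auto simp: \<kappa>_def)
  obtain n0 where n0: "n0 > 0" "\<And>n N. n \<ge> n0 \<Longrightarrow> real N \<le> C * real n \<Longrightarrow>
    \<exists>Y. (\<forall>g\<in>profiles n N. flucts n N g (Y g)) \<and> Esum n N Y \<le> \<kappa> * real n * Esum n N (\<lambda>_. 1)"
    using equilibrium_fluctuations[OF k(1) assms(2)] by blast
  show ?thesis
  proof (intro exI[of _ n0] conjI allI impI)
    fix n N \<beta> \<theta> h T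
    assume n: "n0 \<le> n" and N: "real N \<le> C * real n" and th: "cutoff n \<beta> \<theta>" and h: "tame n C h"
    have np: "0 < n" using n n0(1) by simp
    obtain Y where Y: "\<And>g. g \<in> profiles n N \<Longrightarrow> flucts n N g (Y g)" "Esum n N Y \<le> \<kappa> * real n * Esum n N (\<lambda>_. 1)"
      using n0(2)[OF n N] by blast
    define u where "u = real N / real n"
    define F where "F = (\<lambda>p. \<Sum>x\<le>n. \<theta> x * ((real_of_int (fst p x) - u * real x)^2 - (real_of_int (fst p x) - real_of_int (snd p x))^2))"
    define K where "K = \<beta> * real n * (4 + 20 * C)"
    define K' where "K' = 4 * C * real n ^ 2"
    define I where "I = (\<lambda>p. tame n C (fst p) \<and> snd p \<in> profiles n N)"
    have be: "0 \<le> \<beta>" using th unfolding cutoff_def by (meson abs_ge_zero order_trans)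
    have inv: "I (move2 n e b q)" if "I q" "e < n" for q e b
      using that tame_move profiles_move by (auto simp: I_def move2_def)
    have drift: "block_energy n \<theta> u (fst p) \<le> 2 * real n * (avg n (move2 n) F p - F p) + K * Y (snd p)"
      and bd: "\<bar>F p\<bar> \<le> K' * Y (snd p)" if "I p" for p
      using energy_drift[OF th _ _ N Y(1) np, of "fst p" "snd p"] that
      unfolding I_def F_def u_def K_def K'_def by auto
    have bd': "F p \<le> K' * Y (snd p)" if "I p" for p using bd[OF that] by simp
    have each: "(\<Sum>k<T. run n (move n) k (block_energy n \<theta> u) h)
      \<le> 2 * real n * (K' * run n (move2 n) T (\<lambda>p. Y (snd p)) (h, g) + K' * Y g) + K * (\<Sum>k<T. run n (move2 n) k (\<lambda>p. Y (snd p)) (h, g))"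
      if g: "g \<in> profiles n N" for g
    proof -
      have I: "I (h, g)" using h g by (simp add: I_def)
      have "(\<Sum>k<T. run n (move n) k (block_energy n \<theta> u) h)
        = (\<Sum>k<T. run n (move2 n) k (\<lambda>p. block_energy n \<theta> u (fst p)) (h, g))"
        by (simp add: run_fst)
      also have "\<dots> \<le> (\<Sum>k<T. run n (move2 n) k (\<lambda>p. 2 * real n * (avg n (move2 n) F p - F p) + K * Y (snd p)) (h, g))"
        by (intro sum_mono run_mono[where I = I] inv I drift)
      also have "\<dots> = 2 * real n * (run n (move2 n) T F (h, g) - F (h, g)) + K * (\<Sum>k<T. run n (move2 n) k (\<lambda>p. Y (snd p)) (h, g))"
        by (simp only: run_add run_cmult run_dynkin sum.distrib sum_distrib_left)
      also have "\<dots> \<le> 2 * real n * (K' * run n (move2 n) T (\<lambda>p. Y (snd p)) (h, g) + K' * Y g) + K * (\<Sum>k<T. run n (move2 n) k (\<lambda>p. Y (snd p)) (h, g))"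
      proof (intro add_right_mono mult_left_mono)
        have "run n (move2 n) T F (h, g) \<le> K' * run n (move2 n) T (\<lambda>p. Y (snd p)) (h, g)"
          unfolding run_cmult[symmetric] by (intro run_mono[where I = I] inv I bd')
        moreover have "- F (h, g) \<le> K' * Y g" using bd[OF I] by simp
        ultimately show "run n (move2 n) T F (h, g) - F (h, g) \<le> K' * run n (move2 n) T (\<lambda>p. Y (snd p)) (h, g) + K' * Y g"
          by linarith
      qed simp
      finally show ?thesis .
    qed
    let ?c = "Esum n N (\<lambda>_. 1)"
    let ?L = "\<Sum>k<T. run n (move n) k (block_energy n \<theta> u) h"
    have c: "0 < ?c" by (rule card_profiles_pos[OF np])
    \<comment> \<open>The left side does not involve g, so g may be averaged over all stationary
      profiles.\<close>
    have "?L * ?c \<le> Esum n N (\<lambda>g. 2 * real n * (K' * run n (move2 n) T (\<lambda>p. Y (snd p)) (h, g) + K' * Y g) + K * (\<Sum>k<T. run n (move2 n) k (\<lambda>p. Y (snd p)) (h, g)))"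
      unfolding Esum_const[symmetric] by (rule Esum_mono) (rule each)
    also have "\<dots> = (4 * real n * K' + K * real T) * Esum n N Y"
      by (simp only: Esum_add Esum_cmult Esum_sum Esum_run_snd[OF np]) (simp add: algebra_simps)
    also have "\<dots> \<le> (4 * real n * K' + K * real T) * (\<kappa> * real n * ?c)"
      using be assms(2) by (intro mult_left_mono Y(2)) (auto simp: K_def K'_def)
    also have "\<dots> = (16 * C * \<kappa> * real n ^ 4 + \<kappa> * (4 + 20 * C) * (real T * \<beta> * real n ^ 2)) * ?c"
      unfolding K_def K'_def by (simp add: power2_eq_square power4_eq_xxxx algebra_simps)
    finally have "?L \<le> 16 * C * \<kappa> * real n ^ 4 + \<kappa> * (4 + 20 * C) * (real T * \<beta> * real n ^ 2)"
      using c by simp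
    moreover have "16 * C * \<kappa> * real n ^ 4 \<le> \<epsilon> * real n ^ 4"
      using k assms by (intro mult_right_mono) (auto simp: k(2)[symmetric] algebra_simps)
    ultimately show "(\<Sum>k<T. run n (move n) k (block_energy n \<theta> (real N / real n)) h) \<le> \<epsilon> * (real n ^ 4 + real T * \<beta> * real n ^ 2)"
      unfolding k(2) unfolding u_def distrib_left by linarith
  qed (rule n0(1))
qed

lemma efun_uminus: "efun (- \<eta>) (- q) = efun \<eta> q"
proof -
  have "sigma (- q) = - sigma q" by (simp add: sigma_def)
  then have "efun (- \<eta>) (- q) = (sgn \<eta>)^2 - (- \<eta> - - q) * (- sgn \<eta> - - sigma q)"
    by (simp only: efun_def sgn_minus power2_minus)
  also have "(- \<eta> - - q) * (- sgn \<eta> - - sigma q) = (\<eta> - q) * (sgn \<eta> - sigma q)"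
    by algebra
  finally show ?thesis by (simp only: efun_def)
qed

text \<open>Negative slopes follow by reflecting h, since \<open>efun\<close> is unchanged when both
  of its arguments change sign.\<close>

lemma block_energy_time:
  assumes "0 < \<epsilon>" "0 \<le> C"
  shows "\<exists>n0>0. \<forall>n\<ge>n0. \<forall>N. \<bar>real_of_int N\<bar> \<le> C * real n \<longrightarrow> (\<forall>\<beta> \<theta> h T. cutoff n \<beta> \<theta> \<longrightarrow> tame n C h \<longrightarrow>
    (\<Sum>k<T. run n (move n) k (block_energy n \<theta> (real_of_int N / real n)) h) \<le> \<epsilon> * (real n ^ 4 + real T * \<beta> * real n ^ 2))"
proof -
  obtain n0 where n0: "n0 > 0" "\<forall>n\<ge>n0. \<forall>N. real N \<le> C * real n \<longrightarrow> (\<forall>\<beta> \<theta> h T. cutoff n \<beta> \<theta> \<longrightarrow> tame n C h \<longrightarrow>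
    (\<Sum>k<T. run n (move n) k (block_energy n \<theta> (real N / real n)) h) \<le> \<epsilon> * (real n ^ 4 + real T * \<beta> * real n ^ 2))"
    using block_energy_time_pos[OF assms] by (elim exE conjE) (rule that)
  show ?thesis
  proof (intro exI[of _ n0] conjI allI impI)
    fix n N \<beta> \<theta> h T
    assume n: "n0 \<le> n" and N: "\<bar>real_of_int N\<bar> \<le> C * real n" and th: "cutoff n \<beta> \<theta>" and h: "tame n C h"
    have N': "real (nat \<bar>N\<bar>) \<le> C * real n" using N by simp
    show "(\<Sum>k<T. run n (move n) k (block_energy n \<theta> (real_of_int N / real n)) h) \<le> \<epsilon> * (real n ^ 4 + real T * \<beta> * real n ^ 2)"
    proof (cases "0 \<le> N")
      case True
      then show ?thesis using n0(2)[rule_format, OF n N' th h, of T] by simp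
    next
      case False
      have "block_energy n \<theta> (real_of_int N / real n) = (\<lambda>h. block_energy n \<theta> (real (nat \<bar>N\<bar>) / real n) (\<lambda>x. - h x))"
      proof
        fix h
        have "incr (\<lambda>x. - h x) e = - incr h e" for e by (simp add: incr_def)
        then show "block_energy n \<theta> (real_of_int N / real n) h = block_energy n \<theta> (real (nat \<bar>N\<bar>) / real n) (\<lambda>x. - h x)"
          using efun_uminus[of "incr h _" "real_of_int N / real n"] False by (simp add: block_energy_def)
      qed
      then show ?thesis using n0(2)[rule_format, OF n N' th tame_uminus[OF h], of T] by (simp add: run_uminus)
    qed
  qed (rule n0(1))
qed

section \<open>Euler scheme\<close>


text \<open>The last bound is an inverse Lipschitz property: the derivative of \<open>sigma\<close>
  on [-C, C] is at least 1 / (1 + C)^2. It converts control of \<open>sigma\<close> of the slopes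
  into control of the slopes.\<close>

lemma sigma_diff:
  assumes "a \<le> b"
  shows "0 \<le> sigma b - sigma a" "sigma b - sigma a \<le> b - a"
    and "\<bar>a\<bar> \<le> C \<Longrightarrow> \<bar>b\<bar> \<le> C \<Longrightarrow> b - a \<le> (1 + C)^2 * (sigma b - sigma a)"
proof -
  define D where "D = (1 + \<bar>a\<bar>) * (1 + \<bar>b\<bar>)"
  define E where "E = b * (1 + \<bar>a\<bar>) - a * (1 + \<bar>b\<bar>)"
  have D: "1 \<le> D" unfolding D_def using mult_mono[of 1 "1 + \<bar>a\<bar>" 1 "1 + \<bar>b\<bar>"] by simp
  have eq: "sigma b - sigma a = E / D"
    unfolding sigma_def D_def E_def by (simp add: field_simps)
  have E: "b - a \<le> E" "0 \<le> E"
  proof -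
    have "a * \<bar>b\<bar> \<le> b * \<bar>a\<bar>" using assms by (auto simp: abs_if mult_less_0_iff mult_le_0_iff intro: mult_nonneg_nonneg)
    then show "b - a \<le> E" by (simp add: E_def algebra_simps)
    then show "0 \<le> E" using assms by simp
  qed
  have E': "E \<le> (b - a) * D"
  proof -
    have "(b - a) * D - E = (b - a) * (\<bar>a\<bar> + \<bar>b\<bar> + \<bar>a\<bar> * \<bar>b\<bar>) - (b * \<bar>a\<bar> - a * \<bar>b\<bar>)"
      by (simp add: D_def E_def algebra_simps)
    moreover have "b * \<bar>a\<bar> - a * \<bar>b\<bar> \<le> (b - a) * (\<bar>a\<bar> + \<bar>b\<bar>)"
    proof -
      have "a * \<bar>a\<bar> \<le> b * \<bar>b\<bar>"
      proof (cases "0 \<le> a \<or> b \<le> 0")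
        case True
        then show ?thesis using assms mult_mono[of a b a b] mult_mono[of "- b" "- a" "- b" "- a"] by auto
      next
        case False
        then have "a * \<bar>a\<bar> \<le> 0" "0 \<le> b * \<bar>b\<bar>" by (auto simp: mult_nonpos_nonneg)
        then show ?thesis by linarith
      qed
      then show ?thesis by (simp add: algebra_simps)
    qed
    moreover have "0 \<le> (b - a) * (\<bar>a\<bar> * \<bar>b\<bar>)" using assms by simp
    ultimately show ?thesis by (simp add: distrib_left)
  qed
  show "0 \<le> sigma b - sigma a" unfolding eq using E D by simp
  show "sigma b - sigma a \<le> b - a" unfolding eq using E' D by (simp add: pos_divide_le_eq)
  assume "\<bar>a\<bar> \<le> C" "\<bar>b\<bar> \<le> C"
  then have "D \<le> (1 + C)^2" unfolding D_def power2_eq_square by (intro mult_mono) auto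
  then have "E \<le> (1 + C)^2 * E / D" using D E by (simp add: pos_le_divide_eq mult_right_mono mult.commute[of E])
  then show "b - a \<le> (1 + C)^2 * (sigma b - sigma a)" unfolding eq using E by simp
qed

lemma sigma_mono: "a \<le> b \<Longrightarrow> sigma a \<le> sigma b"
  using sigma_diff(1)[of a b] by simp

lemma sigma_lip: "\<bar>sigma b - sigma a\<bar> \<le> \<bar>b - a\<bar>"
  using sigma_diff[of a b] sigma_diff[of b a] by linarith

lemma sigma_inverse_lip: "\<bar>a\<bar> \<le> C \<Longrightarrow> \<bar>b\<bar> \<le> C \<Longrightarrow> \<bar>b - a\<bar> \<le> (1 + C)^2 * \<bar>sigma b - sigma a\<bar>"
  using sigma_diff[of a b] sigma_diff[of b a] by (cases "a \<le> b") auto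

lemma sigma_bound: "\<bar>sigma q\<bar> \<le> 1"
  by (simp add: sigma_def field_simps abs_if)

definition slope :: "(nat \<Rightarrow> real) \<Rightarrow> nat \<Rightarrow> real" where
  "slope P e = P (Suc e) - P e"

text \<open>The time step 1 / n is the mean duration of one move at total rate n. So step k of the
  scheme matches move k of the discrete chain and time k / n of the differential equations.\<close>

definition euler_step :: "nat \<Rightarrow> (nat \<Rightarrow> real) \<Rightarrow> nat \<Rightarrow> real" where
  "euler_step n P x = P x + (if 0 < x \<and> x < n then (sigma (slope P x) - sigma (slope P (x - 1))) / (2 * real n) else 0)"

definition euler :: "nat \<Rightarrow> (nat \<Rightarrow> real) \<Rightarrow> nat \<Rightarrow> nat \<Rightarrow> real" where
  "euler n P k = (euler_step n ^^ k) P"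

lemma euler_0 [simp]: "euler n P 0 = P"
  and euler_Suc: "euler n P (Suc k) = euler_step n (euler n P k)"
  by (simp_all add: euler_def)

lemma add_double: "a + l * (y + y) = a + (2 * l) * (y :: real)"
  by (simp add: algebra_simps)

text \<open>A discrete comparison principle. Where P - Q lies below M by some amount, each of the
  two fluxes can raise it by at most that amount times 1 / (2 n), because \<open>sigma\<close> is
  nondecreasing and 1-Lipschitz; hence M is not passed.\<close>

lemma euler_step_le:
  assumes "0 < n" "\<And>x. x \<le> n \<Longrightarrow> P x - Q x \<le> M" "0 \<le> M" "x \<le> n"
  shows "euler_step n P x - euler_step n Q x \<le> M"
proof (cases "0 < x \<and> x < n")
  case True
  then obtain y where x: "x = Suc y" by (cases x) auto
  let ?d = "P x - Q x" and ?l = "1 / (2 * real n)"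
  have d: "?d \<le> M" by (rule assms(2)) (use True in simp)
  have 1: "sigma (slope P x) - sigma (slope Q x) \<le> M - ?d"
  proof (cases "slope Q x \<le> slope P x")
    case t: True
    have "P (Suc x) - Q (Suc x) \<le> M" by (rule assms(2)) (use True in simp)
    then show ?thesis using sigma_diff(2)[OF t] by (simp add: slope_def)
  qed (use sigma_mono[of "slope P x" "slope Q x"] d in simp)
  have 2: "sigma (slope Q y) - sigma (slope P y) \<le> M - ?d"
  proof (cases "slope P y \<le> slope Q y")
    case t: True
    have "P y - Q y \<le> M" by (rule assms(2)) (use True x in simp)
    then show ?thesis using sigma_diff(2)[OF t] by (simp add: slope_def x)
  qed (use sigma_mono[of "slope Q y" "slope P y"] d in simp)
  have "euler_step n P x - euler_step n Q x
    = ?d + ?l * ((sigma (slope P x) - sigma (slope Q x)) + (sigma (slope Q y) - sigma (slope P y)))"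
    using True by (simp add: euler_step_def x diff_divide_distrib add_divide_distrib)
  also have "\<dots> \<le> ?d + ?l * ((M - ?d) + (M - ?d))"
    using 1 2 by (intro add_left_mono mult_left_mono add_mono) auto
  also have "\<dots> = ?d + (2 * ?l) * (M - ?d)" by (rule add_double)
  also have "\<dots> \<le> ?d + 1 * (M - ?d)"
    using d assms(1) by (intro add_left_mono mult_right_mono) (auto simp: field_simps)
  finally show ?thesis by simp
next
  case False
  then have "euler_step n P x - euler_step n Q x = P x - Q x" by (auto simp: euler_step_def)
  then show ?thesis using assms(2)[OF assms(4)] by simp
qed

lemma euler_step_contraction:
  assumes "0 < n" "\<And>x. x \<le> n \<Longrightarrow> \<bar>P x - Q x\<bar> \<le> M" "x \<le> n"
  shows "\<bar>euler_step n P x - euler_step n Q x\<bar> \<le> M"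
proof -
  have M: "0 \<le> M" using assms(2)[OF assms(3)] by linarith
  have "euler_step n P x - euler_step n Q x \<le> M" "euler_step n Q x - euler_step n P x \<le> M"
    using assms(2) by (intro euler_step_le assms(1,3) M; fastforce simp: abs_le_iff)+
  then show ?thesis by linarith
qed

text \<open>The comparison argument one level up: slopes change by differences of
  \<open>sigma\<close> between neighbouring edges. At the two extreme edges one of these differences
  is absent, because the end heights are fixed.\<close>

lemma euler_step_slope_le:
  assumes "0 < n" "\<And>e. e < n \<Longrightarrow> slope P e \<le> C" "e < n"
  shows "slope (euler_step n P) e \<le> C"
proof -
  let ?q = "slope P e" and ?l = "1 / (2 * real n)"
  have q: "?q \<le> C" by (rule assms(2)[OF assms(3)])
  define X where "X = (if Suc e < n then sigma (slope P (Suc e)) - sigma ?q else 0)"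
  define Y where "Y = (if 0 < e then sigma (slope P (e - 1)) - sigma ?q else 0)"
  have "X \<le> sigma C - sigma ?q" "Y \<le> sigma C - sigma ?q"
    unfolding X_def Y_def using sigma_mono assms(2)[of "Suc e"] assms(2)[of "e - 1"] q assms(3) by auto
  then have XY: "X \<le> C - ?q" "Y \<le> C - ?q" using sigma_diff(2)[OF q] by linarith+
  have "slope (euler_step n P) e = ?q + ?l * (X + Y)"
    using assms(3) by (auto simp: slope_def[of "euler_step n P"] euler_step_def X_def Y_def slope_def[of P e] diff_divide_distrib add_divide_distrib)
  also have "\<dots> \<le> ?q + ?l * ((C - ?q) + (C - ?q))"
    using XY by (intro add_left_mono mult_left_mono add_mono) auto
  also have "\<dots> = ?q + (2 * ?l) * (C - ?q)" by (rule add_double)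
  also have "\<dots> \<le> ?q + 1 * (C - ?q)"
    using q assms(1) by (intro add_left_mono mult_right_mono) (auto simp: field_simps)
  finally show ?thesis by simp
qed

lemma euler_step_uminus: "euler_step n (\<lambda>x. - P x) = (\<lambda>x. - euler_step n P x)"
proof
  fix x
  have s: "sigma (slope (\<lambda>x. - P x) e) = - sigma (slope P e)" for e
  proof -
    have "slope (\<lambda>x. - P x) e = - slope P e" by (simp add: slope_def)
    then show ?thesis by (simp add: sigma_def)
  qed
  show "euler_step n (\<lambda>x. - P x) x = - euler_step n P x"
    unfolding euler_step_def s by (simp add: diff_divide_distrib)
qed

text \<open>Smoothness is imposed on \<open>sigma\<close> of the slope and not on second differences
  of the heights: its differences are 2 n times the displacement in one Euler step, and this
  displacement cannot grow in time.\<close>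

definition smooth_profile :: "nat \<Rightarrow> real \<Rightarrow> real \<Rightarrow> (nat \<Rightarrow> real) \<Rightarrow> bool" where
  "smooth_profile n C K P \<longleftrightarrow> P 0 = 0 \<and> P n = 0 \<and> (\<forall>e<n. \<bar>slope P e\<bar> \<le> C)
     \<and> (\<forall>x. 0 < x \<and> x < n \<longrightarrow> \<bar>sigma (slope P x) - sigma (slope P (x - 1))\<bar> \<le> K / real n)"

lemma smooth_step_diff:
  assumes "0 < n" "0 \<le> K" "smooth_profile n C K P" "x \<le> n"
  shows "\<bar>euler_step n P x - P x\<bar> \<le> K / (2 * real n ^ 2)"
proof (cases "0 < x \<and> x < n")
  case True
  then have "\<bar>euler_step n P x - P x\<bar> = \<bar>sigma (slope P x) - sigma (slope P (x - 1))\<bar> / (2 * real n)"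
    by (simp add: euler_step_def)
  also have "\<dots> \<le> (K / real n) / (2 * real n)"
    using assms(3) True unfolding smooth_profile_def by (intro divide_right_mono) auto
  finally show ?thesis by (simp add: power2_eq_square)
next
  case False
  then have "euler_step n P x = P x" by (auto simp: euler_step_def)
  then show ?thesis using assms(2) by simp
qed

text \<open>With S the step map, S (S P) - S P is no larger in sup-norm than S P - P, because S does
  not increase sup-norm distances. Undoing the factor 1 / (2 n) gives the smoothness bound for S
  P.\<close>

lemma smooth_euler_step:
  assumes n: "0 < n" and K: "0 \<le> K" and P: "smooth_profile n C K P"
  shows "smooth_profile n C K (euler_step n P)"
proof -
  have bd: "euler_step n P 0 = 0" "euler_step n P n = 0"
    using P by (auto simp: euler_step_def smooth_profile_def)
  have "\<bar>slope (euler_step n P) e\<bar> \<le> C" if "e < n" for e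
  proof -
    have "slope (euler_step n P) e \<le> C"
      using P by (intro euler_step_slope_le n that) (auto simp: smooth_profile_def abs_le_iff)
    moreover have "slope (euler_step n (\<lambda>x. - P x)) e \<le> C"
      using P by (intro euler_step_slope_le n that) (fastforce simp: smooth_profile_def abs_le_iff slope_def)
    ultimately show ?thesis unfolding euler_step_uminus by (simp add: slope_def abs_le_iff)
  qed
  moreover have "\<bar>sigma (slope (euler_step n P) x) - sigma (slope (euler_step n P) (x - 1))\<bar> \<le> K / real n"
    if x: "0 < x" "x < n" for x
  proof -
    let ?S = "euler_step n P"
    have "\<bar>euler_step n ?S x - ?S x\<bar> \<le> K / (2 * real n ^ 2)"
      by (intro euler_step_contraction n smooth_step_diff[OF n K P]) (use x in auto)
    moreover have "euler_step n ?S x - ?S x = (sigma (slope ?S x) - sigma (slope ?S (x - 1))) / (2 * real n)"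
      using x by (simp add: euler_step_def[of n ?S x])
    ultimately have "\<bar>sigma (slope ?S x) - sigma (slope ?S (x - 1))\<bar> / (2 * real n) \<le> (K / real n) / (2 * real n)"
      using n by (simp add: power2_eq_square)
    then show ?thesis using n unfolding divide_le_cancel by simp
  qed
  ultimately show ?thesis unfolding smooth_profile_def using bd by auto
qed

lemma smooth_euler:
  assumes "0 < n" "0 \<le> K" "smooth_profile n C K P"
  shows "smooth_profile n C K (euler n P k)"
  by (induction k) (simp_all add: assms euler_Suc smooth_euler_step)

lemma euler_time_diff:
  assumes "0 < n" "0 \<le> K" "smooth_profile n C K P" "x \<le> n"
  shows "\<bar>euler n P (k + j) x - euler n P k x\<bar> \<le> real j * (K / (2 * real n ^ 2))"
proof (induction j)
  case (Suc j)
  have "\<bar>euler n P (k + Suc j) x - euler n P (k + j) x\<bar> \<le> K / (2 * real n ^ 2)"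
    using smooth_step_diff[OF assms(1,2) smooth_euler[OF assms(1-3)] assms(4), of "k + j"]
    by (simp add: euler_Suc)
  moreover have "real (Suc j) * (K / (2 * real n ^ 2)) = real j * (K / (2 * real n ^ 2)) + K / (2 * real n ^ 2)"
    by (simp only: of_nat_Suc distrib_right mult_1_left)
  ultimately show ?case using Suc by linarith
qed simp

lemma smooth_sigma_diff:
  assumes P: "smooth_profile n C K P" and "c < n" "e < n"
  shows "\<bar>sigma (slope P e) - sigma (slope P c)\<bar> \<le> \<bar>real e - real c\<bar> * (K / real n)"
proof -
  have *: "\<bar>sigma (slope P (c + j)) - sigma (slope P c)\<bar> \<le> real j * (K / real n)" if "c + j < n" for c j
    using that
  proof (induction j)
    case (Suc j)
    have "\<bar>sigma (slope P (Suc (c + j))) - sigma (slope P (c + j))\<bar> \<le> K / real n"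
      using P Suc.prems unfolding smooth_profile_def by (metis add_Suc_right diff_Suc_1 zero_less_Suc)
    moreover have "real (Suc j) * (K / real n) = real j * (K / real n) + K / real n"
      by (simp only: of_nat_Suc distrib_right mult_1_left)
    ultimately show ?case using Suc.IH Suc.prems by simp
  qed simp
  show ?thesis
  proof (cases "c \<le> e")
    case True
    then show ?thesis using *[of c "e - c"] assms by (simp add: of_nat_diff)
  next
    case False
    then show ?thesis using *[of e "c - e"] assms by (simp add: of_nat_diff abs_minus_commute)
  qed
qed

lemma smooth_slope_diff:
  assumes P: "smooth_profile n C K P" and "c < n" "e < n" "0 \<le> K" "\<bar>real e - real c\<bar> \<le> real B"
  shows "\<bar>slope P e - slope P c\<bar> \<le> (1 + C)^2 * K * real B / real n"
proof -
  have "\<bar>slope P e - slope P c\<bar> \<le> (1 + C)^2 * \<bar>sigma (slope P e) - sigma (slope P c)\<bar>"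
    using P assms(2,3) by (intro sigma_inverse_lip) (auto simp: smooth_profile_def)
  also have "\<dots> \<le> (1 + C)^2 * (\<bar>real e - real c\<bar> * (K / real n))"
    by (intro mult_left_mono smooth_sigma_diff[OF assms(1-3)]) simp
  also have "\<dots> \<le> (1 + C)^2 * (real B * (K / real n))"
    using assms(4,5) by (intro mult_left_mono mult_right_mono) auto
  finally show ?thesis by (simp add: algebra_simps)
qed

text \<open>A slope changes little in time because it is close to its average over a window of
  length B, which is controlled by the motion of the two end heights.\<close>
lemma euler_slope_diff:
  assumes n: "0 < n" and K: "0 \<le> K" and P: "smooth_profile n C K P" and B: "0 < B" "c + B \<le> n"
    and e: "e < n" "\<bar>real e - real c\<bar> \<le> real B" and j: "real j \<le> real n * real B ^ 2"
  shows "\<bar>slope (euler n P (k + j)) e - slope (euler n P k) c\<bar> \<le> (3 * (1 + C)^2 + 1) * K * real B / real n"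
proof -
  let ?w = "(1 + C)^2 * K * real B / real n"
  let ?P = "\<lambda>j. euler n P (k + j)"
  have c: "c < n" using B by simp
  have mean: "\<bar>(?P j (c + B) - ?P j c) - real B * slope (?P j) c\<bar> \<le> real B * ?w" for j
  proof -
    have tel: "?P j (c + B) - ?P j c = (\<Sum>i<B. slope (?P j) (c + i))"
      using sum_lessThan_telescope[of "\<lambda>i. ?P j (c + i)" B] by (simp add: slope_def)
    have "\<bar>(\<Sum>i<B. slope (?P j) (c + i) - slope (?P j) c)\<bar> \<le> (\<Sum>i<B. ?w)"
      using B by (intro order_trans[OF sum_abs sum_mono] smooth_slope_diff[OF smooth_euler[OF n K P]] K) auto
    then show ?thesis unfolding tel by (simp add: sum_subtractf)
  qed
  \<comment> \<open>In at most n B^2 steps a height moves by order B^2 / n. Divided by the window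
    length B this is B / n, the size of the spatial variation of the slope; this balance fixes the
    time scale n B^2.\<close>
  have "\<bar>?P j x - ?P 0 x\<bar> \<le> K * real B ^ 2 / (2 * real n)" if "x \<le> n" for x
  proof -
    have "\<bar>?P j x - ?P 0 x\<bar> \<le> real j * (K / (2 * real n ^ 2))"
      using euler_time_diff[OF n K P that, of k j] by simp
    also have "\<dots> \<le> (real n * real B ^ 2) * (K / (2 * real n ^ 2))" using K by (intro mult_right_mono j) auto
    also have "\<dots> = K * real B ^ 2 / (2 * real n)" using n by (simp add: field_simps power2_eq_square)
    finally show ?thesis .
  qed
  from this[of "c + B"] this[of c]
  have "\<bar>real B * slope (?P j) c - real B * slope (?P 0) c\<bar> \<le> 2 * (real B * ?w) + 2 * (K * real B ^ 2 / (2 * real n))"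
    using mean[of j] mean[of 0] B(2) by linarith
  also have "\<dots> = real B * (2 * ?w + K * real B / real n)" by (simp add: power2_eq_square algebra_simps)
  finally have "real B * \<bar>slope (?P j) c - slope (?P 0) c\<bar> \<le> real B * (2 * ?w + K * real B / real n)"
    by (simp add: abs_mult right_diff_distrib[symmetric])
  then have "\<bar>slope (?P j) c - slope (?P 0) c\<bar> \<le> 2 * ?w + K * real B / real n"
    using B(1) by simp
  moreover have "\<bar>slope (?P j) e - slope (?P j) c\<bar> \<le> ?w"
    by (rule smooth_slope_diff[OF smooth_euler[OF n K P] c e(1) K e(2)])
  moreover have "(3 * (1 + C)^2 + 1) * K * real B / real n = 3 * ?w + K * real B / real n"
    by (simp add: algebra_simps add_divide_distrib)
  ultimately show ?thesis by simp
qed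

section \<open>Evolution of the squared distance\<close>


definition dist2 :: "nat \<Rightarrow> (nat \<Rightarrow> real) \<Rightarrow> (nat \<Rightarrow> int) \<Rightarrow> real" where
  "dist2 n P h = (\<Sum>x\<le>n. (real_of_int (h x) - P x)^2)"

definition slope_energy :: "nat \<Rightarrow> (nat \<Rightarrow> real) \<Rightarrow> (nat \<Rightarrow> int) \<Rightarrow> real" where
  "slope_energy n P h = (\<Sum>e<n. efun (incr h e) (slope P e))"

lemma sum_by_parts_0:
  fixes a w :: "nat \<Rightarrow> real"
  assumes "w 0 = 0" "w n = 0" "0 < n"
  shows "(\<Sum>x\<le>n. (if 0 < x \<and> x < n then a x - a (x - 1) else 0) * w x) = - (\<Sum>e<n. a e * (w (Suc e) - w e))"
proof -
  have "(\<Sum>x\<le>n. (if 0 < x \<and> x < n then a x - a (x - 1) else 0) * w x) = (\<Sum>x<n. (if 0 < x then a x - a (x - 1) else 0) * w x)"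
    by (simp add: lessThan_Suc_atMost[symmetric])
  also have "\<dots> = (\<Sum>e<n. a e * w e) - (\<Sum>x<n. if 0 < x then a (x - 1) * w x else 0)"
    unfolding sum_subtractf[symmetric] by (intro sum.cong) (auto simp: assms left_diff_distrib)
  also have "(\<Sum>x<n. if 0 < x then a (x - 1) * w x else 0) = (\<Sum>e<n. a e * w (Suc e))"
  proof -
    obtain m where n: "n = Suc m" using assms(3) by (cases n) auto
    have "(\<Sum>x<n. if 0 < x then a (x - 1) * w x else 0) = (\<Sum>e<m. a e * w (Suc e))"
      unfolding n sum.lessThan_Suc_shift by simp
    moreover have "(\<Sum>e<n. a e * w (Suc e)) = (\<Sum>e<m. a e * w (Suc e))"
      using assms(2) unfolding n by simp
    ultimately show ?thesis by simp
  qed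
  finally show ?thesis by (simp add: right_diff_distrib sum_subtractf)
qed

lemma avg_move2_fst: "avg n (move2 n) (\<lambda>p. F (fst p)) (h, g) = avg n (move n) F h"
  using run_fst[of n 1 F "(h, g)"] by (simp add: run_Suc)

text \<open>Per edge, the jumps of h contribute s^2 and its drift contributes -s times the increment
  of h - P; the motion of P contributes \<open>sigma\<close> of the slope times the same increment,
  after summation by parts. Together these form \<open>efun\<close>. The remaining error arises
  because h is measured against the profile after the step.\<close>

lemma dist2_step:
  assumes n: "0 < n" and K: "0 \<le> K" and P: "smooth_profile n C K P" and h: "h 0 = 0" "h n = 0"
  shows "avg n (move n) (dist2 n (euler_step n P)) h \<le> dist2 n P h + slope_energy n P h / real n + (K + K^2) / real n ^ 2"
proof -
  let ?S = "euler_step n P"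
  define v where "v x = real_of_int (h x) - ?S x" for x
  define w where "w x = real_of_int (h x) - P x" for x
  define p where "p x = ?S x - P x" for x
  define s where "s e = real_of_int (sgn (h (Suc e) - h e))" for e
  define a where "a e = sigma (slope P e)" for e
  have pb: "\<bar>p x\<bar> \<le> K / (2 * real n ^ 2)" if "x \<le> n" for x
    unfolding p_def by (rule smooth_step_diff[OF n K P that])
  have w0: "w 0 = 0" "w n = 0" using P h by (auto simp: w_def smooth_profile_def)
  have v0: "v 0 = 0" "v n = 0" using P h by (auto simp: v_def smooth_profile_def euler_step_def)
  have s_inc: "s e = sgn (incr h e)" for e by (auto simp: s_def incr_def sgn_if)
  have s1: "\<bar>s e\<bar> \<le> 1" for e by (simp add: s_def sgn_if)
  let ?F = "dist2 n ?S" and ?Q = "\<lambda>x (p::int) (q::int). (real_of_int p - ?S x)^2"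
  have "2 * real n * (avg n (move n) ?F h - ?F h) = 2 * real n * (avg n (move2 n) (\<lambda>p. \<Sum>x\<le>n. ?Q x (fst p x) (snd p x)) (h, h) - (\<Sum>x\<le>n. ?Q x (h x) (h x)))"
    unfolding avg_move2_fst[of n ?F h h, symmetric] by (simp add: dist2_def)
  also have "\<dots> = (\<Sum>e<n. (if 0 < e then ?Q e (h e + sgn (h (Suc e) - h e)) (h e + sgn (h (Suc e) - h e)) - ?Q e (h e) (h e) else 0)
     + (if Suc e < n then ?Q (Suc e) (h (Suc e) - sgn (h (Suc e) - h e)) (h (Suc e) - sgn (h (Suc e) - h e)) - ?Q (Suc e) (h (Suc e)) (h (Suc e)) else 0))"
    by (rule avg_site_sum)
  \<comment> \<open>Only an inequality: the null moves of the fixed ends contribute 0, which is at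
    most s^2 because v vanishes there.\<close>
  also have "\<dots> \<le> (\<Sum>e<n. 2 * ((s e)^2 - s e * (v (Suc e) - v e)))"
  proof (rule sum_mono)
    fix e assume e: "e \<in> {..<n}"
    have eqs: "real_of_int (h e + sgn (h (Suc e) - h e)) - ?S e = v e + s e"
      "real_of_int (h (Suc e) - sgn (h (Suc e) - h e)) - ?S (Suc e) = v (Suc e) - s e"
      by (simp_all add: v_def s_def)
    have sq: "(x + y)^2 - x^2 = y^2 + 2 * y * x" "(x - y)^2 - x^2 = y^2 - 2 * y * x" for x y :: real
      by (simp_all add: power2_eq_square algebra_simps)
    have 1: "(if 0 < e then ?Q e (h e + sgn (h (Suc e) - h e)) (h e + sgn (h (Suc e) - h e)) - ?Q e (h e) (h e) else 0) \<le> (s e)^2 + 2 * s e * v e"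
      unfolding eqs unfolding v_def[symmetric] sq using v0 by simp
    have 2: "(if Suc e < n then ?Q (Suc e) (h (Suc e) - sgn (h (Suc e) - h e)) (h (Suc e) - sgn (h (Suc e) - h e)) - ?Q (Suc e) (h (Suc e)) (h (Suc e)) else 0) \<le> (s e)^2 - 2 * s e * v (Suc e)"
    proof (cases "Suc e < n")
      case True
      then show ?thesis unfolding eqs unfolding v_def[symmetric] sq by simp
    next
      case False
      then have "Suc e = n" using e by simp
      then show ?thesis using v0 by simp
    qed
    have "2 * ((s e)^2 - s e * (v (Suc e) - v e)) = ((s e)^2 + 2 * s e * v e) + ((s e)^2 - 2 * s e * v (Suc e))"
      by (simp add: algebra_simps)
    then show "(if 0 < e then ?Q e (h e + sgn (h (Suc e) - h e)) (h e + sgn (h (Suc e) - h e)) - ?Q e (h e) (h e) else 0)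
      + (if Suc e < n then ?Q (Suc e) (h (Suc e) - sgn (h (Suc e) - h e)) (h (Suc e) - sgn (h (Suc e) - h e)) - ?Q (Suc e) (h (Suc e)) (h (Suc e)) else 0)
      \<le> 2 * ((s e)^2 - s e * (v (Suc e) - v e))" using add_mono[OF 1 2] by simp
  qed
  also have "\<dots> = 2 * (\<Sum>e<n. (s e)^2 - s e * (v (Suc e) - v e))" by (simp add: sum_distrib_left)
  finally have A: "avg n (move n) ?F h - ?F h \<le> (\<Sum>e<n. (s e)^2 - s e * (v (Suc e) - v e)) / real n"
    using n by (simp add: field_simps)
  have "?F h = (\<Sum>x\<le>n. (w x)^2 + (p x)^2 - 2 * (p x * w x))"
    unfolding dist2_def by (intro sum.cong) (auto simp: w_def p_def power2_eq_square algebra_simps)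
  also have "\<dots> = dist2 n P h + (\<Sum>x\<le>n. (p x)^2) - 2 * (\<Sum>x\<le>n. p x * w x)"
    by (simp add: sum.distrib sum_subtractf sum_distrib_left dist2_def w_def)
  also have "(\<Sum>x\<le>n. p x * w x) = (1 / (2 * real n)) * (\<Sum>x\<le>n. (if 0 < x \<and> x < n then a x - a (x - 1) else 0) * w x)"
    unfolding sum_distrib_left by (intro sum.cong) (auto simp: p_def euler_step_def a_def)
  also have "\<dots> = - (\<Sum>e<n. a e * (w (Suc e) - w e)) / (2 * real n)"
    unfolding sum_by_parts_0[OF w0 n] by simp
  finally have B: "?F h = dist2 n P h + (\<Sum>x\<le>n. (p x)^2) + (\<Sum>e<n. a e * (w (Suc e) - w e)) / real n"
    by simp
  have "(\<Sum>x\<le>n. (p x)^2) \<le> (\<Sum>x\<le>n. (K / (2 * real n ^ 2))^2)"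
    using pb by (intro sum_mono) (metis abs_ge_zero atMost_iff power2_abs power_mono)
  also have "\<dots> = (real n + 1) * K^2 / (4 * real n ^ 4)" by (simp add: power_divide power_mult_distrib)
  also have "\<dots> \<le> (4 * real n ^ 2) * K^2 / (4 * real n ^ 4)"
  proof (intro divide_right_mono mult_right_mono)
    have "1 \<le> real n" using n by simp
    then have "real n \<le> real n ^ 2" "1 \<le> real n ^ 2" by (auto intro: self_le_power)
    then show "real n + 1 \<le> 4 * real n ^ 2" by linarith
  qed auto
  also have "\<dots> = K^2 / real n ^ 2" using n by (simp add: field_simps power2_eq_square power4_eq_xxxx)
  finally have p2: "(\<Sum>x\<le>n. (p x)^2) \<le> K^2 / real n ^ 2" .
  have "(\<Sum>e<n. (s e)^2 - s e * (v (Suc e) - v e)) + (\<Sum>e<n. a e * (w (Suc e) - w e)) \<le> (\<Sum>e<n. efun (incr h e) (slope P e) + K / real n ^ 2)"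
    unfolding sum.distrib[symmetric]
  proof (rule sum_mono)
    fix e assume e: "e \<in> {..<n}"
    have v: "v (Suc e) - v e = (w (Suc e) - w e) - (p (Suc e) - p e)" by (simp add: v_def w_def p_def)
    have w: "w (Suc e) - w e = incr h e - slope P e" by (simp add: w_def incr_def slope_def)
    have "\<bar>p (Suc e) - p e\<bar> \<le> 2 * (K / (2 * real n ^ 2))" using pb[of e] pb[of "Suc e"] e by simp
    then have "\<bar>s e * (p (Suc e) - p e)\<bar> \<le> 1 * (K / real n ^ 2)"
      unfolding abs_mult using s1 by (intro mult_mono) auto
    then have "s e * (p (Suc e) - p e) \<le> K / real n ^ 2" by linarith
    moreover have "efun (incr h e) (slope P e) = (s e)^2 - (w (Suc e) - w e) * (s e - a e)"
      by (simp only: efun_def s_inc w a_def)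
    ultimately show "(s e)^2 - s e * (v (Suc e) - v e) + a e * (w (Suc e) - w e) \<le> efun (incr h e) (slope P e) + K / real n ^ 2"
      unfolding v by (simp add: algebra_simps)
  qed
  also have "\<dots> = slope_energy n P h + K / real n" using n by (simp add: sum.distrib slope_energy_def power2_eq_square)
  finally have "((\<Sum>e<n. (s e)^2 - s e * (v (Suc e) - v e)) + (\<Sum>e<n. a e * (w (Suc e) - w e))) / real n \<le> (slope_energy n P h + K / real n) / real n"
    by (rule divide_right_mono) simp
  then have "(\<Sum>e<n. (s e)^2 - s e * (v (Suc e) - v e)) / real n + (\<Sum>e<n. a e * (w (Suc e) - w e)) / real n \<le> slope_energy n P h / real n + K / real n ^ 2"
    by (simp add: add_divide_distrib power2_eq_square)
  then show ?thesis using A B p2 by (simp add: add_divide_distrib)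
qed

text \<open>A triangle of height 1 and half-width B centred at c B. In terms of absolute values its
  second differences in x are point masses at three kinks, and it is itself a second difference in
  c.\<close>

definition tent :: "nat \<Rightarrow> nat \<Rightarrow> nat \<Rightarrow> real" where
  "tent B c x = (\<bar>real x - real c * real B - real B\<bar> + \<bar>real x - real c * real B + real B\<bar> - 2 * \<bar>real x - real c * real B\<bar>) / (2 * real B)"

lemma tent_support: "tent B c x \<noteq> 0 \<Longrightarrow> \<bar>real x - real c * real B\<bar> < real B"
proof (rule ccontr)
  assume nz: "tent B c x \<noteq> 0" and "\<not> \<bar>real x - real c * real B\<bar> < real B"
  moreover have "\<bar>y - b\<bar> + \<bar>y + b\<bar> - 2 * \<bar>y\<bar> = 0" if "\<not> \<bar>y\<bar> < b" "0 \<le> b" for y b :: real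
    using that by linarith
  ultimately have "tent B c x = 0" unfolding tent_def by simp
  then show False using nz by simp
qed

lemma tent_range:
  assumes "0 < B"
  shows "0 \<le> tent B c x" "tent B c x \<le> 1"
proof -
  have "0 \<le> \<bar>y - b\<bar> + \<bar>y + b\<bar> - 2 * \<bar>y\<bar>" "\<bar>y - b\<bar> + \<bar>y + b\<bar> - 2 * \<bar>y\<bar> \<le> 2 * b" if "0 < b" for y b :: real
    using that by (auto simp: abs_if)
  then show "0 \<le> tent B c x" "tent B c x \<le> 1"
    using assms unfolding tent_def by (auto simp: divide_le_eq)
qed

lemma second_diff_abs:
  "\<bar>real e - real p\<bar> - 2 * \<bar>real (Suc e) - real p\<bar> + \<bar>real (Suc (Suc e)) - real p\<bar> = (if Suc e = p then 2 else 0)"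
proof -
  consider "e + 2 \<le> p" | "Suc e = p" | "p \<le> e" by linarith
  then show ?thesis
  proof cases
    case 1
    then have "real e + 2 \<le> real p" using of_nat_mono[of "e + 2" p] by simp
    then show ?thesis using 1 by simp
  next
    case 3
    then have "real p \<le> real e" by simp
    then show ?thesis using 3 by simp
  qed auto
qed

lemma tent_cutoff:
  assumes B: "0 < B" and c: "0 < c" "(c + 1) * B \<le> n"
  shows "cutoff n (1 / real B) (tent B c)"
  unfolding cutoff_def
proof (intro conjI allI impI)
  have cB: "real B \<le> real c * real B" using c(1) B by simp
  have nB: "real c * real B + real B \<le> real n"
  proof -
    have "real ((c + 1) * B) \<le> real n" using c(2) by (rule of_nat_mono)
    then show ?thesis by (simp add: algebra_simps)
  qed
  show "0 \<le> tent B c x" "tent B c x \<le> 1" for x by (rule tent_range[OF B])+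
  show "tent B c 0 = 0" using tent_support[of B c 0] cB by force
  show "tent B c x = 0" if "n \<le> x" for x
  proof -
    have "real n \<le> real x" using that by simp
    then show ?thesis using tent_support[of B c x] nB by force
  qed
  show "\<bar>tent B c e - tent B c (Suc e)\<bar> \<le> 1 / real B" for e
  proof -
    let ?f = "\<lambda>y b. \<bar>y - b\<bar> + \<bar>y + b\<bar> - 2 * \<bar>y\<bar> :: real"
    have *: "\<bar>?f y b - ?f (y + 1) b\<bar> \<le> 2" if "0 < b" for y b
    proof -
      have "?f y b - ?f (y + 1) b \<le> 2" using that by (auto simp: abs_if)
      moreover have "?f (y + 1) b - ?f y b \<le> 2" using that by (auto simp: abs_if)
      ultimately show ?thesis by linarith
    qed
    have "tent B c e - tent B c (Suc e) = (?f (real e - real c * real B) (real B) - ?f (real e - real c * real B + 1) (real B)) / (2 * real B)"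
      by (simp add: tent_def diff_divide_distrib[symmetric] algebra_simps)
    also have "\<bar>\<dots>\<bar> \<le> 2 / (2 * real B)"
      unfolding abs_divide using *[of "real B" "real e - real c * real B"] B by (intro divide_mono) auto
    finally show ?thesis by simp
  qed
  show "(\<Sum>e<n. \<bar>tent B c e - 2 * tent B c (Suc e) + tent B c (Suc (Suc e))\<bar>) \<le> 4 * (1 / real B)"
  proof -
    let ?I = "\<lambda>p e. if Suc e = p then 2 else 0 :: real"
    have I: "(\<Sum>e<n. ?I p e) \<le> 2" for p
    proof (cases p)
      case (Suc q)
      then have "(\<Sum>e<n. ?I p e) = (\<Sum>e<n. if e = q then 2 else 0)" by simp
      then show ?thesis by simp
    qed simp
    have abs3: "\<bar>(a1 + a2 - 2 * a3) / b\<bar> \<le> (a1 + a2 + 2 * a3) / b" if "0 \<le> a1" "0 \<le> a2" "0 \<le> a3" "0 \<le> b" for a1 a2 a3 b :: real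
      unfolding abs_divide using that by (simp add: divide_right_mono)
    have "tent B c e - 2 * tent B c (Suc e) + tent B c (Suc (Suc e)) =
      (?I ((c + 1) * B) e + ?I ((c - 1) * B) e - 2 * ?I (c * B) e) / (2 * real B)" for e
    proof -
      have pos: "real ((c + 1) * B) = real c * real B + real B" "real ((c - 1) * B) = real c * real B - real B" "real (c * B) = real c * real B"
        using c(1) by (auto simp: algebra_simps of_nat_diff)
      have A: "tent B c x = (\<bar>real x - real ((c + 1) * B)\<bar> + \<bar>real x - real ((c - 1) * B)\<bar> - 2 * \<bar>real x - real (c * B)\<bar>) / (2 * real B)" for x
        unfolding tent_def pos by (simp add: algebra_simps)
      show ?thesis unfolding second_diff_abs[symmetric] A
        by (simp add: add_divide_distrib diff_divide_distrib)
    qed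
    then have "\<bar>tent B c e - 2 * tent B c (Suc e) + tent B c (Suc (Suc e))\<bar> \<le>
      (?I ((c + 1) * B) e + ?I ((c - 1) * B) e + 2 * ?I (c * B) e) / (2 * real B)" for e
      using abs3[of "?I ((c + 1) * B) e" "?I ((c - 1) * B) e" "?I (c * B) e" "2 * real B"] by simp
    then have "(\<Sum>e<n. \<bar>tent B c e - 2 * tent B c (Suc e) + tent B c (Suc (Suc e))\<bar>) \<le>
      (\<Sum>e<n. (?I ((c + 1) * B) e + ?I ((c - 1) * B) e + 2 * ?I (c * B) e) / (2 * real B))"
      by (rule sum_mono)
    also have "\<dots> = ((\<Sum>e<n. ?I ((c + 1) * B) e) + (\<Sum>e<n. ?I ((c - 1) * B) e) + 2 * (\<Sum>e<n. ?I (c * B) e)) / (2 * real B)"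
      by (simp only: sum_divide_distrib[symmetric] sum.distrib sum_distrib_left)
    also have "\<dots> \<le> 8 / (2 * real B)"
      using I[of "(c + 1) * B"] I[of "(c - 1) * B"] I[of "c * B"] by (intro divide_right_mono) auto
    finally show ?thesis by simp
  qed
qed

text \<open>The tent is a second difference in c, so the sum telescopes to two outer first
  differences; these are B and -B when x lies between B and m B.\<close>

lemma tent_sum:
  assumes B: "0 < B"
  shows "(\<Sum>c<m. tent B (Suc c) x) \<le> 1"
    and "B \<le> x \<Longrightarrow> x \<le> m * B \<Longrightarrow> (\<Sum>c<m. tent B (Suc c) x) = 1"
proof -
  define A where "A c = \<bar>real x - real c * real B\<bar>" for c
  have "tent B (Suc c) x = ((A (Suc (Suc c)) - A (Suc c)) - (A (Suc c) - A c)) / (2 * real B)" for c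
    unfolding tent_def A_def by (simp add: algebra_simps)
  then have "(\<Sum>c<m. tent B (Suc c) x) = (\<Sum>c<m. (A (Suc (Suc c)) - A (Suc c)) - (A (Suc c) - A c)) / (2 * real B)"
    by (simp add: sum_divide_distrib)
  also have "\<dots> = ((A (Suc m) - A m) - (A 1 - A 0)) / (2 * real B)"
    using sum_lessThan_telescope[of "\<lambda>c. A (Suc c) - A c" m] by simp
  finally have eq: "(\<Sum>c<m. tent B (Suc c) x) = ((A (Suc m) - A m) - (A 1 - A 0)) / (2 * real B)" .
  have Am: "A (Suc m) = \<bar>real x - real m * real B - real B\<bar>" by (simp add: A_def algebra_simps)
  have "A (Suc m) - A m \<le> real B" unfolding Am unfolding A_def by linarith
  moreover have "A 0 - A 1 \<le> real B" unfolding A_def by simp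
  ultimately show "(\<Sum>c<m. tent B (Suc c) x) \<le> 1" unfolding eq using B by (simp add: divide_le_eq)
  assume x: "B \<le> x" "x \<le> m * B"
  have "real x \<le> real m * real B" using of_nat_mono[OF x(2), where ?'a = real] by simp
  then have "A (Suc m) - A m = real B" "A 1 - A 0 = - real B" unfolding Am using x(1) by (auto simp: A_def)
  then show "(\<Sum>c<m. tent B (Suc c) x) = 1" unfolding eq using B by simp
qed

text \<open>Large increments only lower \<open>efun\<close>, since sgn - \<open>sigma\<close> then
  has the sign of the increment. What remains besides the square of the sign is at most |q| (1 -
  |\<open>sigma\<close> q|) = |q| / (1 + |q|).\<close>

lemma efun_le_2: "efun (real_of_int \<eta>) q \<le> 2"
proof -
  have s: "\<bar>sigma q\<bar> \<le> 1" "q * sigma q \<ge> 0" by (rule sigma_bound) (simp add: sigma_def)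
  have a1: "\<bar>q\<bar> - \<bar>q\<bar> * \<bar>sigma q\<bar> \<le> 1" by (simp add: sigma_def field_simps)
  have q: "q * sigma q = \<bar>q\<bar> * \<bar>sigma q\<bar>" using s(2) by (metis abs_mult abs_of_nonneg)
  consider "\<eta> = 0" | "\<eta> \<ge> 1" | "\<eta> \<le> -1" by linarith
  then show ?thesis
  proof cases
    case 1
    then show ?thesis using s(2) by (simp add: efun_def)
  next
    case 2
    then have "0 \<le> real_of_int \<eta> * (1 - sigma q)" using s(1) by simp
    then have "efun (real_of_int \<eta>) q \<le> 1 + q - q * sigma q" using 2 by (simp add: efun_def algebra_simps)
    then show ?thesis using a1 q by linarith
  next
    case 3
    then have "real_of_int \<eta> * (1 + sigma q) \<le> 0" using s(1) by (intro mult_nonpos_nonneg) auto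
    then have "efun (real_of_int \<eta>) q \<le> 1 - q - q * sigma q" using 3 by (simp add: efun_def algebra_simps)
    then show ?thesis using a1 q by linarith
  qed
qed

text \<open>The linear growth in |\<eta>| is harmless, since the increments of a tame configuration
  add up to order n.\<close>

lemma efun_lipschitz: "efun \<eta> q \<le> efun \<eta> u + \<bar>q - u\<bar> * (\<bar>\<eta>\<bar> + 2 + \<bar>u\<bar>)"
proof -
  have d: "\<bar>sigma q - sigma u\<bar> \<le> \<bar>q - u\<bar>" by (rule sigma_lip)
  have "efun \<eta> q - efun \<eta> u = (q - u) * sgn \<eta> + (sigma q - sigma u) * \<eta> - (q - u) * sigma q - (sigma q - sigma u) * u"
    by (simp add: efun_def algebra_simps)
  also have "\<dots> \<le> \<bar>q - u\<bar> * 1 + \<bar>q - u\<bar> * \<bar>\<eta>\<bar> + \<bar>q - u\<bar> * 1 + \<bar>q - u\<bar> * \<bar>u\<bar>"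
  proof -
    have "\<bar>(q - u) * sgn \<eta>\<bar> \<le> \<bar>q - u\<bar> * 1" unfolding abs_mult by (intro mult_left_mono) (auto simp: sgn_if)
    moreover have "\<bar>(sigma q - sigma u) * \<eta>\<bar> \<le> \<bar>q - u\<bar> * \<bar>\<eta>\<bar>" unfolding abs_mult by (intro mult_right_mono d) auto
    moreover have "\<bar>(q - u) * sigma q\<bar> \<le> \<bar>q - u\<bar> * 1" unfolding abs_mult by (intro mult_left_mono sigma_bound) auto
    moreover have "\<bar>(sigma q - sigma u) * u\<bar> \<le> \<bar>q - u\<bar> * \<bar>u\<bar>" unfolding abs_mult by (intro mult_right_mono d) auto
    ultimately show ?thesis by linarith
  qed
  finally show ?thesis by (simp add: algebra_simps)
qed

lemma sum_incr_le_tame: "tame n C h \<Longrightarrow> (\<Sum>e<n. \<bar>incr h e\<bar>) \<le> C * real n"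
  by (simp add: tame_def tv_def incr_def)

lemma slope_energy_blocks:
  fixes j k :: nat
  assumes n: "0 < n" and h: "tame n C h" and K: "0 \<le> K" and P: "smooth_profile n C K P"
    and B: "0 < B" "2 * B \<le> n" and j: "real j \<le> real n * real B ^ 2"
  defines "m \<equiv> n div B - 1"
  defines "u \<equiv> \<lambda>c. real_of_int \<lfloor>real n * slope (euler n P k) (Suc c * B)\<rfloor> / real n"
  shows "slope_energy n (euler n P (k + j)) h
    \<le> (\<Sum>c<m. block_energy n (tent B (Suc c)) (u c) h) / 2 + (((3 * (1 + C)^2 + 1) * K + 1) * (2 * C + 3) + 6) * real B"
proof -
  have C: "0 \<le> C" by (rule tame_nonneg[OF h n])
  let ?q = "\<lambda>e. slope (euler n P (k + j)) e"
  let ?T = "\<lambda>c e. tent B (Suc c) e + tent B (Suc c) (Suc e)"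
  \<comment> \<open>The error of a frozen slope: the variation of the Euler slope across the block,
    plus B / n to cover the rounding.\<close>
  define \<omega> where "\<omega> = ((3 * (1 + C)^2 + 1) * K + 1) * real B / real n"
  have om: "0 \<le> \<omega>" using K by (simp add: \<omega>_def)
  have T0: "0 \<le> ?T c e" for c e using tent_range(1)[OF B(1)] by simp
  have n2: "2 \<le> n div B" using B by (simp add: less_eq_div_iff_mult_less_eq)
  have mB: "(m + 1) * B \<le> n" unfolding m_def using n2 by simp
  have mB2: "n < (m + 2) * B"
  proof -
    have "m + 2 = Suc (n div B)" unfolding m_def using n2 by simp
    then show ?thesis using dividend_less_times_div[OF B(1), of n] by (simp add: mult.commute)
  qed
  have cb: "Suc c * B + B \<le> n" if "c < m" for c
  proof -
    have "Suc c * B + B = (Suc c + 1) * B" by simp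
    also have "\<dots> \<le> (m + 1) * B" using that by (intro mult_le_mono1) simp
    finally show ?thesis using mB by simp
  qed
  have local: "?T c e * efun (incr h e) (?q e) \<le> ?T c e * efun (incr h e) (u c) + ?T c e * (\<omega> * (\<bar>incr h e\<bar> + 3 + C))"
    if c: "c < m" and e: "e < n" for c e
  proof (cases "?T c e = 0")
    case False
    let ?v = "slope (euler n P k) (Suc c * B)"
    have "tent B (Suc c) e \<noteq> 0 \<or> tent B (Suc c) (Suc e) \<noteq> 0" using False by auto
    then have "\<bar>real e - real (Suc c) * real B\<bar> < real B \<or> \<bar>real (Suc e) - real (Suc c) * real B\<bar> < real B"
      using tent_support by blast
    moreover have conv: "x < y + z" if "real x < real y + real z" for x y z :: nat
      using that by (metis of_nat_add of_nat_less_iff)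
    moreover have "real (Suc c) * real B = real (Suc c * B)" by (simp only: of_nat_mult)
    ultimately have "e < Suc c * B + B \<and> Suc c * B < e + B \<or> Suc e < Suc c * B + B \<and> Suc c * B < Suc e + B"
      using conv[of e "Suc c * B" B] conv[of "Suc c * B" e B] conv[of "Suc e" "Suc c * B" B] conv[of "Suc c * B" "Suc e" B]
      by (simp only: abs_less_iff) linarith
    then have "e \<le> Suc c * B + B" "Suc c * B \<le> e + B" by linarith+
    then have "real e \<le> real (Suc c * B) + real B" "real (Suc c * B) \<le> real e + real B"
      by (metis of_nat_add of_nat_mono)+
    then have near: "\<bar>real e - real (Suc c * B)\<bar> \<le> real B" by linarith
    have 1: "\<bar>?q e - ?v\<bar> \<le> (3 * (1 + C)^2 + 1) * K * real B / real n"
      by (rule euler_slope_diff[OF n K P B(1) cb[OF c] e near j])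
    have uv: "\<bar>?v - u c\<bar> \<le> 1 / real n"
    proof -
      have "\<bar>real n * ?v - real_of_int \<lfloor>real n * ?v\<rfloor>\<bar> \<le> 1" by linarith
      then have "\<bar>real n * ?v - real_of_int \<lfloor>real n * ?v\<rfloor>\<bar> / real n \<le> 1 / real n" by (rule divide_right_mono) simp
      moreover have "?v - u c = (real n * ?v - real_of_int \<lfloor>real n * ?v\<rfloor>) / real n"
        using n by (simp add: u_def diff_divide_distrib)
      ultimately show ?thesis by (simp add: abs_divide)
    qed
    have "1 / real n \<le> real B / real n" using B(1) by (intro divide_right_mono) auto
    then have qu: "\<bar>?q e - u c\<bar> \<le> \<omega>"
      using 1 uv unfolding \<omega>_def distrib_right add_divide_distrib by linarith
    have "\<bar>?v\<bar> \<le> C" using smooth_euler[OF n K P, of k] cb[OF c] B(1) unfolding smooth_profile_def by auto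
    moreover have "1 / real n \<le> 1" using n by simp
    ultimately have "\<bar>u c\<bar> \<le> C + 1" using uv by linarith
    then have "\<bar>?q e - u c\<bar> * (\<bar>incr h e\<bar> + 2 + \<bar>u c\<bar>) \<le> \<omega> * (\<bar>incr h e\<bar> + 3 + C)"
      using qu om by (intro mult_mono) auto
    then have "efun (incr h e) (?q e) \<le> efun (incr h e) (u c) + \<omega> * (\<bar>incr h e\<bar> + 3 + C)"
      using efun_lipschitz[of "incr h e" "?q e" "u c"] by linarith
    then show ?thesis using T0[of c e] by (metis mult_left_mono distrib_left)
  qed simp
  have edge: "2 * efun (incr h e) (?q e) \<le> (\<Sum>c<m. ?T c e * efun (incr h e) (u c)) + 2 * (\<omega> * (\<bar>incr h e\<bar> + 3 + C))
      + (if e < B \<or> m * B \<le> e then 4 else 0)" if e: "e < n" for e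
  proof -
    let ?E = "efun (incr h e) (?q e)" and ?V = "\<Sum>c<m. ?T c e"
    have V: "?V = (\<Sum>c<m. tent B (Suc c) e) + (\<Sum>c<m. tent B (Suc c) (Suc e))" by (rule sum.distrib)
    have V2: "?V \<le> 2" unfolding V using tent_sum(1)[OF B(1), of e m] tent_sum(1)[OF B(1), of "Suc e" m] by linarith
    have V0: "0 \<le> ?V" by (intro sum_nonneg T0)
    have "?V * ?E = (\<Sum>c<m. ?T c e * ?E)" by (rule sum_distrib_right)
    also have "\<dots> \<le> (\<Sum>c<m. ?T c e * efun (incr h e) (u c) + ?T c e * (\<omega> * (\<bar>incr h e\<bar> + 3 + C)))"
      using e by (intro sum_mono local) auto
    also have "\<dots> = (\<Sum>c<m. ?T c e * efun (incr h e) (u c)) + ?V * (\<omega> * (\<bar>incr h e\<bar> + 3 + C))"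
      by (simp only: sum.distrib[of "\<lambda>c. ?T c e * efun (incr h e) (u c)"] sum_distrib_right)
    also have "\<dots> \<le> (\<Sum>c<m. ?T c e * efun (incr h e) (u c)) + 2 * (\<omega> * (\<bar>incr h e\<bar> + 3 + C))"
      using V2 om C by (intro add_left_mono mult_right_mono) auto
    finally have 1: "?V * ?E \<le> (\<Sum>c<m. ?T c e * efun (incr h e) (u c)) + 2 * (\<omega> * (\<bar>incr h e\<bar> + 3 + C))" .
    have 2: "(2 - ?V) * ?E \<le> (if e < B \<or> m * B \<le> e then 4 else 0)"
    proof (cases "e < B \<or> m * B \<le> e")
      case True
      have "(2 - ?V) * ?E \<le> (2 - ?V) * 2"
        using V2 efun_le_2[of "h (Suc e) - h e"] by (intro mult_left_mono) (auto simp: incr_def)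
      then show ?thesis using True V0 by simp
    next
      case False
      then have "?V = 2" unfolding V using tent_sum(2)[OF B(1), of e m] tent_sum(2)[OF B(1), of "Suc e" m] by auto
      then show ?thesis using False by simp
    qed
    have "2 * ?E = ?V * ?E + (2 - ?V) * ?E" by (simp add: left_diff_distrib)
    then show ?thesis using 1 2 by linarith
  qed
  \<comment> \<open>At most 3 B edges are not fully covered by tents, because n < (m + 2) B; each
    costs at most 4 in twice the energy.\<close>
  have bdry: "(\<Sum>e<n. if e < B \<or> m * B \<le> e then 4 else 0) \<le> 12 * real B"
  proof -
    let ?A = "{e \<in> {..<n}. e < B \<or> m * B \<le> e}"
    have "(\<Sum>e<n. if e < B \<or> m * B \<le> e then 4 else 0 :: real) = 4 * real (card ?A)"
      by (simp add: sum.inter_filter[symmetric])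
    also have "card ?A \<le> card ({..<B} \<union> {m * B..<n})" by (intro card_mono) auto
    also have "\<dots> \<le> B + (n - m * B)" by (rule order_trans[OF card_Un_le]) simp
    also have "\<dots> \<le> 3 * B" using mB2 by simp
    finally show ?thesis by simp
  qed
  have "2 * slope_energy n (euler n P (k + j)) h = (\<Sum>e<n. 2 * efun (incr h e) (?q e))"
    by (simp add: slope_energy_def sum_distrib_left)
  also have "\<dots> \<le> (\<Sum>e<n. (\<Sum>c<m. ?T c e * efun (incr h e) (u c)) + 2 * (\<omega> * (\<bar>incr h e\<bar> + 3 + C)) + (if e < B \<or> m * B \<le> e then 4 else 0))"
    by (intro sum_mono edge) simp
  also have "\<dots> = (\<Sum>e<n. \<Sum>c<m. ?T c e * efun (incr h e) (u c)) + 2 * (\<omega> * ((\<Sum>e<n. \<bar>incr h e\<bar>) + (3 + C) * real n)) + (\<Sum>e<n. if e < B \<or> m * B \<le> e then 4 else 0)"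
  proof -
    have "(\<Sum>e<n. 2 * (\<omega> * (\<bar>incr h e\<bar> + 3 + C))) = 2 * (\<omega> * ((\<Sum>e<n. \<bar>incr h e\<bar>) + (3 + C) * real n))"
      unfolding sum_distrib_left[symmetric] by (simp add: sum.distrib algebra_simps)
    then show ?thesis by (simp only: sum.distrib[of "\<lambda>e. (\<Sum>c<m. ?T c e * efun (incr h e) (u c)) + 2 * (\<omega> * (\<bar>incr h e\<bar> + 3 + C))"]
      sum.distrib[of "\<lambda>e. \<Sum>c<m. ?T c e * efun (incr h e) (u c)"])
  qed
  also have "(\<Sum>e<n. \<Sum>c<m. ?T c e * efun (incr h e) (u c)) = (\<Sum>c<m. block_energy n (tent B (Suc c)) (u c) h)"
    unfolding block_energy_def by (rule sum.swap)
  finally have main: "2 * slope_energy n (euler n P (k + j)) h \<le> (\<Sum>c<m. block_energy n (tent B (Suc c)) (u c) h)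
    + 2 * (\<omega> * ((\<Sum>e<n. \<bar>incr h e\<bar>) + (3 + C) * real n)) + (\<Sum>e<n. if e < B \<or> m * B \<le> e then 4 else 0)" .
  have "\<omega> * ((\<Sum>e<n. \<bar>incr h e\<bar>) + (3 + C) * real n) \<le> \<omega> * ((2 * C + 3) * real n)"
    using sum_incr_le_tame[OF h] by (intro mult_left_mono om) (simp add: algebra_simps)
  also have "\<dots> = ((3 * (1 + C)^2 + 1) * K + 1) * (2 * C + 3) * real B" using n by (simp add: \<omega>_def)
  finally show ?thesis using main bdry by (simp add: algebra_simps)
qed

lemma dist2_run_le:
  assumes n: "0 < n" and h: "tame n C h" and K: "0 \<le> K" and P: "smooth_profile n C K P"
  shows "run n (move n) j (dist2 n (euler n P (k + j))) h \<le> dist2 n (euler n P k) h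
    + (\<Sum>i<j. run n (move n) i (slope_energy n (euler n P (k + i))) h / real n + (K + K^2) / real n ^ 2)"
proof (induction j)
  case (Suc j)
  have "run n (move n) (Suc j) (dist2 n (euler n P (k + Suc j))) h = run n (move n) j (avg n (move n) (dist2 n (euler n P (k + Suc j)))) h"
    by (simp add: run_Suc')
  also have "\<dots> \<le> run n (move n) j (\<lambda>h. dist2 n (euler n P (k + j)) h + (1 / real n * slope_energy n (euler n P (k + j)) h + (K + K^2) / real n ^ 2)) h"
  proof (rule run_mono[where I = "tame n C"])
    fix q assume "tame n C q"
    then show "avg n (move n) (dist2 n (euler n P (k + Suc j))) q
      \<le> dist2 n (euler n P (k + j)) q + (1 / real n * slope_energy n (euler n P (k + j)) q + (K + K^2) / real n ^ 2)"
      using dist2_step[OF n K smooth_euler[OF n K P, of "k + j"], of q] by (simp add: tame_def euler_Suc)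
  qed (use h tame_move in auto)
  also have "\<dots> = run n (move n) j (dist2 n (euler n P (k + j))) h
      + (1 / real n * run n (move n) j (slope_energy n (euler n P (k + j))) h + (K + K^2) / real n ^ 2)"
    by (simp only: run_add run_cmult run_const[OF n])
  finally show ?case using Suc by simp
qed simp

text \<open>Space blocks of length B of order n and time blocks of length n B^2: the
  equilibrium estimate is applied to each tent with the slope frozen at its centre.\<close>
lemma dist2_time_block:
  assumes "0 < \<delta>" "0 \<le> C" "0 \<le> K"
  shows "\<exists>n0>0. \<forall>n\<ge>n0. \<exists>\<tau>>0. \<tau> \<le> n ^ 3 \<and> (\<forall>P h j k. smooth_profile n C K P \<longrightarrow> tame n C h \<longrightarrow> j \<le> \<tau> \<longrightarrow>
    run n (move n) j (dist2 n (euler n P (k + j))) h \<le> dist2 n (euler n P k) h + \<delta> * real \<tau>)"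
proof -
  define K3 where "K3 = ((3 * (1 + C)^2 + 1) * K + 1) * (2 * C + 3) + 6"
  have K3: "0 < K3" using assms by (auto simp: K3_def intro!: add_nonneg_pos)
  \<comment> \<open>The block length as a fraction of n: the freezing and boundary error of order K3
    B then takes a third of the budget, and two block lengths fit into n.\<close>
  define \<beta> where "\<beta> = min (1 / 2) (\<delta> / (3 * K3))"
  have be: "0 < \<beta>" "\<beta> \<le> 1 / 2" "K3 * \<beta> \<le> \<delta> / 3"
    using assms K3 by (auto simp: \<beta>_def min_def field_simps)
  \<comment> \<open>At most n / B blocks contribute \<epsilon> n^3 each. As B \<ge> \<beta> n / 2,
    this choice makes their total at most \<delta> / 3 times n B^2.\<close>
  define \<epsilon> where "\<epsilon> = \<delta> / 3 * (\<beta> / 2)^3"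
  have ep: "0 < \<epsilon>" using be assms by (simp add: \<epsilon>_def)
  have C1: "0 \<le> C + 1" using assms by simp
  obtain n1 where n1: "n1 > 0" "\<forall>n\<ge>n1. \<forall>N. \<bar>real_of_int N\<bar> \<le> (C + 1) * real n \<longrightarrow> (\<forall>\<beta> \<theta> h T. cutoff n \<beta> \<theta> \<longrightarrow> tame n (C + 1) h \<longrightarrow>
    (\<Sum>k<T. run n (move n) k (block_energy n \<theta> (real_of_int N / real n)) h) \<le> \<epsilon> * (real n ^ 4 + real T * \<beta> * real n ^ 2))"
    using block_energy_time[OF ep C1] by (elim exE conjE) (rule that)
  obtain n2 where n2: "real n2 > 2 / \<beta> + 2 + 3 * (K + K^2) / \<delta>"
    using reals_Archimedean2 by blast
  show ?thesis
  proof (rule exI[of _ "max n1 n2"], intro conjI allI impI)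
    show "0 < max n1 n2" using n1 by simp
    fix n assume nn: "max n1 n2 \<le> n"
    have nr: "real n > 2 / \<beta> + 2 + 3 * (K + K^2) / \<delta>" using n2 nn by (smt (verit) max.bounded_iff of_nat_mono)
    have "0 < 2 / \<beta>" "0 \<le> 3 * (K + K^2) / \<delta>" using be assms by auto
    then have nr': "real n > 2 / \<beta>" "real n > 2" "real n > 3 * (K + K^2) / \<delta>" using nr by linarith+
    have np: "0 < n" using nr'(2) by simp
    define B where "B = nat \<lfloor>\<beta> * real n\<rfloor>"
    have bn: "2 < \<beta> * real n" using nr'(1) be(1) by (simp add: field_simps)
    then have B: "real B \<le> \<beta> * real n" "\<beta> * real n - 1 < real B" unfolding B_def by (auto simp: of_nat_nat)
    have B1: "\<beta> / 2 * real n \<le> real B" "0 < B" using B bn by auto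
    have "\<beta> * real n \<le> 1 / 2 * real n" using be by (intro mult_right_mono) auto
    then have "real (2 * B) \<le> real n" using B(1) by simp
    then have B2: "2 * B \<le> n" by (simp only: of_nat_le_iff)
    let ?\<tau> = "n * B ^ 2"
    have \<tau>: "real ?\<tau> = real n * real B ^ 2" by simp
    show "\<exists>\<tau>>0. \<tau> \<le> n ^ 3 \<and> (\<forall>P h j k. smooth_profile n C K P \<longrightarrow> tame n C h \<longrightarrow> j \<le> \<tau> \<longrightarrow>
      run n (move n) j (dist2 n (euler n P (k + j))) h \<le> dist2 n (euler n P k) h + \<delta> * real \<tau>)"
    proof (intro exI[of _ ?\<tau>] conjI allI impI)
      show "0 < ?\<tau>" using np B1 by simp
      have "B ^ 2 \<le> n ^ 2" using B2 by (intro power_mono) auto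
      then show "?\<tau> \<le> n ^ 3" by (simp add: power3_eq_cube power2_eq_square)
      fix P h j k
      assume P: "smooth_profile n C K P" and h: "tame n C h" and j: "j \<le> ?\<tau>"
      have jr: "real j \<le> real n * real B ^ 2" using j \<tau> by (metis of_nat_mono)
      define m where "m = n div B - 1"
      define N where "N c = \<lfloor>real n * slope (euler n P k) (Suc c * B)\<rfloor>" for c
      let ?b = "\<lambda>c. block_energy n (tent B (Suc c)) (real_of_int (N c) / real n)"
      have h': "tame n (C + 1) h" using h by (simp add: tame_def distrib_right)
      have cm: "(Suc c + 1) * B \<le> n" if "c < m" for c
      proof -
        have "(Suc c + 1) * B \<le> (n div B) * B" using that unfolding m_def by (intro mult_le_mono1) simp
        then show ?thesis using div_times_less_eq_dividend[of n B] by linarith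
      qed
      have blk: "(\<Sum>i<j. run n (move n) i (?b c) h) \<le> \<epsilon> * (2 * real n ^ 4)" if c: "c < m" for c
      proof -
        have "\<bar>slope (euler n P k) (Suc c * B)\<bar> \<le> C"
          using smooth_euler[OF np assms(3) P, of k] cm[OF c] B1(2) unfolding smooth_profile_def by auto
        then have "\<bar>real n * slope (euler n P k) (Suc c * B)\<bar> \<le> real n * C" by (simp add: abs_mult mult_left_mono)
        then have "\<bar>real_of_int (N c)\<bar> \<le> real n * C + 1" unfolding N_def by linarith
        then have Nc: "\<bar>real_of_int (N c)\<bar> \<le> (C + 1) * real n" using np by (simp add: algebra_simps)
        have "(\<Sum>i<j. run n (move n) i (?b c) h) \<le> \<epsilon> * (real n ^ 4 + real j * (1 / real B) * real n ^ 2)"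
          using n1(2)[rule_format, OF _ Nc tent_cutoff[OF B1(2) _ cm[OF c]] h'] nn by simp
        also have "\<dots> \<le> \<epsilon> * (2 * real n ^ 4)"
        proof (intro mult_left_mono)
          have "real j * (1 / real B) \<le> (real n * real B ^ 2) * (1 / real B)" by (intro mult_right_mono jr) simp
          also have "\<dots> = real n * real B" using B1 by (simp add: power2_eq_square)
          also have "\<dots> \<le> real n * real n" using B2 by (intro mult_left_mono) auto
          finally have "real j * (1 / real B) * real n ^ 2 \<le> (real n * real n) * real n ^ 2" by (rule mult_right_mono) simp
          then show "real n ^ 4 + real j * (1 / real B) * real n ^ 2 \<le> 2 * real n ^ 4"
            by (simp add: power2_eq_square power4_eq_xxxx mult.assoc)
        qed (use ep in simp)
        finally show ?thesis .
      qed
      have se: "(\<Sum>i<j. run n (move n) i (slope_energy n (euler n P (k + i))) h) \<le> real m * (\<epsilon> * real n ^ 4) + real j * (K3 * real B)"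
      proof -
        have "(\<Sum>i<j. run n (move n) i (slope_energy n (euler n P (k + i))) h)
          \<le> (\<Sum>i<j. run n (move n) i (\<lambda>h. 1 / 2 * (\<Sum>c<m. ?b c h) + K3 * real B) h)"
        proof (intro sum_mono run_mono[where I = "tame n C"])
          fix i q assume i: "i \<in> {..<j}" and q: "tame n C q"
          have "real i \<le> real n * real B ^ 2" using i jr by simp
          then show "slope_energy n (euler n P (k + i)) q \<le> 1 / 2 * (\<Sum>c<m. ?b c q) + K3 * real B"
            using slope_energy_blocks[OF np q assms(3) P B1(2) B2, of i k] unfolding m_def N_def K3_def by simp
        qed (use h tame_move in auto)
        also have "\<dots> = (\<Sum>i<j. 1 / 2 * (\<Sum>c<m. run n (move n) i (?b c) h) + K3 * real B)"
          by (simp only: run_add run_cmult run_const[OF np] run_sum[OF finite_lessThan np])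
        also have "\<dots> = 1 / 2 * (\<Sum>c<m. \<Sum>i<j. run n (move n) i (?b c) h) + real j * (K3 * real B)"
          by (simp add: sum.distrib sum_distrib_left sum_divide_distrib sum.swap[of _ "{..<m}"])
        also have "\<dots> \<le> 1 / 2 * (\<Sum>c<m. \<epsilon> * (2 * real n ^ 4)) + real j * (K3 * real B)"
          by (intro add_right_mono mult_left_mono sum_mono blk) auto
        finally show ?thesis by simp
      qed
      have "run n (move n) j (dist2 n (euler n P (k + j))) h \<le> dist2 n (euler n P k) h
        + (\<Sum>i<j. run n (move n) i (slope_energy n (euler n P (k + i))) h / real n + (K + K^2) / real n ^ 2)"
        by (rule dist2_run_le[OF np h assms(3) P])
      also have "(\<Sum>i<j. run n (move n) i (slope_energy n (euler n P (k + i))) h / real n + (K + K^2) / real n ^ 2)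
        = (\<Sum>i<j. run n (move n) i (slope_energy n (euler n P (k + i))) h) / real n + real j * ((K + K^2) / real n ^ 2)"
        by (simp add: sum.distrib sum_divide_distrib)
      finally have main: "run n (move n) j (dist2 n (euler n P (k + j))) h \<le> dist2 n (euler n P k) h
        + ((\<Sum>i<j. run n (move n) i (slope_energy n (euler n P (k + i))) h) / real n + real j * ((K + K^2) / real n ^ 2))" .
      have "(\<Sum>i<j. run n (move n) i (slope_energy n (euler n P (k + i))) h) / real n
        \<le> (real m * (\<epsilon> * real n ^ 4) + real j * (K3 * real B)) / real n"
        by (rule divide_right_mono[OF se]) simp
      also have "\<dots> = real m * \<epsilon> * real n ^ 3 + real j * (K3 * (real B / real n))"
        using np by (simp add: add_divide_distrib power4_eq_xxxx power3_eq_cube)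
      also have "\<dots> \<le> \<delta> / 3 * real ?\<tau> + real ?\<tau> * (\<delta> / 3)"
      proof (rule add_mono)
        have "real m * real B \<le> real n"
        proof -
          have "m * B \<le> (n div B) * B" unfolding m_def by (intro mult_le_mono1) simp
          then have "m * B \<le> n" using div_times_less_eq_dividend[of n B] by linarith
          then show ?thesis by (metis of_nat_mono of_nat_mult)
        qed
        then have m: "real m \<le> real n / real B" using B1 by (simp add: pos_le_divide_eq)
        have "\<epsilon> * real n ^ 3 = \<delta> / 3 * (\<beta> / 2 * real n) ^ 3" by (simp add: \<epsilon>_def power_mult_distrib power_divide)
        also have "\<dots> \<le> \<delta> / 3 * real B ^ 3"
          using B1 be assms by (intro mult_left_mono power_mono) auto
        finally have e3: "\<epsilon> * real n ^ 3 \<le> \<delta> / 3 * real B ^ 3" .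
        have "real m * (\<epsilon> * real n ^ 3) \<le> (real n / real B) * (\<delta> / 3 * real B ^ 3)"
          by (rule mult_mono[OF m e3]) (use ep in auto)
        also have "\<dots> = \<delta> / 3 * real ?\<tau>" using B1 by (simp add: power3_eq_cube power2_eq_square)
        finally show "real m * \<epsilon> * real n ^ 3 \<le> \<delta> / 3 * real ?\<tau>" by (simp add: mult.assoc)
        have jt: "real j \<le> real ?\<tau>" using j by (rule of_nat_mono)
        have "K3 * (real B / real n) \<le> K3 * \<beta>" using B(1) K3 np by (intro mult_left_mono) (auto simp: divide_le_eq)
        then have kb: "K3 * (real B / real n) \<le> \<delta> / 3" using be(3) by linarith
        show "real j * (K3 * (real B / real n)) \<le> real ?\<tau> * (\<delta> / 3)"
          by (rule mult_mono[OF jt kb]) (use K3 in auto)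
      qed
      finally have A: "(\<Sum>i<j. run n (move n) i (slope_energy n (euler n P (k + i))) h) / real n \<le> \<delta> / 3 * real ?\<tau> + real ?\<tau> * (\<delta> / 3)" .
      have "real j * ((K + K^2) / real n ^ 2) \<le> real ?\<tau> * (\<delta> / 3)"
      proof (rule mult_mono)
        show "real j \<le> real ?\<tau>" using j by (rule of_nat_mono)
        have "K + K^2 \<le> \<delta> / 3 * real n" using nr'(3) assms by (simp add: field_simps)
        also have "\<dots> \<le> \<delta> / 3 * real n ^ 2" using np assms by (intro mult_left_mono self_le_power) auto
        finally show "(K + K^2) / real n ^ 2 \<le> \<delta> / 3" using np by (simp add: divide_le_eq)
      qed (use assms in auto)
      moreover have "\<delta> / 3 * real ?\<tau> + real ?\<tau> * (\<delta> / 3) + real ?\<tau> * (\<delta> / 3) = \<delta> * real ?\<tau>" by simp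
      ultimately show "run n (move n) j (dist2 n (euler n P (k + j))) h \<le> dist2 n (euler n P k) h + \<delta> * real ?\<tau>"
        using main A by linarith
    qed
  qed
qed

text \<open>Time blocks of length \<tau> are chained by the semigroup property, with tameness as the
  invariant. The incomplete last block costs \<delta> \<tau>, which is at most \<delta> n^3.\<close>

lemma dist2_bound:
  assumes "0 < \<delta>" "0 \<le> C" "0 \<le> K"
  shows "\<exists>n0>0. \<forall>n\<ge>n0. \<forall>P h k. smooth_profile n C K P \<longrightarrow> tame n C h \<longrightarrow>
    run n (move n) k (dist2 n (euler n P k)) h \<le> dist2 n P h + \<delta> * (real k + real n ^ 3)"
proof -
  obtain n0 where n0: "n0 > 0" "\<forall>n\<ge>n0. \<exists>\<tau>>0. \<tau> \<le> n ^ 3 \<and> (\<forall>P h j k. smooth_profile n C K P \<longrightarrow> tame n C h \<longrightarrow> j \<le> \<tau> \<longrightarrow>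
    run n (move n) j (dist2 n (euler n P (k + j))) h \<le> dist2 n (euler n P k) h + \<delta> * real \<tau>)"
    using dist2_time_block[OF assms] by (elim exE conjE) (rule that)
  show ?thesis
  proof (intro exI[of _ n0] conjI allI impI)
    fix n P h k
    assume n: "n0 \<le> n" and P: "smooth_profile n C K P" and h: "tame n C h"
    have np: "0 < n" using n n0(1) by simp
    obtain \<tau> where t: "\<tau> > 0" "\<tau> \<le> n ^ 3" and step': "\<forall>P h j k. smooth_profile n C K P \<longrightarrow> tame n C h \<longrightarrow> j \<le> \<tau> \<longrightarrow>
      run n (move n) j (dist2 n (euler n P (k + j))) h \<le> dist2 n (euler n P k) h + \<delta> * real \<tau>"
      using n0(2)[rule_format, OF n] by (elim exE conjE) (rule that)
    note step = step'[rule_format, OF P]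
    have ext: "run n (move n) (a + r) (dist2 n (euler n P (a + r))) h \<le> run n (move n) a (dist2 n (euler n P a)) h + \<delta> * real \<tau>"
      if "r \<le> \<tau>" for a r
    proof -
      have "run n (move n) (a + r) (dist2 n (euler n P (a + r))) h = run n (move n) a (run n (move n) r (dist2 n (euler n P (a + r)))) h"
        by (simp add: run_run)
      also have "\<dots> \<le> run n (move n) a (\<lambda>q. dist2 n (euler n P a) q + \<delta> * real \<tau>) h"
        by (rule run_mono[where I = "tame n C"]) (use h tame_move step that in auto)
      finally show ?thesis by (simp add: run_add run_const[OF np])
    qed
    have whole: "run n (move n) (J * \<tau>) (dist2 n (euler n P (J * \<tau>))) h \<le> dist2 n P h + real J * (\<delta> * real \<tau>)" for J
    proof (induction J)
      case (Suc J)
      then show ?case using ext[of \<tau> "J * \<tau>"] by (simp add: add.commute[of \<tau>] distrib_right)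
    qed simp
    have k: "k = (k div \<tau>) * \<tau> + k mod \<tau>" by simp
    have "run n (move n) k (dist2 n (euler n P k)) h \<le> run n (move n) ((k div \<tau>) * \<tau>) (dist2 n (euler n P ((k div \<tau>) * \<tau>))) h + \<delta> * real \<tau>"
      using ext[of "k mod \<tau>" "(k div \<tau>) * \<tau>"] t(1) by simp
    also have "\<dots> \<le> dist2 n P h + real (k div \<tau>) * (\<delta> * real \<tau>) + \<delta> * real \<tau>"
      using whole[of "k div \<tau>"] by simp
    also have "\<dots> = dist2 n P h + \<delta> * real ((k div \<tau>) * \<tau>) + \<delta> * real \<tau>" by simp
    finally have A: "run n (move n) k (dist2 n (euler n P k)) h \<le> dist2 n P h + \<delta> * real ((k div \<tau>) * \<tau>) + \<delta> * real \<tau>" .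
    have "real ((k div \<tau>) * \<tau>) \<le> real k" by (rule of_nat_mono) (rule div_times_less_eq_dividend)
    moreover have "real \<tau> \<le> real n ^ 3" using t(2) by (metis of_nat_mono of_nat_power)
    ultimately have "\<delta> * real ((k div \<tau>) * \<tau>) \<le> \<delta> * real k" "\<delta> * real \<tau> \<le> \<delta> * real n ^ 3"
      using assms(1) by (auto simp del: of_nat_mult)
    then show "run n (move n) k (dist2 n (euler n P k)) h \<le> dist2 n P h + \<delta> * (real k + real n ^ 3)"
      using A unfolding distrib_left by linarith
  qed (rule n0(1))
qed

section \<open>Uniform deviations\<close>


definition rise_le :: "nat \<Rightarrow> real \<Rightarrow> (nat \<Rightarrow> real) \<Rightarrow> bool" where
  "rise_le n \<rho> f \<longleftrightarrow> (\<forall>a b. a \<le> b \<longrightarrow> b \<le> n \<longrightarrow> f b - f a \<le> \<rho>)"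

text \<open>After the move, the difference at the updated site y lies between its old values at y
  and at a neighbour z. A site strictly left of y is still weakly left of z, so a new rise ending at
  y is bounded by an old rise ending at y or at z; rises starting at y are treated likewise.\<close>

lemma rise_le_move2:
  assumes "rise_le n \<rho> (\<lambda>x. real_of_int (fst p x - snd p x))" "e < n" "0 \<le> \<rho>"
  shows "rise_le n \<rho> (\<lambda>x. real_of_int (fst (move2 n e b p) x - snd (move2 n e b p) x))"
proof -
  define h g where "h = fst p" and "g = snd p"
  define d where "d x = h x - g x" for x
  define d' where "d' x = move n e b h x - move n e b g x" for x
  have old: "real_of_int (d x - d a) \<le> \<rho>" if "a \<le> x" "x \<le> n" for a x
    using assms(1) that unfolding rise_le_def d_def h_def g_def by auto
  have "real_of_int (d' x - d' a) \<le> \<rho>" if ax: "a \<le> x" "x \<le> n" for a x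
    using assms(2)
  proof (cases rule: move_diff_cases[of e n b h g])
    case stay
    then show ?thesis using old[OF ax] by (simp add: d_def d'_def)
  next
    case (site y z)
    have same: "d' w = d w" if "w \<noteq> y" for w using site(5)[OF that] by (simp add: d_def d'_def)
    have up: "d' y = d y \<or> d' y \<le> d y \<or> d' y \<le> d z" and lo: "d y \<le> d' y \<or> d z \<le> d' y"
      using site(6,7) by (auto simp: d_def d'_def min_def max_def split: if_splits)
    consider "x = a" | "x \<noteq> y" "a \<noteq> y" | "x = y" "a < y" | "a = y" "y < x" using ax by linarith
    then show ?thesis
    proof cases
      case 3
      then have "a \<le> z" using site(4) by auto
      then have "real_of_int (d z - d a) \<le> \<rho>" "real_of_int (d y - d a) \<le> \<rho>"
        using old[of a z] old[of a y] site(3) 3 ax by auto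
      then show ?thesis using up same[of a] 3 by auto
    next
      case 4
      then have "z \<le> x" using site(4) by auto
      then have "real_of_int (d x - d z) \<le> \<rho>" "real_of_int (d x - d y) \<le> \<rho>"
        using old[of z x] old[of y x] 4 ax by auto
      then show ?thesis using lo same[of x] 4 by auto
    qed (use assms(3) same old[OF ax] in auto)
  qed
  then show ?thesis unfolding rise_le_def d'_def h_def g_def by (auto simp: move2_def)
qed

text \<open>The slack \<eta> absorbs the rounding of the initial data (value 1) and later a
  fluctuation of order n. Only rises are recorded, falls being rises of the reflected
  configuration.\<close>

definition steep :: "nat \<Rightarrow> nat \<Rightarrow> real \<Rightarrow> (nat \<Rightarrow> int) \<Rightarrow> bool" where
  "steep n C \<eta> h \<longleftrightarrow> (\<exists>a b. a \<le> b \<and> b \<le> n \<and> real_of_int (h b - h a) > real C * (real b - real a) + \<eta>)"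

text \<open>Compare with a stationary profile of mean slope C: the rise of the difference never grows.\<close>
lemma steep_rare:
  fixes C :: nat
  assumes "0 < \<delta>" "0 < \<kappa>"
  shows "\<exists>n0>0. \<forall>n\<ge>n0. \<forall>h k. (\<not> steep n C 1 h) \<longrightarrow> run n (move n) k (\<lambda>h. of_bool (steep n C (\<kappa> * real n) h)) h \<le> \<delta>"
proof -
  define \<epsilon> where "\<epsilon> = \<delta> * \<kappa> / 8"
  have ep: "0 < \<epsilon>" using assms by (simp add: \<epsilon>_def)
  have C0: "0 \<le> real C" by simp
  obtain n1 where n1: "n1 > 0" "\<forall>n\<ge>n1. \<forall>N. real N \<le> real C * real n \<longrightarrow>
    (\<exists>Y. (\<forall>g\<in>profiles n N. flucts n N g (Y g)) \<and> Esum n N Y \<le> \<epsilon> * real n * Esum n N (\<lambda>_. 1))"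
    using equilibrium_fluctuations[OF ep C0] by (elim exE conjE) (rule that)
  obtain n2 where n2: "real n2 > 2 / (\<delta> * \<kappa>)" using reals_Archimedean2 by blast
  show ?thesis
  proof (rule exI[of _ "max n1 n2"], intro conjI allI impI)
    show "0 < max n1 n2" using n1 by simp
    fix n h k assume nn: "max n1 n2 \<le> n" and h: "\<not> steep n C 1 h"
    have np: "0 < n" using nn n1 by simp
    have "real n2 \<le> real n" using nn by simp
    then have "2 / (\<delta> * \<kappa>) < real n" using n2 by linarith
    then have nr: "2 \<le> \<delta> * \<kappa> * real n" using assms by (simp add: field_simps)
    let ?N = "C * n"
    have N: "real ?N / real n = real C" using np by simp
    obtain Y where Y: "\<And>g. g \<in> profiles n ?N \<Longrightarrow> flucts n ?N g (Y g)" "Esum n ?N Y \<le> \<epsilon> * real n * Esum n ?N (\<lambda>_. 1)"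
      using n1(2) nn by (metis max.boundedE of_nat_mult order_refl)
    let ?\<eta> = "\<kappa> * real n"
    have eta: "0 < ?\<eta>" using assms np by simp
    let ?p = "run n (move n) k (\<lambda>h. of_bool (steep n C ?\<eta> h)) h"
    have prof: "\<bar>real_of_int (g x) - real C * real x\<bar> \<le> Y g" if "g \<in> profiles n ?N" "x \<le> n" for g x
      using Y(1)[OF that(1)] that(2) unfolding flucts_def N by blast
    have each: "?p \<le> (1 + 2 * Y g) / ?\<eta> + 2 / ?\<eta> * run n (move2 n) k (\<lambda>p. Y (snd p)) (h, g)"
      if g: "g \<in> profiles n ?N" for g
    proof -
      \<comment> \<open>Bound for the initial rise of h - g: 1 is the slack of h, and g strays from
        its line by at most \<open>Y g\<close> at each of two sites.\<close>
      define \<rho> where "\<rho> = 1 + 2 * Y g"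
      have Y0: "0 \<le> Y g" using Y(1)[OF g] by (simp add: flucts_def)
      define I where "I p \<longleftrightarrow> rise_le n \<rho> (\<lambda>x. real_of_int (fst p x - snd p x)) \<and> snd p \<in> profiles n ?N" for p
      have init: "I (h, g)" unfolding I_def rise_le_def
      proof (intro conjI allI impI)
        fix a b assume ab: "a \<le> b" "b \<le> n"
        have "real_of_int (h b - h a) \<le> real C * (real b - real a) + 1"
          using h ab unfolding steep_def by force
        then show "real_of_int (fst (h, g) b - snd (h, g) b) - real_of_int (fst (h, g) a - snd (h, g) a) \<le> \<rho>"
          using prof[OF g, of a] prof[OF g, of b] ab by (simp add: \<rho>_def right_diff_distrib abs_le_iff)
      qed (simp add: g)
      have inv: "I (move2 n e b q)" if "I q" "e < n" for q e b
        using that rise_le_move2[of n \<rho> q e b] profiles_move[of "snd q" n ?N e b] Y0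
        by (auto simp: I_def \<rho>_def) (simp add: move2_def)
      \<comment> \<open>Markov's inequality in pointwise form: a steep configuration at the later
        time forces \<open>?\<eta>\<close> \<le> \<rho> + 2 \<open>Y (snd q)\<close>.\<close>
      have pt: "of_bool (steep n C ?\<eta> (fst q)) \<le> \<rho> / ?\<eta> + 2 / ?\<eta> * Y (snd q)" if q: "I q" for q
      proof -
        have Yq: "0 \<le> Y (snd q)" using Y(1) q by (simp add: I_def flucts_def)
        show ?thesis
        proof (cases "steep n C ?\<eta> (fst q)")
          case True
          then obtain a b where ab: "a \<le> b" "b \<le> n" "real_of_int (fst q b - fst q a) > real C * (real b - real a) + ?\<eta>"
            unfolding steep_def by blast
          have "real_of_int (fst q b - snd q b) - real_of_int (fst q a - snd q a) \<le> \<rho>"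
            using q ab unfolding I_def rise_le_def by blast
          moreover have "\<bar>real_of_int (snd q a) - real C * real a\<bar> \<le> Y (snd q)" "\<bar>real_of_int (snd q b) - real C * real b\<bar> \<le> Y (snd q)"
            using prof q ab unfolding I_def by auto
          ultimately have "?\<eta> \<le> \<rho> + 2 * Y (snd q)"
            using ab(3) by (simp add: right_diff_distrib abs_le_iff)
          then show ?thesis using True eta by (simp add: add_divide_distrib[symmetric] pos_le_divide_eq)
        next
          case False
          then show ?thesis using Yq Y0 eta by (auto simp: \<rho>_def intro!: add_nonneg_nonneg divide_nonneg_pos)
        qed
      qed
      have "?p = run n (move2 n) k (\<lambda>q. of_bool (steep n C ?\<eta> (fst q))) (h, g)"
        using run_fst[of n k "\<lambda>h. of_bool (steep n C ?\<eta> h)" "(h, g)"] by simp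
      also have "\<dots> \<le> run n (move2 n) k (\<lambda>q. \<rho> / ?\<eta> + 2 / ?\<eta> * Y (snd q)) (h, g)"
        by (rule run_mono[where I = I]) (use inv init pt in auto)
      also have "\<dots> = \<rho> / ?\<eta> + 2 / ?\<eta> * run n (move2 n) k (\<lambda>p. Y (snd p)) (h, g)"
        by (simp only: run_add run_cmult run_const[OF np])
      finally show ?thesis by (simp add: \<rho>_def)
    qed
    let ?c = "Esum n ?N (\<lambda>_. 1)"
    have c: "0 < ?c" by (rule card_profiles_pos[OF np])
    have "?p * ?c \<le> Esum n ?N (\<lambda>g. (1 / ?\<eta> * 1 + 2 / ?\<eta> * Y g) + 2 / ?\<eta> * run n (move2 n) k (\<lambda>p. Y (snd p)) (h, g))"
      unfolding Esum_const[symmetric] by (rule Esum_mono) (use each in \<open>simp add: add_divide_distrib\<close>)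
    also have "\<dots> = 1 / ?\<eta> * ?c + 4 / ?\<eta> * Esum n ?N Y"
      by (simp only: Esum_add Esum_cmult Esum_run_snd[OF np])
    also have "\<dots> \<le> 1 / ?\<eta> * ?c + 4 / ?\<eta> * (\<epsilon> * real n * ?c)"
      using eta by (intro add_left_mono mult_left_mono Y(2)) auto
    also have "\<dots> = (1 / ?\<eta> + 4 * \<epsilon> / \<kappa>) * ?c" using np assms by (simp add: field_simps)
    finally have "?p \<le> 1 / ?\<eta> + 4 * \<epsilon> / \<kappa>" using c by simp
    also have "\<dots> \<le> \<delta> / 2 + \<delta> / 2"
    proof (rule add_mono)
      show "1 / ?\<eta> \<le> \<delta> / 2" using nr eta by (simp add: field_simps)
      show "4 * \<epsilon> / \<kappa> \<le> \<delta> / 2" using assms by (simp add: \<epsilon>_def)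
    qed
    finally show "?p \<le> \<delta>" by simp
  qed
qed

section \<open>From mean square to uniform distance\<close>

lemma slope_bound_diff:
  assumes "\<And>e. e < n \<Longrightarrow> \<bar>slope P e\<bar> \<le> C" "a \<le> b" "b \<le> n"
  shows "\<bar>P b - P a\<bar> \<le> C * (real b - real a)"
  using assms(2,3)
proof (induction rule: dec_induct)
  case (step m)
  then have "\<bar>slope P m\<bar> \<le> C" by (intro assms(1)) simp
  moreover have "C * (real (Suc m) - real a) = C * (real m - real a) + C" by (simp add: algebra_simps)
  moreover have "\<bar>P m - P a\<bar> \<le> C * (real m - real a)" using step by simp
  ultimately show ?case unfolding slope_def by linarith
qed simp

text \<open>Over a distance m of about \<kappa> n / (2 (C + 1)) h changes by at most 3 \<kappa> n /
  2 and P by at most \<kappa> n / 2. So a deviation above 4 \<kappa> n remains at least 2 \<kappa> n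
  on m + 1 sites, and the squares there add up to the stated multiple of n^3.\<close>

lemma large_deviation_imp_dist2:
  fixes C :: nat
  assumes "\<And>e. e < n \<Longrightarrow> \<bar>slope P e\<bar> \<le> real C" "\<not> steep n C (\<kappa> * real n) h" "\<not> steep n C (\<kappa> * real n) (\<lambda>x. - h x)"
    and x: "x \<le> n" "\<bar>real_of_int (h x) - P x\<bar> > 4 * \<kappa> * real n" and k: "0 < \<kappa>" "\<kappa> \<le> 1" and n: "0 < n"
  shows "2 * \<kappa> ^ 3 / (real C + 1) * real n ^ 3 \<le> dist2 n P h"
proof -
  define m where "m = nat \<lfloor>\<kappa> * real n / (2 * (real C + 1))\<rfloor>"
  have pos: "0 \<le> \<kappa> * real n / (2 * (real C + 1))" using k by simp
  have m: "real m \<le> \<kappa> * real n / (2 * (real C + 1))" "\<kappa> * real n / (2 * (real C + 1)) \<le> real m + 1"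
    using pos unfolding m_def by (auto simp: of_nat_nat)
  have mC: "real C * real m \<le> \<kappa> * real n / 2"
  proof -
    have "real C * real m \<le> (real C + 1) * real m" by (simp add: distrib_right)
    also have "\<dots> \<le> (real C + 1) * (\<kappa> * real n / (2 * (real C + 1)))" by (intro mult_left_mono m) simp
    also have "\<dots> = \<kappa> * real n / 2" by (simp add: field_simps)
    finally show ?thesis .
  qed
  have m2: "2 * m \<le> n"
  proof -
    have "real m \<le> \<kappa> * real n / 2"
    proof -
      have "\<kappa> * real n / (2 * (real C + 1)) \<le> \<kappa> * real n / 2" using k by (intro divide_left_mono) auto
      then show ?thesis using m(1) by linarith
    qed
    also have "\<dots> \<le> 1 * real n / 2" using k by (intro divide_right_mono mult_right_mono) auto
    finally have "real (2 * m) \<le> real n" by simp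
    then show ?thesis by (simp only: of_nat_le_iff)
  qed
  have hmod: "\<bar>real_of_int (h b - h a)\<bar> \<le> real C * (real b - real a) + \<kappa> * real n" if "a \<le> b" "b \<le> n" for a b
  proof -
    have "real_of_int (h b - h a) \<le> real C * (real b - real a) + \<kappa> * real n"
      using assms(2) that unfolding steep_def by force
    moreover have "real_of_int (- h b - - h a) \<le> real C * (real b - real a) + \<kappa> * real n"
      using assms(3) that unfolding steep_def by force
    ultimately show ?thesis by simp
  qed
  have Pb: "\<bar>P b - P a\<bar> \<le> real C * (real b - real a)" if "a \<le> b" "b \<le> n" for a b
    by (rule slope_bound_diff[OF assms(1) that])
  have far: "2 * \<kappa> * real n \<le> \<bar>real_of_int (h y) - P y\<bar>" if y: "y \<le> n" "real y \<le> real x + real m" "real x \<le> real y + real m" for y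
  proof -
    have *: "real C * (real b - real a) \<le> \<kappa> * real n / 2" if "real b - real a \<le> real m" for a b :: nat
      using mult_left_mono[OF that, of "real C"] mC by simp
    have "\<bar>real_of_int (h x - h y)\<bar> \<le> \<kappa> * real n / 2 + \<kappa> * real n \<and> \<bar>P x - P y\<bar> \<le> \<kappa> * real n / 2"
    proof (cases "x \<le> y")
      case True
      then show ?thesis using hmod[of x y] Pb[of x y] *[of y x] y
        by (auto simp: abs_minus_commute)
    next
      case False
      then show ?thesis using hmod[of y x] Pb[of y x] *[of x y] y x
        by auto
    qed
    then have "\<bar>real_of_int (h x) - real_of_int (h y)\<bar> \<le> \<kappa> * real n / 2 + \<kappa> * real n" "\<bar>P x - P y\<bar> \<le> \<kappa> * real n / 2" by auto
    then show ?thesis using x(2) by linarith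
  qed
  \<comment> \<open>A window of m + 1 sites with x at one end; it fits on at least one side of x
    because 2 m \<le> n.\<close>
  obtain S where S: "S \<subseteq> {..n}" "card S = m + 1" "finite S" "\<And>y. y \<in> S \<Longrightarrow> real y \<le> real x + real m \<and> real x \<le> real y + real m"
  proof (cases "x + m \<le> n")
    case True
    show ?thesis by (rule that[of "{x..x + m}"]) (use True in \<open>auto simp: of_nat_add[symmetric] simp del: of_nat_add\<close>)
  next
    case False
    show ?thesis by (rule that[of "{x - m..x}"]) (use False m2 x in \<open>auto simp: of_nat_add[symmetric] simp del: of_nat_add\<close>)
  qed
  have "2 * \<kappa> ^ 3 / (real C + 1) * real n ^ 3 = (\<kappa> * real n / (2 * (real C + 1))) * (2 * \<kappa> * real n)^2"
    by (simp add: power2_eq_square power3_eq_cube field_simps)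
  also have "\<dots> \<le> (real m + 1) * (2 * \<kappa> * real n)^2" by (intro mult_right_mono m) simp
  also have "\<dots> = (\<Sum>y\<in>S. (2 * \<kappa> * real n)^2)" using S(2) by simp
  also have "\<dots> \<le> (\<Sum>y\<in>S. (real_of_int (h y) - P y)^2)"
  proof (rule sum_mono)
    fix y assume "y \<in> S"
    then have "2 * \<kappa> * real n \<le> \<bar>real_of_int (h y) - P y\<bar>" using far S by auto
    then show "(2 * \<kappa> * real n)^2 \<le> (real_of_int (h y) - P y)^2"
      using k by (metis abs_of_nonneg abs_le_square_iff mult_nonneg_nonneg of_nat_0_le_iff less_imp_le zero_le_numeral)
  qed
  also have "\<dots> \<le> dist2 n P h" unfolding dist2_def by (intro sum_mono2 S) auto
  finally show ?thesis .
qed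

text \<open>A large deviation at one site requires a steep rise, a steep fall, or a squared distance
  of order n^3. The first two are rare by the coupling, the third by Markov's inequality.\<close>

lemma sup_deviation:
  fixes C :: nat
  assumes "0 < \<delta>" "0 < \<kappa>" "\<kappa> \<le> 1" "0 \<le> K" "0 \<le> T"
  shows "\<exists>n0>0. \<forall>n\<ge>n0. \<forall>P h k. smooth_profile n (real C) K P \<longrightarrow> tame n (real C) h \<longrightarrow>
    \<not> steep n C 1 h \<longrightarrow> \<not> steep n C 1 (\<lambda>x. - h x) \<longrightarrow> (\<forall>x\<le>n. \<bar>real_of_int (h x) - P x\<bar> \<le> real C) \<longrightarrow> real k \<le> T * real n ^ 3 \<longrightarrow>
    run n (move n) k (\<lambda>h. of_bool (\<exists>x\<le>n. \<bar>real_of_int (h x) - euler n P k x\<bar> > 4 * \<kappa> * real n)) h \<le> \<delta>"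
proof -
  define \<gamma> where "\<gamma> = 2 * \<kappa> ^ 3 / (real C + 1)"
  have ga: "0 < \<gamma>" using assms by (simp add: \<gamma>_def)
  \<comment> \<open>For k \<le> T n^3 the growth \<delta>' (k + n^3) of the mean squared distance is
    then at most a quarter of \<delta> \<gamma> n^3.\<close>
  define \<delta>' where "\<delta>' = \<delta> * \<gamma> / (4 * (T + 1))"
  have de: "0 < \<delta>'" using assms ga by (simp add: \<delta>'_def)
  have d4: "0 < \<delta> / 4" "0 \<le> real C" using assms by auto
  obtain n1 where n1: "n1 > 0" "\<forall>n\<ge>n1. \<forall>h k. (\<not> steep n C 1 h) \<longrightarrow> run n (move n) k (\<lambda>h. of_bool (steep n C (\<kappa> * real n) h)) h \<le> \<delta> / 4"
    using steep_rare[OF d4(1) assms(2), of C] by (elim exE conjE) (rule that)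
  obtain n2 where n2: "n2 > 0" "\<forall>n\<ge>n2. \<forall>P h k. smooth_profile n (real C) K P \<longrightarrow> tame n (real C) h \<longrightarrow>
    run n (move n) k (dist2 n (euler n P k)) h \<le> dist2 n P h + \<delta>' * (real k + real n ^ 3)"
    using dist2_bound[OF de d4(2) assms(4)] by (elim exE conjE) (rule that)
  obtain n3 where n3: "real n3 > 8 * real C ^ 2 / (\<delta> * \<gamma>)" using reals_Archimedean2 by blast
  show ?thesis
  proof (rule exI[of _ "max n1 (max n2 n3)"], intro conjI allI impI)
    show "0 < max n1 (max n2 n3)" using n1 by simp
    fix n P h k
    assume nn: "max n1 (max n2 n3) \<le> n" and P: "smooth_profile n (real C) K P" and h: "tame n (real C) h"
      and st: "\<not> steep n C 1 h" "\<not> steep n C 1 (\<lambda>x. - h x)"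
      and close: "\<forall>x\<le>n. \<bar>real_of_int (h x) - P x\<bar> \<le> real C" and k: "real k \<le> T * real n ^ 3"
    have np: "0 < n" and nn': "n1 \<le> n" "n2 \<le> n" "n3 \<le> n" using nn n1 by auto
    have "real n3 \<le> real n" using nn' by simp
    then have "8 * real C ^ 2 / (\<delta> * \<gamma>) < real n" using n3 by linarith
    then have nr: "8 * real C ^ 2 \<le> \<delta> * \<gamma> * real n" using assms ga by (simp add: field_simps)
    let ?Z = "\<gamma> * real n ^ 3" and ?st = "steep n C (\<kappa> * real n)"
    have Z: "0 < ?Z" using ga np by simp
    have pt: "of_bool (\<exists>x\<le>n. \<bar>real_of_int (q x) - euler n P k x\<bar> > 4 * \<kappa> * real n)
      \<le> of_bool (?st q) + of_bool (?st (\<lambda>x. - q x)) + 1 / ?Z * dist2 n (euler n P k) q" for q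
    proof (cases "(\<exists>x\<le>n. \<bar>real_of_int (q x) - euler n P k x\<bar> > 4 * \<kappa> * real n) \<and> \<not> ?st q \<and> \<not> ?st (\<lambda>x. - q x)")
      case True
      then obtain x where x: "x \<le> n" "\<bar>real_of_int (q x) - euler n P k x\<bar> > 4 * \<kappa> * real n" by blast
      have "?Z \<le> dist2 n (euler n P k) q"
        unfolding \<gamma>_def
        by (rule large_deviation_imp_dist2[where h = q and P = "euler n P k" and x = x])
          (use True x assms(2,3) np smooth_euler[OF np assms(4) P, of k] in \<open>auto simp: smooth_profile_def\<close>)
      then have "1 \<le> 1 / ?Z * dist2 n (euler n P k) q" using Z by (simp add: pos_le_divide_eq)
      then show ?thesis using True by simp
    next
      case False
      have "0 \<le> 1 / ?Z * dist2 n (euler n P k) q" using Z by (auto simp: dist2_def intro!: divide_nonneg_pos sum_nonneg)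
      then show ?thesis using False by auto
    qed
    have "run n (move n) k (\<lambda>h. of_bool (\<exists>x\<le>n. \<bar>real_of_int (h x) - euler n P k x\<bar> > 4 * \<kappa> * real n)) h
      \<le> run n (move n) k (\<lambda>q. of_bool (?st q) + of_bool (?st (\<lambda>x. - q x)) + 1 / ?Z * dist2 n (euler n P k) q) h"
      by (rule run_mono[where I = "\<lambda>_. True"]) (use pt in auto)
    also have "\<dots> = run n (move n) k (\<lambda>q. of_bool (?st q)) h + run n (move n) k (\<lambda>q. of_bool (?st q)) (\<lambda>x. - h x)
        + 1 / ?Z * run n (move n) k (dist2 n (euler n P k)) h"
      using run_uminus[of n k "\<lambda>q. of_bool (?st q)" h] by (simp only: run_add run_cmult)
    also have "\<dots> \<le> \<delta> / 4 + \<delta> / 4 + \<delta> / 2"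
    proof (intro add_mono)
      show "run n (move n) k (\<lambda>q. of_bool (?st q)) h \<le> \<delta> / 4" "run n (move n) k (\<lambda>q. of_bool (?st q)) (\<lambda>x. - h x) \<le> \<delta> / 4"
        using n1(2) nn'(1) st by blast+
      have "run n (move n) k (dist2 n (euler n P k)) h \<le> dist2 n P h + \<delta>' * (real k + real n ^ 3)"
        using n2(2) nn'(2) P h by blast
      also have "\<dots> \<le> \<delta> / 4 * ?Z + \<delta> / 4 * ?Z"
      proof (rule add_mono)
        have "dist2 n P h \<le> (\<Sum>x\<le>n. real C ^ 2)"
          unfolding dist2_def using close by (intro sum_mono) (auto simp: abs_le_square_iff[symmetric])
        also have "\<dots> = (real n + 1) * real C ^ 2" by simp
        also have "\<dots> \<le> 2 * real n * real C ^ 2" using np by (intro mult_right_mono) auto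
        also have "\<dots> = (8 * real C ^ 2) * real n / 4" by simp
        also have "\<dots> \<le> (\<delta> * \<gamma> * real n) * real n / 4" by (intro divide_right_mono mult_right_mono nr) auto
        also have "\<dots> = \<delta> / 4 * \<gamma> * real n ^ 2" by (simp add: power2_eq_square)
        also have "\<dots> \<le> \<delta> / 4 * \<gamma> * real n ^ 3"
          using np assms ga by (intro mult_left_mono power_increasing) auto
        finally show "dist2 n P h \<le> \<delta> / 4 * ?Z" by (simp add: mult.assoc)
        have "\<delta>' * (real k + real n ^ 3) \<le> \<delta>' * ((T + 1) * real n ^ 3)"
          using k de by (intro mult_left_mono) (auto simp: distrib_right)
        also have "\<dots> = \<delta> / 4 * ?Z" using assms by (simp add: \<delta>'_def field_simps)
        finally show "\<delta>' * (real k + real n ^ 3) \<le> \<delta> / 4 * ?Z" .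
      qed
      finally show "1 / ?Z * run n (move n) k (dist2 n (euler n P k)) h \<le> \<delta> / 2"
        using Z by (simp add: divide_le_eq)
    qed
    finally show "run n (move n) k (\<lambda>h. of_bool (\<exists>x\<le>n. \<bar>real_of_int (h x) - euler n P k x\<bar> > 4 * \<kappa> * real n)) h \<le> \<delta>" by simp
  qed
qed

section \<open>Poissonisation\<close>


definition view :: "nat \<Rightarrow> (int \<Rightarrow> int) \<Rightarrow> nat \<Rightarrow> int" where
  "view L h k = h (int k - int L)"

lemma view_upd: "view L (h(int k - int L := v)) = (view L h)(k := v)"
  by (auto simp: view_def fun_eq_iff)

text \<open>At an interior site the rates split by neighbour: the pull of the right neighbour is the
  \<open>True\<close> move on the edge to the right, the pull of the left neighbour the
  \<open>False\<close> move on the edge to the left. Each has rate 1/2, and 2 n such moves make the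
  total rate n.\<close>

lemma gen_view:
  "gen L (\<lambda>h. f (view L h)) h = real (2 * L + 1) * (avg (2 * L + 1) (move (2 * L + 1)) f (view L h) - f (view L h))"
proof -
  let ?n = "2 * L + 1" and ?v = "view L h"
  let ?T = "\<lambda>e. f (move ?n e True ?v) - f ?v" and ?F = "\<lambda>e. f (move ?n e False ?v) - f ?v"
  let ?c = "\<lambda>x. cplus h x * (f (view L (h(x := h x + 1))) - f (view L h)) + cminus h x * (f (view L (h(x := h x - 1))) - f (view L h))"
  have site: "?c (int (Suc i) - int L) = ?T (Suc i) + ?F i" if i: "i < 2 * L" for i
  proof -
    have nb: "h (int (Suc i) - int L + 1) = ?v (Suc (Suc i))" "h (int (Suc i) - int L - 1) = ?v i" "h (int (Suc i) - int L) = ?v (Suc i)"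
      by (auto simp: view_def algebra_simps)
    have mv: "move ?n (Suc i) True ?v = ?v(Suc i := ?v (Suc i) + sgn (?v (Suc (Suc i)) - ?v (Suc i)))"
      "move ?n i False ?v = ?v(Suc i := ?v (Suc i) + sgn (?v i - ?v (Suc i)))"
      using i by (auto simp: move_def sgn_if)
    show ?thesis unfolding mv cplus_def cminus_def nb view_upd
      by (cases "?v (Suc i)" "?v (Suc (Suc i))" rule: linorder_cases; cases "?v (Suc i)" "?v i" rule: linorder_cases) (auto simp: sgn_if fun_upd_idem)
  qed
  have T: "(\<Sum>e<?n. ?T e) = (\<Sum>i<2 * L. ?T (Suc i))"
    unfolding Suc_eq_plus1[symmetric] sum.lessThan_Suc_shift by (simp add: move_def)
  have F: "(\<Sum>e<?n. ?F e) = (\<Sum>i<2 * L. ?F i)"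
    unfolding Suc_eq_plus1[symmetric] sum.lessThan_Suc by (simp add: move_def)
  have "gen L (\<lambda>h. f (view L h)) h = 1 / 2 * (\<Sum>x\<in>{- int L + 1..int L}. ?c x)"
    by (simp add: gen_def)
  also have "(\<Sum>x\<in>{- int L + 1..int L}. ?c x) = (\<Sum>i<2 * L. ?c (int (Suc i) - int L))"
  proof -
    have "(\<Sum>x\<in>{- int L + 1..int L}. c x) = (\<Sum>i<2 * L. c (int (Suc i) - int L))" for c :: "int \<Rightarrow> real"
      by (rule sum.reindex_bij_witness[where i = "\<lambda>i. int (Suc i) - int L" and j = "\<lambda>x. nat (x + int L - 1)"]) auto
    then show ?thesis .
  qed
  also have "\<dots> = (\<Sum>i<2 * L. ?T (Suc i) + ?F i)" by (intro sum.cong refl site) simp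
  also have "\<dots> = (\<Sum>e<?n. ?T e) + (\<Sum>e<?n. ?F e)" unfolding T F by (rule sum.distrib)
  also have "\<dots> = 2 * real ?n * (avg ?n (move ?n) f ?v - f ?v)"
  proof -
    have "(\<Sum>e<?n. ?T e) + (\<Sum>e<?n. ?F e) = (\<Sum>e<?n. f (move ?n e True ?v) + f (move ?n e False ?v)) - real (2 * ?n) * f ?v"
      by (simp only: sum_subtractf sum.distrib) simp
    also have "(\<Sum>e<?n. f (move ?n e True ?v) + f (move ?n e False ?v)) = real (2 * ?n) * avg ?n (move ?n) f ?v"
      unfolding avg_def by simp
    finally show ?thesis by (simp add: right_diff_distrib)
  qed
  also have "1 / 2 * (2 * real ?n * (avg ?n (move ?n) f ?v - f ?v)) = real ?n * (avg ?n (move ?n) f ?v - f ?v)"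
    by (simp only: mult.assoc)
  finally show ?thesis .
qed

section \<open>Expansion of the semigroup over a Poisson number of moves\<close>

definition jump_gen :: "nat \<Rightarrow> ((nat \<Rightarrow> int) \<Rightarrow> real) \<Rightarrow> (nat \<Rightarrow> int) \<Rightarrow> real" where
  "jump_gen n f v = real n * (avg n (move n) f v - f v)"

lemma gen_pow_view: "(gen L ^^ m) (\<lambda>h. f (view L h)) = (\<lambda>h. (jump_gen (2 * L + 1) ^^ m) f (view L h))"
proof (induction m)
  case (Suc m)
  show ?case unfolding funpow.simps comp_def Suc by (rule ext) (simp only: gen_view jump_gen_def)
qed simp

lemma jump_gen_pow_linear:
  "(jump_gen n ^^ m) (\<lambda>v. c * (F v - H v)) = (\<lambda>v. c * ((jump_gen n ^^ m) F v - (jump_gen n ^^ m) H v))"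
proof (induction m arbitrary: F H)
  case (Suc m)
  have "jump_gen n (\<lambda>v. c * (F v - H v)) = (\<lambda>v. c * (jump_gen n F v - jump_gen n H v))"
  proof
    fix v
    have A: "avg n (move n) (\<lambda>v. c * (F v - H v)) v = c * (avg n (move n) F v - avg n (move n) H v)"
      using avg_cmult[of n "move n" c "\<lambda>v. F v - H v" v] avg_add[of n "move n" F "\<lambda>v. -1 * H v" v]
        avg_cmult[of n "move n" "-1" H v] by simp
    show "jump_gen n (\<lambda>v. c * (F v - H v)) v = c * (jump_gen n F v - jump_gen n H v)"
      unfolding jump_gen_def A by (simp add: algebra_simps)
  qed
  then show ?case unfolding funpow_Suc_right comp_def by (simp only: Suc.IH)
qed simp

text \<open>Pascal's rule for alternating binomial sums, which are iterated forward
  differences.\<close>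

lemma binomial_difference:
  fixes a :: "nat \<Rightarrow> real"
  shows "(\<Sum>j\<le>Suc m. real (Suc m choose j) * (-1) ^ (Suc m + j) * a j)
    = (\<Sum>j\<le>m. real (m choose j) * (-1) ^ (m + j) * a (Suc j)) - (\<Sum>j\<le>m. real (m choose j) * (-1) ^ (m + j) * a j)"
proof -
  let ?t = "\<lambda>j. real (m choose Suc j) * (-1) ^ (m + j) * a (Suc j)"
  have "(\<Sum>j\<le>Suc m. real (Suc m choose j) * (-1) ^ (Suc m + j) * a j)
    = (-1) ^ Suc m * a 0 + (\<Sum>j\<le>m. real (m choose j) * (-1) ^ (m + j) * a (Suc j) + ?t j)"
    unfolding sum.atMost_Suc_shift by (simp add: algebra_simps)
  also have "\<dots> = (-1) ^ Suc m * a 0 + (\<Sum>j\<le>m. real (m choose j) * (-1) ^ (m + j) * a (Suc j)) + (\<Sum>j\<le>m. ?t j)"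
    by (simp only: sum.distrib add.assoc)
  also have "(\<Sum>j\<le>m. ?t j) = (-1) ^ m * a 0 - (\<Sum>j\<le>m. real (m choose j) * (-1) ^ (m + j) * a j)"
  proof -
    have "(\<Sum>j\<le>Suc m. real (m choose j) * (-1) ^ (m + j) * a j) = (-1) ^ m * a 0 - (\<Sum>j\<le>m. ?t j)"
      unfolding sum.atMost_Suc_shift by (simp add: sum_negf)
    then show ?thesis by (simp add: binomial_eq_0)
  qed
  finally show ?thesis by simp
qed

text \<open>The binomial expansion of a power of n (\<open>avg\<close> - 1). Starting from
  \<open>run n (move n) i f\<close> rather than f lets the induction absorb an application of
  \<open>avg\<close> into i.\<close>

lemma jump_gen_pow:
  "(jump_gen n ^^ m) (run n (move n) i f) v = real n ^ m * (\<Sum>j\<le>m. real (m choose j) * (-1) ^ (m + j) * run n (move n) (i + j) f v)"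
proof (induction m arbitrary: i)
  case (Suc m)
  have "jump_gen n (run n (move n) i f) = (\<lambda>v. real n * (run n (move n) (Suc i) f v - run n (move n) i f v))"
    by (rule ext) (simp add: jump_gen_def run_Suc)
  then have "(jump_gen n ^^ Suc m) (run n (move n) i f) v
    = real n * ((jump_gen n ^^ m) (run n (move n) (Suc i) f) v - (jump_gen n ^^ m) (run n (move n) i f) v)"
    unfolding funpow_Suc_right comp_def by (simp only: jump_gen_pow_linear)
  also have "\<dots> = real n ^ Suc m * ((\<Sum>j\<le>m. real (m choose j) * (-1) ^ (m + j) * run n (move n) (i + Suc j) f v)
      - (\<Sum>j\<le>m. real (m choose j) * (-1) ^ (m + j) * run n (move n) (i + j) f v))"
    unfolding Suc by (simp add: algebra_simps)
  finally show ?case unfolding binomial_difference .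
qed simp

lemma real_exp_sums: "(\<lambda>k. x ^ k / fact k) sums exp (x :: real)"
  using exp_converges[of x] by (simp add: divide_inverse mult.commute)

text \<open>This is exp (n t (A - 1)) = exp (n t A) exp (- n t) for the averaging operator A. As the
  semigroup is given by a power series, the identity is a Cauchy product; boundedness of the
  averages gives absolute convergence.\<close>

lemma poisson_series:
  assumes "\<And>j. \<bar>run n (move n) j f v\<bar> \<le> 1"
  shows "(\<lambda>m. t ^ m / fact m * (jump_gen n ^^ m) f v) sums ((\<Sum>k. (real n * t) ^ k / fact k * run n (move n) k f v) * exp (- (real n * t)))"
proof -
  let ?a = "\<lambda>j. run n (move n) j f v" and ?l = "real n * t"
  have s1: "summable (\<lambda>k. norm (?l ^ k / fact k * ?a k))"
  proof (rule summable_comparison_test')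
    show "summable (\<lambda>k. \<bar>?l\<bar> ^ k / fact k)" using real_exp_sums sums_summable by blast
    show "norm (norm (?l ^ k / fact k * ?a k)) \<le> \<bar>?l\<bar> ^ k / fact k" if "0 \<le> k" for k
      using assms[of k] by (simp add: abs_mult power_abs mult_left_le divide_right_mono)
  qed
  have s2: "summable (\<lambda>k. norm ((- ?l) ^ k / fact k))"
  proof -
    have "(\<lambda>k. norm ((- ?l) ^ k / fact k)) = (\<lambda>k. \<bar>?l\<bar> ^ k / fact k)" by (simp add: power_abs)
    then show ?thesis using real_exp_sums[of "\<bar>?l\<bar>"] sums_summable by metis
  qed
  have "(\<lambda>m. \<Sum>i\<le>m. (?l ^ i / fact i * ?a i) * ((- ?l) ^ (m - i) / fact (m - i))) sums
     ((\<Sum>k. ?l ^ k / fact k * ?a k) * (\<Sum>k. (- ?l) ^ k / fact k))"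
    by (rule Cauchy_product_sums[OF s1 s2])
  moreover have "(\<Sum>k. (- ?l) ^ k / fact k) = exp (- ?l)" by (rule sums_unique[OF real_exp_sums, symmetric])
  moreover have "(\<Sum>i\<le>m. (?l ^ i / fact i * ?a i) * ((- ?l) ^ (m - i) / fact (m - i))) = t ^ m / fact m * (jump_gen n ^^ m) f v" for m
  proof -
    have "t ^ m / fact m * (jump_gen n ^^ m) f v = (\<Sum>j\<le>m. ?l ^ m / fact m * (real (m choose j) * (-1) ^ (m + j) * ?a j))"
      using jump_gen_pow[where n = n and m = m and i = 0 and f = f and v = v] by (simp add: sum_distrib_left power_mult_distrib mult_ac)
    also have "\<dots> = (\<Sum>i\<le>m. (?l ^ i / fact i * ?a i) * ((- ?l) ^ (m - i) / fact (m - i)))"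
    proof (rule sum.cong[OF refl])
      fix j assume "j \<in> {..m}"
      then obtain i where m: "m = j + i" using le_Suc_ex by auto
      have "real (m choose j) / fact m = 1 / (fact j * fact i)"
        using m by (simp add: binomial_fact)
      moreover have "(- 1 :: real) ^ (m + j) = (- 1) ^ i"
      proof -
        have "(- 1 :: real) ^ (m + j) = (- 1) ^ (2 * j + i)" by (simp add: m mult_2 add_ac)
        then show ?thesis by (simp add: power_add power_mult)
      qed
      moreover have "(- ?l) ^ i = (- 1) ^ i * ?l ^ i" by (rule power_minus)
      ultimately show "?l ^ m / fact m * (real (m choose j) * (-1) ^ (m + j) * ?a j) = (?l ^ j / fact j * ?a j) * ((- ?l) ^ (m - j) / fact (m - j))"
        by (simp add: m power_add field_simps)
    qed
    finally show ?thesis by simp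
  qed
  ultimately show ?thesis by simp
qed

section \<open>Concentration of the Poisson distribution\<close>

lemma poisson_moments:
  fixes x :: real
  shows "(\<lambda>k. x ^ k / fact k * real k) sums (x * exp x)"
    and "(\<lambda>k. x ^ k / fact k * (real k * (real k - 1))) sums (x^2 * exp x)"
proof -
  have 1: "x ^ Suc k / fact (Suc k) * real (Suc k) = x * (x ^ k / fact k)" for k
    by (simp add: fact_Suc del: of_nat_Suc)
  have "(\<lambda>k. x ^ Suc k / fact (Suc k) * real (Suc k)) sums (x * exp x)"
    unfolding 1 by (intro sums_mult real_exp_sums)
  then show A: "(\<lambda>k. x ^ k / fact k * real k) sums (x * exp x)" by (subst (asm) sums_Suc_iff) simp
  have 2: "x ^ Suc k / fact (Suc k) * (real (Suc k) * (real (Suc k) - 1)) = x * (x ^ k / fact k * real k)" for k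
  proof -
    have "x ^ Suc k / fact (Suc k) * (real (Suc k) * (real (Suc k) - 1)) = (x ^ Suc k / fact (Suc k) * real (Suc k)) * real k" by simp
    then show ?thesis unfolding 1 by (simp only: mult.assoc)
  qed
  have "(\<lambda>k. x ^ Suc k / fact (Suc k) * (real (Suc k) * (real (Suc k) - 1))) sums (x * (x * exp x))"
    unfolding 2 by (intro sums_mult A)
  then show "(\<lambda>k. x ^ k / fact k * (real k * (real k - 1))) sums (x^2 * exp x)"
    by (subst (asm) sums_Suc_iff) (simp add: power2_eq_square mult.assoc)
qed

lemma poisson_variance:
  fixes x :: real
  shows "(\<lambda>k. x ^ k / fact k * (real k - x)^2) sums (x * exp x)"
proof -
  have gen: "p * (y - x)^2 = p * (y * (y - 1)) + (1 - 2 * x) * (p * y) + x^2 * p" for p y :: real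
    by (simp add: power2_eq_square algebra_simps)
  have eq: "x ^ k / fact k * (real k - x)^2 = x ^ k / fact k * (real k * (real k - 1)) + (1 - 2 * x) * (x ^ k / fact k * real k) + x^2 * (x ^ k / fact k)" for k
    by (rule gen)
  have "(\<lambda>k. x ^ k / fact k * (real k * (real k - 1)) + (1 - 2 * x) * (x ^ k / fact k * real k) + x^2 * (x ^ k / fact k))
    sums (x^2 * exp x + (1 - 2 * x) * (x * exp x) + x^2 * exp x)"
    by (intro sums_add sums_mult poisson_moments real_exp_sums)
  moreover have "x^2 * exp x + (1 - 2 * x) * (x * exp x) + x^2 * exp x = x * exp x"
    by (simp add: power2_eq_square algebra_simps)
  ultimately show ?thesis unfolding eq by simp
qed

text \<open>Chebyshev's inequality in pointwise form: outside the window (k - x)^2 / r^2 is at least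
  1, and x is also the variance.\<close>

lemma poisson_average_le:
  fixes a :: "nat \<Rightarrow> real"
  assumes a: "\<And>k. 0 \<le> a k" "\<And>k. a k \<le> 1" and x: "0 \<le> x" and r: "0 < r" and d: "0 \<le> \<delta>"
    and near: "\<And>k. \<bar>real k - x\<bar> \<le> r \<Longrightarrow> a k \<le> \<delta>"
  shows "0 \<le> (\<Sum>k. x ^ k / fact k * a k) * exp (- x)" "(\<Sum>k. x ^ k / fact k * a k) * exp (- x) \<le> \<delta> + x / r^2"
proof -
  have sm: "summable (\<lambda>k. x ^ k / fact k * a k)"
  proof (rule summable_comparison_test')
    show "summable (\<lambda>k. x ^ k / fact k)" using real_exp_sums sums_summable by blast
    show "norm (x ^ k / fact k * a k) \<le> x ^ k / fact k" if "0 \<le> k" for k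
      using a[of k] x by (simp add: abs_mult mult_left_le divide_right_mono)
  qed
  show "0 \<le> (\<Sum>k. x ^ k / fact k * a k) * exp (- x)"
    by (intro mult_nonneg_nonneg suminf_nonneg sm) (use a x in auto)
  have le: "a k \<le> \<delta> + (real k - x)^2 / r^2" for k
  proof (cases "\<bar>real k - x\<bar> \<le> r")
    case True
    then show ?thesis using near[OF True] by (simp add: add_increasing2)
  next
    case False
    then have "r^2 \<le> (real k - x)^2" using r by (simp add: abs_le_square_iff[symmetric])
    then have "1 \<le> (real k - x)^2 / r^2" using r by (simp add: pos_le_divide_eq)
    then show ?thesis using a(2)[of k] d by linarith
  qed
  have S: "(\<lambda>k. \<delta> * (x ^ k / fact k) + 1 / r^2 * (x ^ k / fact k * (real k - x)^2)) sums (\<delta> * exp x + 1 / r^2 * (x * exp x))"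
    by (intro sums_add sums_mult poisson_variance real_exp_sums)
  have "(\<Sum>k. x ^ k / fact k * a k) \<le> \<delta> * exp x + 1 / r^2 * (x * exp x)"
  proof (rule sums_le[OF _ summable_sums[OF sm] S])
    fix k
    have "x ^ k / fact k * a k \<le> x ^ k / fact k * (\<delta> + (real k - x)^2 / r^2)"
      using x by (intro mult_left_mono le) auto
    then show "x ^ k / fact k * a k \<le> \<delta> * (x ^ k / fact k) + 1 / r^2 * (x ^ k / fact k * (real k - x)^2)"
      by (simp add: algebra_simps)
  qed
  then have "(\<Sum>k. x ^ k / fact k * a k) * exp (- x) \<le> (\<delta> * exp x + 1 / r^2 * (x * exp x)) * exp (- x)"
    by (rule mult_right_mono) simp
  also have "\<dots> = (\<delta> + x / r^2) * (exp x * exp (- x))" by (simp add: algebra_simps)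
  finally show "(\<Sum>k. x ^ k / fact k * a k) * exp (- x) \<le> \<delta> + x / r^2" by (simp add: exp_minus)
qed

text \<open>The number of moves up to time t is Poisson with mean n t, n = 2 L + 1. Hence the
  discrete chain has to be controlled only for move numbers within r of this mean.\<close>

lemma chain_prob_le:
  assumes A: "\<And>h. h \<in> A \<longleftrightarrow> Q (view L h)" and t: "0 \<le> t" and r: "0 < r" and d: "0 \<le> \<delta>"
    and near: "\<And>k. \<bar>real k - real (2 * L + 1) * t\<bar> \<le> r \<Longrightarrow> run (2 * L + 1) (move (2 * L + 1)) k (\<lambda>v. of_bool (Q v)) (view L h0) \<le> \<delta>"
  shows "0 \<le> chain_prob L h0 t A" "chain_prob L h0 t A \<le> \<delta> + real (2 * L + 1) * t / r^2"
proof -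
  let ?n = "2 * L + 1" and ?f = "\<lambda>v. of_bool (Q v) :: real"
  let ?a = "\<lambda>k. run ?n (move ?n) k ?f (view L h0)"
  have a: "0 \<le> ?a k" "?a k \<le> 1" for k
    using run_mono[where I = "\<lambda>_. True" and F = "\<lambda>_. 0" and G = ?f and p = "view L h0" and n = ?n and act = "move ?n" and k = k]
      run_mono[where I = "\<lambda>_. True" and G = "\<lambda>_. 1" and F = ?f and p = "view L h0" and n = ?n and act = "move ?n" and k = k]
      run_const[of ?n "move ?n" k 0] run_const[of ?n "move ?n" k 1] by auto
  have ab: "\<bar>?a k\<bar> \<le> 1" for k using a[of k] by simp
  have "(\<lambda>h. if h \<in> A then 1 else 0) = (\<lambda>h. ?f (view L h))" using A by auto
  then have G: "(gen L ^^ m) (\<lambda>h. if h \<in> A then 1 else 0) h0 = (jump_gen ?n ^^ m) ?f (view L h0)" for m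
    using gen_pow_view[where m = m and L = L and f = ?f] by simp
  have "chain_prob L h0 t A = (\<Sum>m. t ^ m / fact m * (jump_gen ?n ^^ m) ?f (view L h0))"
    unfolding chain_prob_def markov_sg_def by (simp only: G)
  also have "\<dots> = (\<Sum>k. (real ?n * t) ^ k / fact k * ?a k) * exp (- (real ?n * t))"
    by (rule sums_unique[OF poisson_series[OF ab], symmetric])
  finally have eq: "chain_prob L h0 t A = (\<Sum>k. (real ?n * t) ^ k / fact k * ?a k) * exp (- (real ?n * t))" .
  have x: "0 \<le> real ?n * t" using t by simp
  note p = poisson_average_le[of ?a "real ?n * t" r \<delta>, OF a x r d near]
  show "0 \<le> chain_prob L h0 t A" unfolding eq by (rule p(1))
  show "chain_prob L h0 t A \<le> \<delta> + real ?n * t / r^2" unfolding eq by (rule p(2))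
qed

section \<open>Comparison with the differential equations\<close>


text \<open>At the first time when the barrier is touched, a maximising coordinate has
  nonnegative slope relative to the barrier.\<close>
lemma maximum_principle:
  fixes w w' :: "nat \<Rightarrow> real \<Rightarrow> real"
  assumes der: "\<And>x t. x \<le> n \<Longrightarrow> t \<in> {a..b} \<Longrightarrow> (w x has_real_derivative w' x t) (at t within {a..b})"
    and init: "\<And>x. x \<le> n \<Longrightarrow> w x a \<le> M"
    and drift: "\<And>x t. x \<le> n \<Longrightarrow> t \<in> {a..b} \<Longrightarrow> (\<And>y. y \<le> n \<Longrightarrow> w y t \<le> w x t) \<Longrightarrow> w' x t \<le> \<epsilon>"
    and x: "x \<le> n" and t: "t \<in> {a..b}"
  shows "w x t \<le> M + \<epsilon> * (t - a)"
proof -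
  \<comment> \<open>The slack \<delta>, in both the level and the slope of the barrier, keeps w
    strictly below it at time a and makes the derivative relative to it strictly negative at a
    contact.\<close>
  have strict: "w x t - M - (\<epsilon> + \<delta>) * (t - a) - \<delta> < 0" if d: "0 < \<delta>" for \<delta>
  proof (rule ccontr)
    assume neg: "\<not> ?thesis"
    define v where "v x t = w x t - M - (\<epsilon> + \<delta>) * (t - a) - \<delta>" for x t
    have dv: "(v x has_real_derivative (w' x t - (\<epsilon> + \<delta>))) (at t within {a..b})" if "x \<le> n" "t \<in> {a..b}" for x t
      unfolding v_def by (rule derivative_eq_intros der that refl | simp)+
    have cont: "continuous_on {a..b} (v x)" if "x \<le> n" for x
      using dv[OF that] by (rule DERIV_continuous_on)
    define Z where "Z = (\<Union>x\<in>{..n}. {t \<in> {a..b}. 0 \<le> v x t})"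
    have "compact Z" unfolding Z_def
    proof (rule compact_UN)
      fix x assume "x \<in> {..n}"
      then have "closed {t \<in> {a..b}. 0 \<le> v x t}"
        by (intro continuous_on_closed_Collect_le continuous_intros cont) auto
      then have "compact ({a..b} \<inter> {t \<in> {a..b}. 0 \<le> v x t})" by (intro compact_Int_closed) auto
      moreover have "{a..b} \<inter> {t \<in> {a..b}. 0 \<le> v x t} = {t \<in> {a..b}. 0 \<le> v x t}" by auto
      ultimately show "compact {t \<in> {a..b}. 0 \<le> v x t}" by simp
    qed simp
    moreover have "t \<in> Z" using neg x t unfolding Z_def v_def by (intro UN_I[of x]) auto
    ultimately obtain \<tau> where tau: "\<tau> \<in> Z" "\<And>s. s \<in> Z \<Longrightarrow> \<tau> \<le> s"
      using compact_attains_inf[of Z] by blast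
    obtain y0 where y0: "y0 \<le> n" "0 \<le> v y0 \<tau>" and tab: "\<tau> \<in> {a..b}" using tau(1) unfolding Z_def by auto
    obtain y where y: "y \<le> n" "\<And>z. z \<le> n \<Longrightarrow> w z \<tau> \<le> w y \<tau>"
    proof -
      have "finite ((\<lambda>z. w z \<tau>) ` {..n})" "(\<lambda>z. w z \<tau>) ` {..n} \<noteq> {}" by auto
      then have "Max ((\<lambda>z. w z \<tau>) ` {..n}) \<in> (\<lambda>z. w z \<tau>) ` {..n}" by (rule Max_in)
      then obtain y where "y \<in> {..n}" "Max ((\<lambda>z. w z \<tau>) ` {..n}) = w y \<tau>" by (rule imageE)
      then show ?thesis using that[of y] by (metis Max_ge atMost_iff finite_atMost finite_imageI imageI)
    qed
    have vy: "0 \<le> v y \<tau>" using y0 y(2)[of y0] unfolding v_def by simp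
    have "v y a < 0" using init[OF y(1)] d unfolding v_def by simp
    then have "\<tau> \<noteq> a" using vy by auto
    then have ta: "a < \<tau>" using tab by simp
    \<comment> \<open>With a negative derivative at the first contact time, v was even larger
      shortly before, hence already nonnegative there: a contradiction.\<close>
    have "w' y \<tau> - (\<epsilon> + \<delta>) < 0" using drift[OF y(1) tab y(2)] d by simp
    from has_real_derivative_neg_dec_left[OF dv[OF y(1) tab] this]
    obtain c where c: "c > 0" "\<And>h. 0 < h \<Longrightarrow> \<tau> - h \<in> {a..b} \<Longrightarrow> h < c \<Longrightarrow> v y \<tau> < v y (\<tau> - h)" by blast
    define h where "h = min (c / 2) ((\<tau> - a) / 2)"
    have h: "0 < h" "h < c" "\<tau> - h \<in> {a..b}" using c(1) ta tab by (auto simp: h_def min_def field_simps)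
    have "0 \<le> v y (\<tau> - h)" using c(2)[OF h(1,3,2)] vy by linarith
    then have "\<tau> - h \<in> Z" using h(3) y(1) unfolding Z_def by auto
    then show False using tau(2)[of "\<tau> - h"] h(1) by simp
  qed
  show ?thesis
  proof (rule ccontr)
    assume "\<not> ?thesis"
    then have pos: "0 < w x t - M - \<epsilon> * (t - a)" (is "0 < ?g") by simp
    define \<delta> where "\<delta> = ?g / (2 * (1 + (t - a)))"
    have ta: "0 \<le> t - a" using t by simp
    then have d: "0 < \<delta>" using pos unfolding \<delta>_def by (intro divide_pos_pos) auto
    have "\<delta> * (1 + (t - a)) = ?g / 2" using ta unfolding \<delta>_def by (simp add: field_simps)
    then have "\<delta> + \<delta> * (t - a) < ?g" using pos by (simp add: distrib_left)
    then show False using strict[OF d] by (simp add: distrib_right)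
  qed
qed

definition height_ode :: "nat \<Rightarrow> (nat \<Rightarrow> real \<Rightarrow> real) \<Rightarrow> bool" where
  "height_ode n \<phi> \<longleftrightarrow> (\<forall>t\<ge>0. \<phi> 0 t = 0 \<and> \<phi> n t = 0) \<and>
    (\<forall>x t. 0 < x \<longrightarrow> x < n \<longrightarrow> 0 \<le> t \<longrightarrow> (\<phi> x has_real_derivative
       (sigma (\<phi> (Suc x) t - \<phi> x t) - sigma (\<phi> x t - \<phi> (x - 1) t)) / 2) (at t within {0..}))"

lemma height_ode_uminus: "height_ode n \<phi> \<Longrightarrow> height_ode n (\<lambda>x t. - \<phi> x t)"
proof -
  assume ode: "height_ode n \<phi>"
  have s: "sigma (- u) = - sigma u" for u by (simp add: sigma_def)
  have s': "sigma (- u - - v) = - sigma (u - v)" for u v using s[of "u - v"] by simp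
  have "((\<lambda>t. - \<phi> x t) has_real_derivative (sigma (- \<phi> (Suc x) t - - \<phi> x t) - sigma (- \<phi> x t - - \<phi> (x - 1) t)) / 2) (at t within {0..})"
    if "0 < x" "x < n" "0 \<le> t" for x t
  proof -
    have "((\<lambda>t. - \<phi> x t) has_real_derivative - ((sigma (\<phi> (Suc x) t - \<phi> x t) - sigma (\<phi> x t - \<phi> (x - 1) t)) / 2)) (at t within {0..})"
      using ode that unfolding height_ode_def by (intro DERIV_minus) blast
    moreover have "- ((sigma (\<phi> (Suc x) t - \<phi> x t) - sigma (\<phi> x t - \<phi> (x - 1) t)) / 2) = (sigma (- \<phi> (Suc x) t - - \<phi> x t) - sigma (- \<phi> x t - - \<phi> (x - 1) t)) / 2"
      unfolding s' by (simp add: field_simps)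
    ultimately show ?thesis by metis
  qed
  then show ?thesis using ode unfolding height_ode_def by simp
qed

lemma smooth_profile_uminus: "smooth_profile n C K P \<Longrightarrow> smooth_profile n C K (\<lambda>x. - P x)"
proof -
  have "slope (\<lambda>x. - P x) e = - slope P e" for e by (simp add: slope_def)
  moreover have "sigma (- u) = - sigma u" for u by (simp add: sigma_def)
  moreover have "\<bar>- u - - v\<bar> = \<bar>u - v\<bar>" for u v :: real by simp
  ultimately show "smooth_profile n C K P \<Longrightarrow> smooth_profile n C K (\<lambda>x. - P x)"
    by (simp add: smooth_profile_def)
qed

text \<open>\<phi> is compared with the linear interpolation \<Psi> of one Euler step. Where \<phi>
  - \<Psi> is maximal, \<phi> has the smaller right slope and the larger left slope, so monotonicity
  of \<open>sigma\<close> bounds its velocity through the slopes of \<Psi>, which are within K / n^2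
  of those of P. Spatial smoothness is thus needed for P only. Over a time 1 / n the error is K /
  n^3.\<close>

lemma ode_step_upper:
  assumes n: "0 < n" and K: "0 \<le> K" and P: "smooth_profile n C K P" and ode: "height_ode n \<phi>" and a: "0 \<le> a"
    and init: "\<And>x. x \<le> n \<Longrightarrow> \<phi> x a - P x \<le> M" and x: "x \<le> n" and t: "t \<in> {a..a + 1 / real n}"
  shows "\<phi> x t - (P x + (t - a) * real n * (euler_step n P x - P x)) \<le> M + K / real n ^ 3"
proof -
  let ?b = "a + 1 / real n"
  define p where "p x = euler_step n P x - P x" for x
  define \<Psi> where "\<Psi> x t = P x + (t - a) * real n * p x" for x t
  define \<phi>' where "\<phi>' x t = (if 0 < x \<and> x < n then (sigma (\<phi> (Suc x) t - \<phi> x t) - sigma (\<phi> x t - \<phi> (x - 1) t)) / 2 else 0)" for x t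
  have pb: "\<bar>p x\<bar> \<le> K / (2 * real n ^ 2)" if "x \<le> n" for x
    unfolding p_def by (rule smooth_step_diff[OF n K P that])
  have p0: "p 0 = 0" "p n = 0" by (simp_all add: p_def euler_step_def)
  have "\<phi> x t - \<Psi> x t \<le> M + K / real n ^ 2 * (t - a)"
  proof (rule maximum_principle[where w = "\<lambda>x t. \<phi> x t - \<Psi> x t" and w' = "\<lambda>x t. \<phi>' x t - real n * p x" and n = n and b = ?b])
    fix x t assume xt: "x \<le> n" "t \<in> {a..?b}"
    have t0: "0 \<le> t" using xt a by simp
    have sub: "{a..?b} \<subseteq> {0..}" using a by auto
    have "(\<phi> x has_real_derivative \<phi>' x t) (at t within {a..?b})"
    proof (cases "0 < x \<and> x < n")
      case True
      then have "(\<phi> x has_real_derivative \<phi>' x t) (at t within {0..})"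
        using ode t0 unfolding height_ode_def \<phi>'_def by auto
      then show ?thesis using sub by (rule DERIV_subset)
    next
      case False
      then have "x = 0 \<or> x = n" using xt by auto
      \<comment> \<open>The equations give derivatives at interior sites only; at the ends the
        derivative is that of the constant 0.\<close>
      then have z: "\<phi> x s = 0" if "s \<in> {a..?b}" for s using ode that a unfolding height_ode_def by auto
      have "((\<lambda>_. 0) has_real_derivative 0) (at t within {a..?b})" by simp
      then have "(\<phi> x has_real_derivative 0) (at t within {a..?b})"
        by (rule has_field_derivative_transform_within[where d = 1]) (use z xt in auto)
      moreover have "\<phi>' x t = 0" using False by (auto simp: \<phi>'_def)
      ultimately show ?thesis by simp
    qed
    then show "((\<lambda>t. \<phi> x t - \<Psi> x t) has_real_derivative \<phi>' x t - real n * p x) (at t within {a..?b})"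
      unfolding \<Psi>_def by (auto intro!: derivative_eq_intros)
    assume max: "\<And>y. y \<le> n \<Longrightarrow> \<phi> y t - \<Psi> y t \<le> \<phi> x t - \<Psi> x t"
    show "\<phi>' x t - real n * p x \<le> K / real n ^ 2"
    proof (cases "0 < x \<and> x < n")
      case True
      then obtain y where y: "x = Suc y" by (cases x) auto
      have tn: "0 \<le> (t - a) * real n" "(t - a) * real n \<le> 1"
      proof -
        show "0 \<le> (t - a) * real n" using xt by simp
        have "(t - a) * real n \<le> (1 / real n) * real n" using xt by (intro mult_right_mono) auto
        then show "(t - a) * real n \<le> 1" using n by simp
      qed
      have sl: "\<bar>(\<Psi> (Suc z) t - \<Psi> z t) - slope P z\<bar> \<le> K / real n ^ 2" if "Suc z \<le> n" for z
      proof -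
        have "\<bar>p (Suc z) - p z\<bar> \<le> K / real n ^ 2" using pb[of z] pb[of "Suc z"] that by simp
        moreover have "(\<Psi> (Suc z) t - \<Psi> z t) - slope P z = ((t - a) * real n) * (p (Suc z) - p z)"
          by (simp add: \<Psi>_def slope_def algebra_simps)
        ultimately have "\<bar>(\<Psi> (Suc z) t - \<Psi> z t) - slope P z\<bar> \<le> 1 * (K / real n ^ 2)"
          using tn by (simp only: abs_mult) (intro mult_mono, auto)
        then show ?thesis by simp
      qed
      have "sigma (\<phi> (Suc x) t - \<phi> x t) \<le> sigma (\<Psi> (Suc x) t - \<Psi> x t)"
        using max[of "Suc x"] True by (intro sigma_mono) simp
      moreover have "\<bar>sigma (\<Psi> (Suc x) t - \<Psi> x t) - sigma (slope P x)\<bar> \<le> K / real n ^ 2"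
        using sigma_lip[of "\<Psi> (Suc x) t - \<Psi> x t" "slope P x"] sl[of x] True by linarith
      moreover have "sigma (\<Psi> x t - \<Psi> y t) \<le> sigma (\<phi> x t - \<phi> y t)"
        using max[of y] True y by (intro sigma_mono) simp
      moreover have "\<bar>sigma (\<Psi> x t - \<Psi> y t) - sigma (slope P y)\<bar> \<le> K / real n ^ 2"
        using sigma_lip[of "\<Psi> x t - \<Psi> y t" "slope P y"] sl[of y] True y by simp
      moreover have "real n * p x = (sigma (slope P x) - sigma (slope P y)) / 2"
        using True n y by (simp add: p_def euler_step_def)
      moreover have "\<phi>' x t = (sigma (\<phi> (Suc x) t - \<phi> x t) - sigma (\<phi> x t - \<phi> y t)) / 2"
        using True y by (simp add: \<phi>'_def)
      moreover have "f - g \<le> c" if "S1 \<le> P1" "\<bar>P1 - s1\<bar> \<le> c" "P2 \<le> S2" "\<bar>P2 - s2\<bar> \<le> c" "g = (s1 - s2) / 2" "f = (S1 - S2) / 2"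
        for f g c S1 S2 P1 P2 s1 s2 :: real
      proof -
        have "S1 \<le> s1 + c" "s2 - c \<le> S2" using that by linarith+
        then show ?thesis unfolding that(5,6) by (simp add: field_simps)
      qed
      ultimately show ?thesis by blast
    next
      case False
      then have "x = 0 \<or> x = n" using xt by auto
      then have "p x = 0" "\<phi>' x t = 0" using p0 by (auto simp: \<phi>'_def)
      then show ?thesis using K by simp
    qed
  qed (use init x t in \<open>auto simp: \<Psi>_def\<close>)
  also have "K / real n ^ 2 * (t - a) \<le> K / real n ^ 2 * (1 / real n)"
    using t K by (intro mult_left_mono) auto
  finally show ?thesis by (simp add: \<Psi>_def p_def power3_eq_cube power2_eq_square)
qed

lemma ode_step:
  assumes n: "0 < n" and K: "0 \<le> K" and P: "smooth_profile n C K P" and ode: "height_ode n \<phi>" and a: "0 \<le> a"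
    and init: "\<And>x. x \<le> n \<Longrightarrow> \<bar>\<phi> x a - P x\<bar> \<le> M" and x: "x \<le> n" and t: "t \<in> {a..a + 1 / real n}"
  shows "\<bar>\<phi> x t - (P x + (t - a) * real n * (euler_step n P x - P x))\<bar> \<le> M + K / real n ^ 3"
proof -
  have i: "\<phi> x a - P x \<le> M" "- \<phi> x a - - P x \<le> M" if "x \<le> n" for x using init[OF that] by auto
  have "\<phi> x t - (P x + (t - a) * real n * (euler_step n P x - P x)) \<le> M + K / real n ^ 3"
    by (rule ode_step_upper[OF n K P ode a i(1) x t])
  moreover have "- \<phi> x t - (- P x + (t - a) * real n * (euler_step n (\<lambda>x. - P x) x - - P x)) \<le> M + K / real n ^ 3"
    by (rule ode_step_upper[OF n K smooth_profile_uminus[OF P] height_ode_uminus[OF ode] a i(2) x t])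
  moreover have "- \<phi> x t - (- P x + (t - a) * real n * (euler_step n (\<lambda>x. - P x) x - - P x))
      = - (\<phi> x t - (P x + (t - a) * real n * (euler_step n P x - P x)))"
    unfolding euler_step_uminus by (simp add: algebra_simps)
  ultimately show ?thesis by linarith
qed

lemma ode_euler:
  assumes n: "0 < n" and K: "0 \<le> K" and P: "smooth_profile n C K P" and ode: "height_ode n \<phi>"
    and init: "\<And>x. x \<le> n \<Longrightarrow> \<bar>\<phi> x 0 - P x\<bar> \<le> M"
  shows "x \<le> n \<Longrightarrow> \<bar>\<phi> x (real k / real n) - euler n P k x\<bar> \<le> M + real k * (K / real n ^ 3)"
proof (induction k arbitrary: x)
  case (Suc k)
  have t: "real (Suc k) / real n \<in> {real k / real n..real k / real n + 1 / real n}"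
    by (simp add: add_divide_distrib divide_right_mono)
  have one: "(real (Suc k) / real n - real k / real n) * real n = 1" using n by (simp add: add_divide_distrib)
  have "\<bar>\<phi> x (real (Suc k) / real n) - (euler n P k x + (real (Suc k) / real n - real k / real n) * real n * (euler_step n (euler n P k) x - euler n P k x))\<bar>
    \<le> (M + real k * (K / real n ^ 3)) + K / real n ^ 3"
    by (rule ode_step[OF n K smooth_euler[OF n K P] ode _ Suc.IH Suc.prems t]) auto
  then show ?case unfolding one by (simp add: euler_Suc algebra_simps add_divide_distrib)
qed (use init in simp)

text \<open>Besides the initial error M there are three contributions: the accumulated error of the
  scheme, the position inside the current step, and the motion of the scheme between step floor (n
  s) and step k.\<close>

lemma ode_euler_time:
  assumes n: "0 < n" and K: "0 \<le> K" and P: "smooth_profile n C K P" and ode: "height_ode n \<phi>"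
    and init: "\<And>x. x \<le> n \<Longrightarrow> \<bar>\<phi> x 0 - P x\<bar> \<le> M" and s: "0 \<le> s" and x: "x \<le> n"
  shows "\<bar>\<phi> x s - euler n P k x\<bar> \<le> M + (real n * s + 1) * (K / real n ^ 3) + (\<bar>real k - real n * s\<bar> + 2) * (K / (2 * real n ^ 2))"
proof -
  define k1 where "k1 = nat \<lfloor>real n * s\<rfloor>"
  have k1: "real k1 \<le> real n * s" "real n * s < real k1 + 1"
    using s unfolding k1_def by (auto simp: of_nat_nat)
  let ?a = "real k1 / real n" and ?e = "euler n P k1 x" and ?D = "K / (2 * real n ^ 2)"
  have t: "s \<in> {?a..?a + 1 / real n}"
  proof -
    have "?a \<le> real n * s / real n" "real n * s / real n \<le> (real k1 + 1) / real n"
      by (rule divide_right_mono; use k1 in simp)+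
    then show ?thesis using n by (simp add: add_divide_distrib)
  qed
  let ?p = "euler_step n (euler n P k1) x - ?e"
  have D0: "0 \<le> ?D" using K by simp
  have 1: "\<bar>\<phi> x s - (?e + (s - ?a) * real n * ?p)\<bar> \<le> (M + real k1 * (K / real n ^ 3)) + K / real n ^ 3"
    by (rule ode_step[OF n K smooth_euler[OF n K P] ode _ ode_euler[OF n K P ode init] x t]) auto
  have p: "\<bar>?p\<bar> \<le> ?D" by (rule smooth_step_diff[OF n K smooth_euler[OF n K P] x])
  have "(s - ?a) * real n = real n * s - real k1" using n by (simp add: left_diff_distrib)
  then have "0 \<le> (s - ?a) * real n" "(s - ?a) * real n \<le> 1" using k1 by simp_all
  then have 2: "\<bar>(s - ?a) * real n * ?p\<bar> \<le> 1 * ?D"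
    unfolding abs_mult[of "(s - ?a) * real n"] using p by (intro mult_mono) auto
  have 3: "\<bar>?e - euler n P k x\<bar> \<le> \<bar>real k1 - real k\<bar> * ?D"
  proof (cases "k \<le> k1")
    case True
    then show ?thesis using euler_time_diff[OF n K P x, of k "k1 - k"] by (simp add: of_nat_diff)
  next
    case False
    then show ?thesis using euler_time_diff[OF n K P x, of k1 "k - k1"] by (simp add: of_nat_diff abs_minus_commute)
  qed
  have "\<bar>real k1 - real k\<bar> \<le> \<bar>real k - real n * s\<bar> + 1" using k1 by linarith
  then have 4: "\<bar>real k1 - real k\<bar> * ?D \<le> (\<bar>real k - real n * s\<bar> + 1) * ?D" by (rule mult_right_mono[OF _ D0])
  have 5: "real k1 * (K / real n ^ 3) \<le> real n * s * (K / real n ^ 3)" using k1 K by (intro mult_right_mono) auto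
  have 6: "(real n * s + 1) * (K / real n ^ 3) = real n * s * (K / real n ^ 3) + K / real n ^ 3"
    "(\<bar>real k - real n * s\<bar> + 2) * ?D = (\<bar>real k - real n * s\<bar> + 1) * ?D + 1 * ?D"
    by (simp_all only: distrib_right mult_1_left)
  have key: "\<bar>f - g\<bar> \<le> M + (k' + c) + (b + 1 * d)"
    if "\<bar>f - (e + q)\<bar> \<le> (M + k) + c" "\<bar>q\<bar> \<le> 1 * d" "\<bar>e - g\<bar> \<le> a" "a \<le> b" "k \<le> k'" for f g k k' c b d e q a :: real
    using that by linarith
  show ?thesis unfolding 6 by (rule key[OF 1 2 3 4 5])
qed

section \<open>Convergence\<close>


lemma within_mean_value:
  fixes f f' :: "real \<Rightarrow> real"
  assumes "\<And>y. y \<in> {a..b} \<Longrightarrow> (f has_real_derivative f' y) (at y within {a..b})" "y \<in> {a..b}" "z \<in> {a..b}" "y < z"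
  obtains \<xi> where "y < \<xi>" "\<xi> < z" "f z - f y = (z - y) * f' \<xi>"
proof -
  have sub: "{y..z} \<subseteq> {a..b}" using assms by auto
  have "\<exists>x\<in>{y<..<z}. f z - f y = (\<lambda>h. h * f' x) (z - y)"
  proof (rule mvt_simple[OF assms(4)])
    fix x assume "y \<le> x" "x \<le> z"
    then have "(f has_real_derivative f' x) (at x within {y..z})"
      using DERIV_subset[OF assms(1) sub] sub by auto
    moreover have "(\<lambda>h. h * f' x) = (*) (f' x)" by (auto simp: mult.commute)
    ultimately show "(f has_derivative (\<lambda>h. h * f' x)) (at x within {y..z})"
      by (simp add: has_field_derivative_def)
  qed
  then show ?thesis using that by auto
qed

lemma within_lipschitz:
  fixes f f' :: "real \<Rightarrow> real"
  assumes "\<And>y. y \<in> {a..b} \<Longrightarrow> (f has_real_derivative f' y) (at y within {a..b})" "\<And>y. y \<in> {a..b} \<Longrightarrow> \<bar>f' y\<bar> \<le> A"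
    and "y \<in> {a..b}" "z \<in> {a..b}"
  shows "\<bar>f z - f y\<bar> \<le> A * \<bar>z - y\<bar>"
proof -
  have *: "\<bar>f z - f y\<bar> \<le> A * \<bar>z - y\<bar>" if yz: "y \<in> {a..b}" "z \<in> {a..b}" "y < z" for y z
  proof -
    obtain \<xi> where x: "y < \<xi>" "\<xi> < z" "f z - f y = (z - y) * f' \<xi>"
      by (rule within_mean_value[OF assms(1) yz])
    then have "\<bar>f' \<xi>\<bar> \<le> A" using yz by (intro assms(2)) auto
    then show ?thesis unfolding x(3) abs_mult using mult_left_mono[of "\<bar>f' \<xi>\<bar>" A "\<bar>z - y\<bar>"] by (simp add: mult.commute)
  qed
  show ?thesis
  proof (cases y z rule: linorder_cases)
    case less
    then show ?thesis using *[OF assms(3,4)] by simp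
  next
    case greater
    then show ?thesis using *[OF assms(4,3)] by (simp add: abs_minus_commute)
  qed simp
qed

text \<open>The grid -1 + 2 x / n, x = 0, ..., n, avoids the kink of the given initial data at the
  right end, at the price of a bounded error.\<close>
lemma initial_profile:
  assumes "C2_on_interval phi0 (-1) 1" and ends: "phi0 (-1) = 0" "phi0 1 = 0"
  shows "\<exists>(C::nat) K. 0 \<le> K \<and> (\<forall>L\<ge>1. \<exists>P. smooth_profile (2 * L + 1) (real C) K P
    \<and> tame (2 * L + 1) (real C) (view L (h_init phi0 L))
    \<and> \<not> steep (2 * L + 1) C 1 (view L (h_init phi0 L)) \<and> \<not> steep (2 * L + 1) C 1 (\<lambda>x. - view L (h_init phi0 L) x)
    \<and> (\<forall>x\<le>2 * L + 1. \<bar>real_of_int (view L (h_init phi0 L) x) - P x\<bar> \<le> real C)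
    \<and> (\<forall>x\<le>2 * L + 1. \<bar>Phi0 phi0 L (int x - int L) - P x\<bar> \<le> real C))"
proof -
  obtain f1 f2 where d1: "\<And>y. y \<in> {-1..1} \<Longrightarrow> (phi0 has_real_derivative f1 y) (at y within {-1..1})"
    and d2: "\<And>y. y \<in> {-1..1} \<Longrightarrow> (f1 has_real_derivative f2 y) (at y within {-1..1})" and c2: "continuous_on {-1..1} f2"
    using assms(1) unfolding C2_on_interval_def by blast
  have bdd: "\<exists>A. \<forall>y\<in>{-1..1}. \<bar>f y\<bar> \<le> A" if "continuous_on {-1..1} f" for f :: "real \<Rightarrow> real"
  proof -
    have "bounded (f ` {-1..1})" by (intro compact_imp_bounded compact_continuous_image that) simp
    then show ?thesis unfolding bounded_iff by auto
  qed
  obtain A where A: "\<And>y. y \<in> {-1..1} \<Longrightarrow> \<bar>f1 y\<bar> \<le> A" using bdd[OF DERIV_continuous_on[OF d2]] by blast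
  obtain B where B: "\<And>y. y \<in> {-1..1} \<Longrightarrow> \<bar>f2 y\<bar> \<le> B" using bdd[OF c2] by blast
  have A0: "0 \<le> A" using A[of 0] by simp
  have B0: "0 \<le> B" using B[of 0] by simp
  have lip: "\<bar>phi0 z - phi0 y\<bar> \<le> A * \<bar>z - y\<bar>" if "y \<in> {-1..1}" "z \<in> {-1..1}" for y z
    by (rule within_lipschitz[OF d1 A that])
  have lip1: "\<bar>f1 z - f1 y\<bar> \<le> B * \<bar>z - y\<bar>" if "y \<in> {-1..1}" "z \<in> {-1..1}" for y z
    by (rule within_lipschitz[OF d2 B that])
  \<comment> \<open>The extra 1 pays for taking integer parts.\<close>
  define C where "C = nat \<lceil>A\<rceil> + 1"
  have C: "A + 1 \<le> real C" unfolding C_def using A0 by (simp add: of_nat_nat) 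
  show ?thesis
  proof (rule exI[of _ C], rule exI[of _ "4 * B"], intro conjI allI impI)
    show "0 \<le> 4 * B" using B0 by simp
    fix L :: nat assume L: "1 \<le> L"
    let ?n = "2 * L + 1"
    have n: "0 < real ?n" and Lr: "0 < real L" "2 * real L \<le> real ?n" using L by auto
    define y where "y x = - 1 + 2 * real x / real ?n" for x
    define P where "P x = real L * phi0 (y x)" for x
    define p where "p x = Phi0 phi0 L (int x - int L)" for x
    define h where "h = view L (h_init phi0 L)"
    have yr: "y x \<in> {-1..1}" if "x \<le> ?n" for x
    proof -
      have "2 * real x / real ?n \<le> 2" using that n by (simp add: pos_divide_le_eq del: of_nat_Suc)
      then show ?thesis by (simp add: y_def)
    qed
    have yS: "y (Suc x) - y x = 2 / real ?n" for x
      by (simp add: y_def diff_divide_distrib[symmetric])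
    have y0: "y 0 = -1" by (simp add: y_def)
    have yn: "y ?n = 1" using n by (simp add: y_def del: of_nat_Suc)
    have sl: "\<bar>slope P e\<bar> \<le> real C" if e: "e < ?n" for e
    proof -
      have "\<bar>phi0 (y (Suc e)) - phi0 (y e)\<bar> \<le> A * \<bar>y (Suc e) - y e\<bar>"
        using e by (intro lip yr) auto
      also have "\<dots> = A * (2 / real ?n)" unfolding yS using n by simp
      finally have f: "\<bar>phi0 (y (Suc e)) - phi0 (y e)\<bar> \<le> A * (2 / real ?n)" .
      have "\<bar>slope P e\<bar> = real L * \<bar>phi0 (y (Suc e)) - phi0 (y e)\<bar>"
        unfolding slope_def P_def right_diff_distrib[symmetric] abs_mult by simp
      also have "\<dots> \<le> real L * (A * (2 / real ?n))" by (rule mult_left_mono[OF f]) simp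
      also have "\<dots> = A * (2 * real L / real ?n)" by simp
      also have "\<dots> \<le> A * 1" using Lr(2) n A0 by (intro mult_left_mono) (auto simp: pos_divide_le_eq)
      finally show ?thesis using C by simp
    qed
    have sd: "\<bar>sigma (slope P x) - sigma (slope P (x - 1))\<bar> \<le> 4 * B / real ?n" if x: "0 < x" "x < ?n" for x
    proof -
      obtain z where z: "x = Suc z" using x by (cases x) auto
      have lt: "y z < y x" "y x < y (Suc x)" using yS[of z] yS[of x] n z by (smt (verit) divide_pos_pos)+
      have r: "y z \<in> {-1..1}" "y x \<in> {-1..1}" "y (Suc x) \<in> {-1..1}" using x z by (auto intro!: yr simp del: atLeastAtMost_iff)
      obtain \<xi> where xi: "y z < \<xi>" "\<xi> < y x" "phi0 (y x) - phi0 (y z) = (y x - y z) * f1 \<xi>"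
        by (rule within_mean_value[OF d1 r(1,2) lt(1)])
      obtain \<zeta> where ze: "y x < \<zeta>" "\<zeta> < y (Suc x)" "phi0 (y (Suc x)) - phi0 (y x) = (y (Suc x) - y x) * f1 \<zeta>"
        by (rule within_mean_value[OF d1 r(2,3) lt(2)])
      \<comment> \<open>The two mean value points lie in adjacent cells of length 2 / n
        each.\<close>
      have "\<bar>f1 \<zeta> - f1 \<xi>\<bar> \<le> B * \<bar>\<zeta> - \<xi>\<bar>" using xi ze r by (intro lip1) auto
      also have "\<dots> \<le> B * (4 / real ?n)"
        using xi(1,2) ze(1,2) yS[of z] yS[of x] z B0 by (intro mult_left_mono) auto
      finally have f: "\<bar>f1 \<zeta> - f1 \<xi>\<bar> \<le> B * (4 / real ?n)" .
      have "slope P x - slope P z = real L * (2 / real ?n) * (f1 \<zeta> - f1 \<xi>)"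
      proof -
        have "slope P x = real L * ((2 / real ?n) * f1 \<zeta>)" "slope P z = real L * ((2 / real ?n) * f1 \<xi>)"
          using ze(3) xi(3) yS[of x] yS[of z] unfolding slope_def P_def z right_diff_distrib[symmetric] by simp_all
        then show ?thesis by (simp only: right_diff_distrib mult.assoc)
      qed
      then have "\<bar>slope P x - slope P z\<bar> = (real L * (2 / real ?n)) * \<bar>f1 \<zeta> - f1 \<xi>\<bar>"
        using Lr n by (simp add: abs_mult)
      also have "\<dots> \<le> 1 * (B * (4 / real ?n))"
        using Lr n f by (intro mult_mono) (auto simp: pos_divide_le_eq)
      finally show ?thesis using sigma_lip[of "slope P x" "slope P z"] z by (simp add: mult.commute)
    qed
    have "P 0 = 0" "P ?n = 0" unfolding P_def y0 yn by (simp_all add: ends)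
    then have P: "smooth_profile ?n (real C) (4 * B) P"
      unfolding smooth_profile_def using sl sd by blast
    have pval: "p x = real L * phi0 (- 1 + real x / real L)" if "x \<le> 2 * L" for x
    proof -
      have "real_of_int (int x - int L) / real L = - 1 + real x / real L" using Lr by (simp add: diff_divide_distrib)
      moreover have "real x \<le> 2 * real L" using that by (metis of_nat_mono of_nat_mult of_nat_numeral)
      then have "- 1 + real x / real L \<le> 1" using Lr by (simp add: pos_divide_le_eq)
      ultimately show ?thesis unfolding p_def Phi0_def phi_ext_def by simp
    qed
    have xr: "- 1 + real x / real L \<in> {-1..1}" if "x \<le> 2 * L" for x
    proof -
      have "real x \<le> 2 * real L" using that by (metis of_nat_mono of_nat_mult of_nat_numeral)
      then show ?thesis using Lr by (simp add: pos_divide_le_eq)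
    qed
    have pn: "p ?n = 0"
    proof -
      have "real_of_int (int ?n - int L) / real L > 1" using Lr by (simp add: pos_less_divide_eq)
      then show ?thesis unfolding p_def Phi0_def phi_ext_def by simp
    qed
    have p2L: "p (2 * L) = 0" using pval[of "2 * L"] Lr ends by simp
    have p0: "p 0 = 0" using pval[of 0] ends by simp
    \<comment> \<open>The last edge is flat: the data vanish at site 2 L, where the argument of phi0
      is 1, and at site 2 L + 1 by the extension.\<close>
    have pstep: "\<bar>p (Suc x) - p x\<bar> \<le> A" if x: "x < ?n" for x
    proof (cases "x = 2 * L")
      case True
      then show ?thesis using pn p2L A0 by simp
    next
      case False
      then have x: "x \<le> 2 * L" "Suc x \<le> 2 * L" using x by auto
      have "\<bar>phi0 (- 1 + real (Suc x) / real L) - phi0 (- 1 + real x / real L)\<bar> \<le> A * \<bar>(- 1 + real (Suc x) / real L) - (- 1 + real x / real L)\<bar>"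
        by (intro lip xr x)
      also have "\<dots> = A * (1 / real L)" using Lr by (simp add: diff_divide_distrib[symmetric])
      finally have "real L * \<bar>phi0 (- 1 + real (Suc x) / real L) - phi0 (- 1 + real x / real L)\<bar> \<le> real L * (A * (1 / real L))"
        by (rule mult_left_mono) simp
      then show ?thesis unfolding pval[OF x(1)] pval[OF x(2)] right_diff_distrib[symmetric] abs_mult using Lr by simp
    qed
    have pP: "\<bar>p x - P x\<bar> \<le> A" if x: "x \<le> ?n" for x
    proof (cases "x = ?n")
      case True
      then show ?thesis using pn yn ends A0 by (simp add: P_def)
    next
      case False
      then have x: "x \<le> 2 * L" using x by simp
      have "\<bar>phi0 (- 1 + real x / real L) - phi0 (y x)\<bar> \<le> A * \<bar>(- 1 + real x / real L) - y x\<bar>"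
        using x by (intro lip xr yr) auto
      \<comment> \<open>The two grids differ by at most 1 / L, which after multiplication by L is a
        bounded error in height.\<close>
      also have "(- 1 + real x / real L) - y x = real x / (real L * real ?n)"
        using Lr n by (simp add: y_def field_simps)
      also have "A * \<bar>real x / (real L * real ?n)\<bar> \<le> A * (1 / real L)"
      proof (intro mult_left_mono A0)
        have "real x \<le> real ?n" using x by simp
        then have "real x / (real L * real ?n) \<le> real ?n / (real L * real ?n)" by (intro divide_right_mono) auto
        also have "\<dots> = 1 / real L" using n by (simp del: of_nat_Suc)
        finally show "\<bar>real x / (real L * real ?n)\<bar> \<le> 1 / real L" using Lr n by (simp add: abs_mult)
      qed
      finally have "real L * \<bar>phi0 (- 1 + real x / real L) - phi0 (y x)\<bar> \<le> real L * (A * (1 / real L))"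
        by (rule mult_left_mono) simp
      then show ?thesis unfolding pval[OF x(1)] P_def right_diff_distrib[symmetric] abs_mult using Lr by simp
    qed
    have hp: "h x = \<lfloor>p x\<rfloor>" if "x \<le> ?n" for x
      using that by (simp add: h_def view_def h_init_def p_def)
    have hb: "real_of_int (h x) \<le> p x" "p x \<le> real_of_int (h x) + 1" if "x \<le> ?n" for x
      unfolding hp[OF that] by linarith+
    have plip: "\<bar>p b - p a\<bar> \<le> A * (real b - real a)" if "a \<le> b" "b \<le> ?n" for a b
      by (rule slope_bound_diff[OF _ that]) (use pstep in \<open>simp add: slope_def\<close>)
    have AC: "A * (real b - real a) \<le> real C * (real b - real a)" if "a \<le> b" for a b
      using that C by (intro mult_right_mono) auto
    have st: "\<not> steep ?n C 1 h" "\<not> steep ?n C 1 (\<lambda>x. - h x)"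
    proof -
      have "real_of_int (h b - h a) \<le> real C * (real b - real a) + 1 \<and> real_of_int (- h b - - h a) \<le> real C * (real b - real a) + 1"
        if ab: "a \<le> b" "b \<le> ?n" for a b
      proof -
        have M: "\<bar>p b - p a\<bar> \<le> real C * (real b - real a)" using plip[OF ab] AC[OF ab(1)] by (rule order_trans)
        have hh: "real_of_int (h a) \<le> p a" "p a \<le> real_of_int (h a) + 1" "real_of_int (h b) \<le> p b" "p b \<le> real_of_int (h b) + 1"
          using hb ab by auto
        have "u - v \<le> m + 1 \<and> v - u \<le> m + 1" if "\<bar>q - r\<bar> \<le> m" "v \<le> r" "r \<le> v + 1" "u \<le> q" "q \<le> u + 1" for u v q r m :: real
          using that by linarith
        from this[OF M hh] show ?thesis by simp
      qed
      then show "\<not> steep ?n C 1 h" "\<not> steep ?n C 1 (\<lambda>x. - h x)" unfolding steep_def by (auto simp: not_less)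
    qed
    have tm: "tame ?n (real C) h"
    proof -
      have "real_of_int (tv ?n h) = (\<Sum>e<?n. real_of_int \<bar>h (Suc e) - h e\<bar>)" by (simp only: tv_def of_int_sum)
      also have "\<dots> \<le> (\<Sum>e<?n. real C)"
      proof (rule sum_mono)
        fix e assume "e \<in> {..<?n}"
        then have "\<bar>p (Suc e) - p e\<bar> \<le> A" "real_of_int (h e) \<le> p e" "p e \<le> real_of_int (h e) + 1"
          "real_of_int (h (Suc e)) \<le> p (Suc e)" "p (Suc e) \<le> real_of_int (h (Suc e)) + 1"
          using pstep[of e] hb[of e] hb[of "Suc e"] by auto
        then have "\<bar>real_of_int (h (Suc e)) - real_of_int (h e)\<bar> \<le> A + 1" by linarith
        then show "real_of_int \<bar>h (Suc e) - h e\<bar> \<le> real C" using C by simp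
      qed
      also have "\<dots> = real C * real ?n" by simp
      finally show ?thesis unfolding tame_def using hp[of 0] hp[of ?n] p0 pn by simp
    qed
    have cl: "\<bar>real_of_int (h x) - P x\<bar> \<le> real C" if "x \<le> ?n" for x
      using hb[OF that] pP[OF that] C by linarith
    have cl': "\<bar>p x - P x\<bar> \<le> real C" if "x \<le> ?n" for x using pP[OF that] C by linarith
    show "\<exists>P. smooth_profile ?n (real C) (4 * B) P
      \<and> tame ?n (real C) (view L (h_init phi0 L))
      \<and> \<not> steep ?n C 1 (view L (h_init phi0 L)) \<and> \<not> steep ?n C 1 (\<lambda>x. - view L (h_init phi0 L) x)
      \<and> (\<forall>x\<le>?n. \<bar>real_of_int (view L (h_init phi0 L) x) - P x\<bar> \<le> real C)
      \<and> (\<forall>x\<le>?n. \<bar>Phi0 phi0 L (int x - int L) - P x\<bar> \<le> real C)"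
      unfolding h_def[symmetric] p_def[symmetric] using P tm st cl cl' by blast
  qed
qed

lemma solves_ODE_view:
  assumes "solves_ODE phi0 L \<Phi>"
  shows "height_ode (2 * L + 1) (\<lambda>x t. \<Phi> (int x - int L) t)"
  unfolding height_ode_def
proof (intro conjI allI impI)
  have e: "int (2 * L + 1) - int L = int L + 1" by simp
  show "\<Phi> (int 0 - int L) t = 0" "\<Phi> (int (2 * L + 1) - int L) t = 0" if "0 \<le> t" for t
    using assms that unfolding solves_ODE_def e by auto
  fix x t assume x: "0 < x" "x < 2 * L + 1" and t: "0 \<le> (t :: real)"
  have "int x - int L \<in> {- int L + 1..int L}" using x by auto
  then have D: "(\<Phi> (int x - int L) has_real_derivative 1 / 2 * (sigma (\<Phi> (int x - int L + 1) t - \<Phi> (int x - int L) t) - sigma (\<Phi> (int x - int L) t - \<Phi> (int x - int L - 1) t))) (at t within {0..})"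
    using assms t unfolding solves_ODE_def by blast
  have e12: "int x - int L + 1 = int (Suc x) - int L" "int x - int L - 1 = int (x - 1) - int L" using x by auto
  show "(\<Phi> (int x - int L) has_real_derivative (sigma (\<Phi> (int (Suc x) - int L) t - \<Phi> (int x - int L) t) - sigma (\<Phi> (int x - int L) t - \<Phi> (int (x - 1) - int L) t)) / 2) (at t within {0..})"
    using D unfolding e12 by (simp only: times_divide_eq_left mult_1_left)
qed

lemma Max_deviation_view:
  assumes "0 < L"
  shows "Max ((\<lambda>x. \<bar>real_of_int (h x) - F x\<bar> / real L) ` {- int L..int L + 1}) > \<epsilon>
    \<longleftrightarrow> (\<exists>k\<le>2 * L + 1. \<bar>real_of_int (view L h k) - F (int k - int L)\<bar> > \<epsilon> * real L)"
proof -
  have "Max ((\<lambda>x. \<bar>real_of_int (h x) - F x\<bar> / real L) ` {- int L..int L + 1}) > \<epsilon>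
    \<longleftrightarrow> (\<exists>x\<in>{- int L..int L + 1}. \<bar>real_of_int (h x) - F x\<bar> / real L > \<epsilon>)"
    by (subst Max_gr_iff) auto
  also have "\<dots> \<longleftrightarrow> (\<exists>x\<in>{- int L..int L + 1}. \<bar>real_of_int (h x) - F x\<bar> > \<epsilon> * real L)"
    using assms by (simp add: pos_less_divide_eq)
  also have "\<dots> \<longleftrightarrow> (\<exists>k\<le>2 * L + 1. \<bar>real_of_int (view L h k) - F (int k - int L)\<bar> > \<epsilon> * real L)"
  proof
    assume "\<exists>x\<in>{- int L..int L + 1}. \<bar>real_of_int (h x) - F x\<bar> > \<epsilon> * real L"
    then obtain x where "x \<in> {- int L..int L + 1}" "\<bar>real_of_int (h x) - F x\<bar> > \<epsilon> * real L" by blast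
    then show "\<exists>k\<le>2 * L + 1. \<bar>real_of_int (view L h k) - F (int k - int L)\<bar> > \<epsilon> * real L"
      by (intro exI[of _ "nat (x + int L)"]) (auto simp: view_def)
  next
    assume "\<exists>k\<le>2 * L + 1. \<bar>real_of_int (view L h k) - F (int k - int L)\<bar> > \<epsilon> * real L"
    then obtain k where "k \<le> 2 * L + 1" "\<bar>real_of_int (view L h k) - F (int k - int L)\<bar> > \<epsilon> * real L" by blast
    then show "\<exists>x\<in>{- int L..int L + 1}. \<bar>real_of_int (h x) - F x\<bar> > \<epsilon> * real L"
      by (intro bexI[of _ "int k - int L"]) (auto simp: view_def)
  qed
  finally show ?thesis .
qed

theorem theorem3p2:
  fixes phi0 :: "real \<Rightarrow> real" and Phi :: "nat \<Rightarrow> int \<Rightarrow> real \<Rightarrow> real"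
  assumes "C2_on_interval phi0 (-1) 1"
    and "phi0 (-1) = 0" and "phi0 1 = 0"
    and "piecewise_monotone phi0 (-1) 1"
    and "\<And>L. solves_ODE phi0 L (Phi L)"
  shows "\<forall>t\<ge>0. \<forall>\<epsilon>>0.
    (\<lambda>L. chain_prob L (h_init phi0 L) (real L ^ 2 * t)
       {h. Max ((\<lambda>x. \<bar>real_of_int (h x) - Phi L x (real L ^ 2 * t)\<bar> / real L) ` {-int L .. int L + 1}) > \<epsilon>})
    \<longlonglongrightarrow> 0"
proof (intro allI impI)
  fix t \<epsilon> :: real assume t: "0 \<le> t" and ep: "0 < \<epsilon>"
  obtain C :: nat and K where K: "0 \<le> K" and ini: "\<forall>L\<ge>1. \<exists>P. smooth_profile (2 * L + 1) (real C) K P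
    \<and> tame (2 * L + 1) (real C) (view L (h_init phi0 L))
    \<and> \<not> steep (2 * L + 1) C 1 (view L (h_init phi0 L)) \<and> \<not> steep (2 * L + 1) C 1 (\<lambda>x. - view L (h_init phi0 L) x)
    \<and> (\<forall>x\<le>2 * L + 1. \<bar>real_of_int (view L (h_init phi0 L) x) - P x\<bar> \<le> real C)
    \<and> (\<forall>x\<le>2 * L + 1. \<bar>Phi0 phi0 L (int x - int L) - P x\<bar> \<le> real C)"
    using initial_profile[OF assms(1-3)] by (elim exE conjE) (rule that)
  let ?p = "\<lambda>L. chain_prob L (h_init phi0 L) (real L ^ 2 * t)
       {h. Max ((\<lambda>x. \<bar>real_of_int (h x) - Phi L x (real L ^ 2 * t)\<bar> / real L) ` {-int L .. int L + 1}) > \<epsilon>}"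
  \<comment> \<open>As n \<le> 3 L, the choice gives 6 \<kappa> n \<le> \<epsilon> L. Of the 6, 4
    are spent on the distance of the chain to the Euler scheme and 2 on that of the scheme to the
    differential equations.\<close>
  define \<kappa> where "\<kappa> = min 1 (\<epsilon> / 18)"
  have ka: "0 < \<kappa>" "\<kappa> \<le> 1" "18 * \<kappa> \<le> \<epsilon>" using ep by (auto simp: \<kappa>_def)
  \<comment> \<open>The window of move numbers has radius \<rho> n^3; across it the Euler scheme
    moves by at most \<rho> K n / 2, which is below \<kappa> n.\<close>
  define \<rho> where "\<rho> = \<kappa> / (K + 1)"
  have rho: "0 < \<rho>" "\<rho> * K \<le> \<kappa>" using ka K by (auto simp: \<rho>_def field_simps)
  have T: "0 \<le> t + \<rho>" using t rho by simp
  show "?p \<longlonglongrightarrow> 0"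
  proof (rule LIMSEQ_I)
    fix \<delta> :: real assume de: "0 < \<delta>"
    have d2: "0 < \<delta> / 2" using de by simp
    obtain n0 where n0: "n0 > 0" "\<forall>n\<ge>n0. \<forall>P h k. smooth_profile n (real C) K P \<longrightarrow> tame n (real C) h \<longrightarrow>
      \<not> steep n C 1 h \<longrightarrow> \<not> steep n C 1 (\<lambda>x. - h x) \<longrightarrow> (\<forall>x\<le>n. \<bar>real_of_int (h x) - P x\<bar> \<le> real C) \<longrightarrow> real k \<le> (t + \<rho>) * real n ^ 3 \<longrightarrow>
      run n (move n) k (\<lambda>h. of_bool (\<exists>x\<le>n. \<bar>real_of_int (h x) - euler n P k x\<bar> > 4 * \<kappa> * real n)) h \<le> \<delta> / 2"
      using sup_deviation[OF d2 ka(1,2) K T, of C] by (elim exE conjE) (rule that)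
    \<comment> \<open>The first term makes the bounded errors fit into \<kappa> n, the second makes
      the Poisson tail smaller than \<delta> / 2.\<close>
    obtain n1 where n1: "real n1 > (real C + (t + 1) * K + K) / \<kappa> + 2 * t / (\<rho>^2 * \<delta>)" using reals_Archimedean2 by blast
    show "\<exists>no. \<forall>L\<ge>no. norm (?p L - 0) < \<delta>"
    proof (rule exI[of _ "max n0 n1 + 1"], intro allI impI)
      fix L assume L: "max n0 n1 + 1 \<le> L"
      let ?n = "2 * L + 1" and ?s = "real L ^ 2 * t"
      have L1: "1 \<le> L" "0 < L" "n0 \<le> ?n" "0 < ?n" using L by auto
      have nr1: "1 \<le> real ?n" and Ln: "2 * real L \<le> real ?n" "real ?n \<le> 3 * real L" using L1 by auto
      have "real n1 \<le> real ?n" using L by (intro of_nat_mono) simp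
      moreover have "0 \<le> (real C + (t + 1) * K + K) / \<kappa>" "0 \<le> 2 * t / (\<rho>^2 * \<delta>)" using t K ka de by auto
      ultimately have big: "(real C + (t + 1) * K + K) / \<kappa> < real ?n" "2 * t / (\<rho>^2 * \<delta>) < real ?n" using n1 by linarith+
      obtain P where P: "smooth_profile ?n (real C) K P" "tame ?n (real C) (view L (h_init phi0 L))"
        "\<not> steep ?n C 1 (view L (h_init phi0 L))" "\<not> steep ?n C 1 (\<lambda>x. - view L (h_init phi0 L) x)"
        "\<forall>x\<le>?n. \<bar>real_of_int (view L (h_init phi0 L) x) - P x\<bar> \<le> real C"
        "\<forall>x\<le>?n. \<bar>Phi0 phi0 L (int x - int L) - P x\<bar> \<le> real C"
        using ini[rule_format, OF L1(1)] by (elim exE conjE) (rule that)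
      define \<phi> where "\<phi> = (\<lambda>x s. Phi L (int x - int L) s)"
      have ode: "height_ode ?n \<phi>" unfolding \<phi>_def by (rule solves_ODE_view[OF assms(5)])
      have ode0: "\<bar>\<phi> x 0 - P x\<bar> \<le> real C" if "x \<le> ?n" for x
      proof -
        have "int x - int L \<in> {- int L..int L + 1}" using that by auto
        then have "\<phi> x 0 = Phi0 phi0 L (int x - int L)" using assms(5)[of L] unfolding solves_ODE_def \<phi>_def by blast
        then show ?thesis using P(6) that by simp
      qed
      have s: "0 \<le> ?s" using t by simp
      have ns: "real ?n * ?s \<le> t * real ?n ^ 3"
      proof -
        have "real L ^ 2 \<le> real ?n ^ 2" using L1 by (intro power_mono) auto
        then have "real ?n * t * real L ^ 2 \<le> real ?n * t * real ?n ^ 2" using t by (intro mult_left_mono) auto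
        then show ?thesis by (simp only: power3_eq_cube power2_eq_square mult.assoc mult.commute mult.left_commute)
      qed
      define r where "r = \<rho> * real ?n ^ 3"
      have r: "0 < r" unfolding r_def using rho nr1 by (intro mult_pos_pos zero_less_power) auto
      define Q where "Q = (\<lambda>v :: nat \<Rightarrow> int. \<exists>k\<le>?n. \<bar>real_of_int (v k) - \<phi> k ?s\<bar> > \<epsilon> * real L)"
      have near: "run ?n (move ?n) k (\<lambda>v. of_bool (Q v)) (view L (h_init phi0 L)) \<le> \<delta> / 2"
        if k: "\<bar>real k - real ?n * ?s\<bar> \<le> r" for k
      proof -
        have kT: "real k \<le> (t + \<rho>) * real ?n ^ 3" using k ns unfolding r_def distrib_right by linarith
        have dev: "\<bar>\<phi> x ?s - euler ?n P k x\<bar> \<le> 2 * \<kappa> * real ?n" if x: "x \<le> ?n" for x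
        proof -
          have n3: "1 \<le> real ?n ^ 3" by (rule one_le_power[OF nr1])
          have n2: "1 \<le> real ?n ^ 2" by (rule one_le_power[OF nr1])
          have "(real ?n * ?s + 1) * (K / real ?n ^ 3) \<le> ((t + 1) * real ?n ^ 3) * (K / real ?n ^ 3)"
          proof (rule mult_right_mono)
            show "real ?n * ?s + 1 \<le> (t + 1) * real ?n ^ 3" unfolding distrib_right[of t] using ns n3 by linarith
          qed (use K in simp)
          also have "\<dots> = (t + 1) * K" using n3 by simp
          finally have 1: "(real ?n * ?s + 1) * (K / real ?n ^ 3) \<le> (t + 1) * K" .
          have "(\<bar>real k - real ?n * ?s\<bar> + 2) * (K / (2 * real ?n ^ 2)) \<le> (r + 2) * (K / (2 * real ?n ^ 2))"
            using k K by (intro mult_right_mono) auto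
          also have "\<dots> = \<rho> * K * real ?n / 2 + K / real ?n ^ 2"
            using nr1 unfolding r_def distrib_right by (simp add: power3_eq_cube power2_eq_square del: of_nat_Suc of_nat_add of_nat_mult)
          also have "\<dots> \<le> \<kappa> * real ?n + K"
          proof (rule add_mono)
            have "\<rho> * K * real ?n \<le> \<kappa> * real ?n" "0 \<le> \<kappa> * real ?n" using rho ka by (auto intro: mult_right_mono)
            then show "\<rho> * K * real ?n / 2 \<le> \<kappa> * real ?n" by linarith
            show "K / real ?n ^ 2 \<le> K" using n2 K by (simp add: divide_le_eq mult_le_cancel_left1 del: of_nat_Suc of_nat_add of_nat_mult)
          qed
          finally have 2: "(\<bar>real k - real ?n * ?s\<bar> + 2) * (K / (2 * real ?n ^ 2)) \<le> \<kappa> * real ?n + K" .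
          have 3: "real C + (t + 1) * K + K \<le> \<kappa> * real ?n"
            using big(1) ka(1) by (simp add: pos_divide_less_eq mult.commute)
          have "\<bar>\<phi> x ?s - euler ?n P k x\<bar> \<le> real C + (real ?n * ?s + 1) * (K / real ?n ^ 3) + (\<bar>real k - real ?n * ?s\<bar> + 2) * (K / (2 * real ?n ^ 2))"
            by (rule ode_euler_time[OF L1(4) K P(1) ode ode0 s x])
          also have "\<dots> \<le> real C + (t + 1) * K + (\<kappa> * real ?n + K)" by (intro add_mono order_refl 1 2)
          also have "\<dots> \<le> \<kappa> * real ?n + \<kappa> * real ?n" using 3 by linarith
          finally show ?thesis by (simp only: mult_2 distrib_right)
        qed
        have imp: "\<exists>x\<le>?n. \<bar>real_of_int (v x) - euler ?n P k x\<bar> > 4 * \<kappa> * real ?n" if Q: "Q v" for v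
        proof -
          obtain x where x: "x \<le> ?n" "\<bar>real_of_int (v x) - \<phi> x ?s\<bar> > \<epsilon> * real L" using Q unfolding Q_def by blast
          have "18 * \<kappa> * real L \<le> \<epsilon> * real L" using ka by (intro mult_right_mono) auto
          moreover have "\<kappa> * real ?n \<le> \<kappa> * (3 * real L)" using Ln ka by (intro mult_left_mono) auto
          ultimately have "6 * (\<kappa> * real ?n) \<le> \<epsilon> * real L" by linarith
          then have "\<bar>real_of_int (v x) - euler ?n P k x\<bar> > 4 * \<kappa> * real ?n" using dev[OF x(1)] x(2) by linarith
          then show ?thesis using x(1) by blast
        qed
        have "run ?n (move ?n) k (\<lambda>v. of_bool (Q v)) (view L (h_init phi0 L))
          \<le> run ?n (move ?n) k (\<lambda>v. of_bool (\<exists>x\<le>?n. \<bar>real_of_int (v x) - euler ?n P k x\<bar> > 4 * \<kappa> * real ?n)) (view L (h_init phi0 L))"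
          by (rule run_mono[where I = "\<lambda>_. True"]) (use imp in \<open>auto simp del: of_nat_Suc of_nat_add of_nat_mult\<close>)
        also have "\<dots> \<le> \<delta> / 2" by (rule n0(2)[rule_format, OF L1(3) P(1-4) P(5)[rule_format] kT])
        finally show ?thesis .
      qed
      have Qeq: "h \<in> {h. Max ((\<lambda>x. \<bar>real_of_int (h x) - Phi L x ?s\<bar> / real L) ` {-int L .. int L + 1}) > \<epsilon>} \<longleftrightarrow> Q (view L h)" for h
        unfolding mem_Collect_eq Q_def \<phi>_def by (rule Max_deviation_view[OF L1(2)])
      have d20: "0 \<le> \<delta> / 2" using de by simp
      have up: "?p L \<le> \<delta> / 2 + real ?n * ?s / r^2" by (rule chain_prob_le(2)[OF Qeq s r d20 near])
      have lo: "0 \<le> ?p L" by (rule chain_prob_le(1)[OF Qeq s r d20 near])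
      \<comment> \<open>The Poisson mean is at most t n^3, while r^2 = \<rho>^2 n^6.\<close>
      have small: "real ?n * ?s / r^2 < \<delta> / 2"
      proof -
        have "real ?n * ?s / r^2 \<le> (t * real ?n ^ 3) / r^2" by (rule divide_right_mono[OF ns]) simp
        also have "\<dots> = t / \<rho>^2 / real ?n ^ 3"
          using nr1 unfolding r_def by (simp add: power_mult_distrib power2_eq_square del: of_nat_Suc of_nat_add of_nat_mult)
        also have "\<dots> \<le> t / \<rho>^2 / real ?n"
          using nr1 t self_le_power[OF nr1, of 3] by (intro divide_left_mono) auto
        also have "\<dots> < \<delta> / 2"
        proof -
          have "2 * t < real ?n * (\<rho>^2 * \<delta>)" using big(2) rho de by (subst (asm) pos_divide_less_eq) auto
          then show ?thesis using rho nr1 by (simp add: pos_divide_less_eq mult_ac del: of_nat_Suc of_nat_add of_nat_mult)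
        qed
        finally show ?thesis .
      qed
      have "?p L < \<delta>" using up small by linarith
      then show "norm (?p L - 0) < \<delta>" using lo by (simp only: diff_0_right real_norm_def abs_of_nonneg)
    qed
  qed
qed

end
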